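(* Let $\Omega^\pm \subseteq \mathbb{R}^d$ be open convex sets and let $\mu^\pm$ be absolutely continuous probability measures with $L^\infty$ densities, compactly supported in $\Omega^\pm$ respectively. Assume that the cost $c$ is $\mathscr{C}^2$ on $\Omega^- \times \Omega^+$ and infinitesimally twisted. Then, as $\varepsilon \downarrow 0$, \[ v_\varepsilon = v_0 + \frac{d}{2}\varepsilon \log(1/\varepsilon)+ O(\varepsilon). \]
   Context: Let $X^\pm = \operatorname{spt}\mu^\pm$ and let $\Pi(\mu^-,\mu^+)$ be the set of probability measures on $X^-\times X^+$ with marginals $\mu^-$ and $\mu^+$. For probability measures $p,q$, the relative entropy is $\mathrm{Ent}(p\,|\,q)=\int \rho\log\rho\,\mathrm{d}q$ if $p=\rho q$, and $+\infty$ otherwise. For $\varepsilon>0$, \[v_\varepsilon \coloneqq \inf_{\gamma\in\Pi(\mu^-,\mu^+)}\Big\{\int c\,\mathrm{d}\gamma + \varepsilon\,\mathrm{Ent}(\gamma\,|\,\mu^-\otimes\mu^+)\Big\},\qquad v_0\coloneqq \inf_{\gamma\in\Pi(\mu^-,\mu^+)}\int c\,\mathrm{d}\gamma.\] A cost $c\in\mathscr{C}^2(\Omega^-\times\Omega^+)$ is infinitesimally twisted if the matrix $\nabla^2_{xy}c(x,y)=(\partial^2_{x_iy_j}c(x,y))_{i,j}$ is invertible for every $(x,y)\in\Omega^-\times\Omega^+$. *)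

theory Defs
  imports "HOL-Probability.Probability"
begin

definition spt :: "'a::metric_space measure \<Rightarrow> 'a set" where
  "spt \<mu> = {x. \<forall>e>0. emeasure \<mu> (ball x e) \<noteq> 0}"

text \<open>Relative entropy Ent(p | q) = int rho log rho dq if p = rho q, and +infinity otherwise.
  The integral is the (extended) difference of the integrals of positive and negative parts.\<close>
definition Ent :: "'a measure \<Rightarrow> 'a measure \<Rightarrow> ereal" where
  "Ent p q = (if sets p = sets q \<and> absolutely_continuous q p then
     (let \<rho> = (\<lambda>x. enn2real (RN_deriv q p x)) in
        enn2ereal (\<integral>\<^sup>+x. ennreal (\<rho> x * ln (\<rho> x)) \<partial>q)
      - enn2ereal (\<integral>\<^sup>+x. ennreal (- (\<rho> x * ln (\<rho> x))) \<partial>q))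
   else \<infinity>)"

definition couplings :: "('a::metric_space) measure \<Rightarrow> ('b::metric_space) measure \<Rightarrow> ('a \<times> 'b) measure set" where
  "couplings \<mu>m \<mu>p = {\<gamma>. prob_space \<gamma> \<and> sets \<gamma> = sets borel
      \<and> emeasure \<gamma> (UNIV - spt \<mu>m \<times> spt \<mu>p) = 0
      \<and> distr \<gamma> borel fst = \<mu>m \<and> distr \<gamma> borel snd = \<mu>p}"

definition transport_cost :: "('a::metric_space) measure \<Rightarrow> ('b::metric_space) measure \<Rightarrow> ('a \<times> 'b \<Rightarrow> real) \<Rightarrow> ('a \<times> 'b) measure \<Rightarrow> real" where
  "transport_cost \<mu>m \<mu>p c \<gamma> = (\<integral>z\<in>(spt \<mu>m \<times> spt \<mu>p). c z \<partial>\<gamma>)"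

definition v_eps :: "('a::metric_space) measure \<Rightarrow> ('b::metric_space) measure \<Rightarrow> ('a \<times> 'b \<Rightarrow> real) \<Rightarrow> real \<Rightarrow> ereal" where
  "v_eps \<mu>m \<mu>p c \<epsilon> = (INF \<gamma>\<in>couplings \<mu>m \<mu>p.
      ereal (transport_cost \<mu>m \<mu>p c \<gamma>) + ereal \<epsilon> * Ent \<gamma> (\<mu>m \<Otimes>\<^sub>M \<mu>p))"

definition v_zero :: "('a::metric_space) measure \<Rightarrow> ('b::metric_space) measure \<Rightarrow> ('a \<times> 'b \<Rightarrow> real) \<Rightarrow> ereal" where
  "v_zero \<mu>m \<mu>p c = (INF \<gamma>\<in>couplings \<mu>m \<mu>p. ereal (transport_cost \<mu>m \<mu>p c \<gamma>))"

definition second_derivs :: "'b::real_normed_vector set \<Rightarrow> ('b \<Rightarrow> real) \<Rightarrow> ('b \<Rightarrow> ('b \<Rightarrow>\<^sub>L real))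
     \<Rightarrow> ('b \<Rightarrow> ('b \<Rightarrow>\<^sub>L ('b \<Rightarrow>\<^sub>L real))) \<Rightarrow> bool" where
  "second_derivs S f f' f'' \<longleftrightarrow>
     (\<forall>z\<in>S. (f has_derivative blinfun_apply (f' z)) (at z)) \<and>
     (\<forall>z\<in>S. (f' has_derivative blinfun_apply (f'' z)) (at z))"

definition C2_on :: "'b::real_normed_vector set \<Rightarrow> ('b \<Rightarrow> real) \<Rightarrow> bool" where
  "C2_on S f \<longleftrightarrow> (\<exists>f' f''. second_derivs S f f' f'' \<and> continuous_on S f'')"

definition mixed_hessian :: "((real^'n) \<times> (real^'n) \<Rightarrow> (((real^'n) \<times> (real^'n)) \<Rightarrow>\<^sub>L (((real^'n) \<times> (real^'n)) \<Rightarrow>\<^sub>L real)))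
     \<Rightarrow> real^'n \<Rightarrow> real^'n \<Rightarrow> real^'n^'n" where
  "mixed_hessian c'' x y = (\<chi> i j. blinfun_apply (blinfun_apply (c'' (x, y)) (axis i 1, 0)) (0, axis j 1))"

definition infinitesimally_twisted :: "(real^'n) set \<Rightarrow> (real^'n) set \<Rightarrow> ((real^'n) \<times> (real^'n) \<Rightarrow> real) \<Rightarrow> bool" where
  "infinitesimally_twisted \<Omega>m \<Omega>p c \<longleftrightarrow>
     (\<forall>c' c''. second_derivs (\<Omega>m \<times> \<Omega>p) c c' c'' \<longrightarrow>
        (\<forall>x\<in>\<Omega>m. \<forall>y\<in>\<Omega>p. invertible (mixed_hessian c'' x y)))"

end

theory Submission
  imports Defs
begin

text \<open>
  Neither optimal plans nor exact Kantorovich potentials are needed: for each \<epsilon>, discretising the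
  marginals gives potentials with \<open>\<phi> \<oplus> \<psi> \<le> c\<close> and a plan whose cost exceeds \<open>\<integral>\<phi> + \<integral>\<psi>\<close> by at most
  \<epsilon>. Put \<open>E = c - \<phi> \<oplus> \<psi> \<ge> 0\<close>.

  Lower bound: by Gibbs' principle it suffices that \<open>\<integral>exp (- E / \<epsilon>) \<le> C \<epsilon>^(d/2)\<close>. Nonnegativity of \<open>E\<close>
  bounds \<open>E (x, y) + E (x', y')\<close> from below by the mixed second difference of \<open>c\<close>, which by the twist
  condition is at least \<open>|x - x'|\<^sup>2 / 2\<close> along the slices \<open>y = T x + w\<close>; so on each slice \<open>E\<close> is
  quadratically detached from its near-minimiser, and a Gaussian integral remains.

  Upper bound: block a near-optimal plan on cells of size \<open>\<surd>\<epsilon>\<close> in the target, which costs entropy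
  \<open>d/2 log (1/\<epsilon>) + O(1)\<close>. With \<psi> an inf-convolution of \<open>c\<close>, hence semiconcave, moving mass within a cell
  raises \<open>E\<close> by second differences of \<psi> at scale \<open>\<surd>\<epsilon>\<close>; these are signed up to \<open>O(\<epsilon>)\<close>, so moving them
  onto a cutoff shows that their integral is \<open>O(\<epsilon>)\<close>.
\<close>

section \<open>Duality for finite transport problems\<close>

text \<open>The potentials change with \<epsilon> and come with no regularity and no bound uniform
  in \<epsilon>, so every constant has to be fixed before they are chosen and may depend only on
  \<open>c\<close>, the supports and the density bound \<open>M\<close>. This shapes the statements:
  the Laplace bound is uniform over all measurable pairs below \<open>c\<close>, and the upper bound
  uses only what an infimum of the functions \<open>c (x, y) - \<phi> x\<close> inherits from
  \<open>c\<close>, namely oscillation and semiconcavity in \<open>y\<close>. Potentials with a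
  duality gap of \<epsilon> suffice because that gap is itself O(\<epsilon>).

  Both sides meet the same exponent. \<open>E\<close> may vanish along a set of dimension
  \<open>d\<close> in a space of dimension \<open>2 d\<close>; on each transversal slice a full
  \<open>d\<close>-dimensional Gaussian of width \<open>sqrt \<epsilon>\<close> remains, while the
  slice parameter \<open>w\<close> stays in a bounded set. Dually, about
  \<open>\<epsilon> powr (- d / 2)\<close> cells cover the target support. Bounded densities let the
  marginals be dominated by Lebesgue measure, which translations and shears preserve.\<close>

text \<open>An entropic regularisation with parameter \<open>h\<close> replaces linear programming: at a maximiser of the smooth
  semi-dual \<open>D\<close>, the plan \<open>\<pi> i j = n j * exp ((\<phi> i - c i j) / h) / S j\<close> has the right marginals, and
  \<open>\<phi> i + \<psi> j \<le> c i j\<close> holds exactly because \<open>\<pi> i j \<le> n j\<close>.\<close>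
lemma finite_transport_duality:
  fixes m :: "'i \<Rightarrow> real" and n :: "'j \<Rightarrow> real" and c :: "'i \<Rightarrow> 'j \<Rightarrow> real"
  assumes "finite I" "finite J"
    and m: "\<And>i. i \<in> I \<Longrightarrow> 0 < m i" "sum m I = 1"
    and n: "\<And>j. j \<in> J \<Longrightarrow> 0 \<le> n j" "sum n J = 1"
    and "0 < \<eta>"
  obtains \<phi> \<psi> \<pi> where
    "\<And>i j. i \<in> I \<Longrightarrow> j \<in> J \<Longrightarrow> 0 \<le> \<pi> i j"
    "\<And>i j. i \<in> I \<Longrightarrow> j \<in> J \<Longrightarrow> \<phi> i + \<psi> j \<le> c i j"
    "\<And>i. i \<in> I \<Longrightarrow> (\<Sum>j\<in>J. \<pi> i j) = m i"
    "\<And>j. j \<in> J \<Longrightarrow> (\<Sum>i\<in>I. \<pi> i j) = n j"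
    "(\<Sum>i\<in>I. \<Sum>j\<in>J. \<pi> i j * c i j) \<le> (\<Sum>i\<in>I. \<phi> i * m i) + (\<Sum>j\<in>J. \<psi> j * n j) + \<eta>"
proof -
  have I0: "I \<noteq> {}" using m(2) by auto
  \<comment> \<open>The duality gap below is at most \<open>h * n j\<close> for each pair, hence
    \<open>card I * h\<close> in total.\<close>
  define h where "h = \<eta> / real (card I)"
  have card_pos: "0 < card I" using I0 \<open>finite I\<close> by (simp add: card_gt_0_iff)
  have h: "0 < h" using card_pos \<open>0 < \<eta>\<close> by (simp add: h_def)
  define S where "S j \<phi> = (\<Sum>i\<in>I. exp ((\<phi> i - c i j) / h))" for j and \<phi> :: "'i \<Rightarrow> real"
  have S_pos: "0 < S j \<phi>" for j \<phi>
    unfolding S_def using I0 \<open>finite I\<close> by (intro sum_pos) auto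
  define D where "D \<phi> = (\<Sum>i\<in>I. \<phi> i * m i) - h * (\<Sum>j\<in>J. n j * ln (S j \<phi>))" for \<phi>
  define C where "C = (\<Sum>i\<in>I. \<Sum>j\<in>J. \<bar>c i j\<bar>)"
  have cC: "c i j \<le> C" if "i \<in> I" "j \<in> J" for i j
  proof -
    have "c i j \<le> (\<Sum>j\<in>J. \<bar>c i j\<bar>)"
      using member_le_sum[of j J "\<lambda>j. \<bar>c i j\<bar>"] that \<open>finite J\<close> by force
    also have "\<dots> \<le> C" unfolding C_def
      using member_le_sum[of i I "\<lambda>i. \<Sum>j\<in>J. \<bar>c i j\<bar>"] that \<open>finite I\<close> by (force simp: sum_nonneg)
    finally show ?thesis .
  qed
  \<comment> \<open>Each \<open>S j\<close> is bounded below by its \<open>k\<close>-th term. When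
    \<open>\<phi> k\<close> is the largest value, all summands
    \<open>m i * (\<phi> i - \<phi> k)\<close> are nonpositive, so \<open>D\<close> is small as soon
    as one coordinate lies far below the maximum.\<close>
  have D_le: "D \<phi> \<le> (\<Sum>i\<in>I. m i * (\<phi> i - \<phi> k)) + C" if k: "k \<in> I" for \<phi> k
  proof -
    have "\<phi> k - C \<le> h * ln (S j \<phi>)" if "j \<in> J" for j
    proof -
      have "exp ((\<phi> k - C) / h) \<le> exp ((\<phi> k - c k j) / h)"
        using cC[OF k that] h by (simp add: divide_right_mono)
      also have "\<dots> \<le> S j \<phi>" unfolding S_def
        using member_le_sum[of k I "\<lambda>i. exp ((\<phi> i - c i j) / h)"] k \<open>finite I\<close> by simp
      finally have "(\<phi> k - C) / h \<le> ln (S j \<phi>)" using S_pos by (simp add: ln_ge_iff)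
      then show ?thesis using h by (simp add: divide_le_eq mult.commute)
    qed
    then have "(\<Sum>j\<in>J. n j * (\<phi> k - C)) \<le> (\<Sum>j\<in>J. n j * (h * ln (S j \<phi>)))"
      using n by (intro sum_mono mult_left_mono) auto
    then have "\<phi> k - C \<le> h * (\<Sum>j\<in>J. n j * ln (S j \<phi>))"
      by (simp add: n(2) flip: sum_distrib_right) (simp add: sum_distrib_left mult.left_commute)
    moreover have "(\<Sum>i\<in>I. m i * (\<phi> i - \<phi> k)) = (\<Sum>i\<in>I. \<phi> i * m i) - \<phi> k"
      using m(2) by (simp add: algebra_simps sum_subtractf flip: sum_distrib_left)
    ultimately show ?thesis unfolding D_def by linarith
  qed
  define D0 where "D0 = D (\<lambda>_. 0)"
  have D0: "D0 \<le> C" using D_le[of _ "\<lambda>_. 0"] I0 unfolding D0_def by auto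
  \<comment> \<open>\<open>m i * R\<close> exceeds \<open>C - D0\<close> by at least one for every
    \<open>i\<close>, so a coordinate lying more than \<open>R\<close> below the maximum pushes
    \<open>D\<close> under its value \<open>D0\<close> at zero.\<close>
  define R where "R = (\<Sum>i\<in>I. (C - D0 + 1) / m i)"
  have Rm: "C - D0 + 1 \<le> m i * R" if "i \<in> I" for i
  proof -
    have "(C - D0 + 1) / m i \<le> R" unfolding R_def
      using member_le_sum[of i I "\<lambda>i. (C - D0 + 1) / m i"] that \<open>finite I\<close> D0 m(1)
      by (simp add: less_imp_le)
    then show ?thesis using m(1)[OF that] by (simp add: divide_le_eq mult.commute)
  qed
  have R0: "0 \<le> R" unfolding R_def using D0 m(1) by (intro sum_nonneg) (simp add: less_imp_le)
  \<comment> \<open>Coordinates outside \<open>I\<close> are pinned at zero, which makes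
    \<open>K\<close> compact in the product topology even if the index type is infinite.\<close>
  define K where "K = PiE UNIV (\<lambda>i. if i \<in> I then {-R..0::real} else {0})"
  have "compactin (product_topology (\<lambda>_. euclidean) UNIV) K"
    unfolding K_def compactin_PiE by (auto simp: compactin_euclidean_iff)
  then have K: "compact K" by (simp add: euclidean_product_topology compactin_euclidean_iff)
  have K0: "(\<lambda>_. 0) \<in> K" using R0 by (auto simp: K_def)
  have cont: "continuous_on K D"
  proof -
    have "continuous_on K (\<lambda>\<phi>. \<phi> i)" for i
      by (rule continuous_on_subset[OF continuous_on_product_coordinates]) simp
    moreover have "(\<Sum>i\<in>I. exp ((\<phi> i - c i j) / h)) \<noteq> 0" for \<phi> j
      using S_pos[of j \<phi>] by (simp add: S_def)
    ultimately show ?thesis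
      unfolding D_def S_def using h by (intro continuous_intros) auto
  qed
  obtain \<phi> where \<phi>: "\<phi> \<in> K" "\<And>\<zeta>. \<zeta> \<in> K \<Longrightarrow> D \<zeta> \<le> D \<phi>"
    using continuous_attains_sup[OF K _ cont] K0 by blast
  \<comment> \<open>Since \<open>m\<close> and \<open>n\<close> both have total mass one,
    \<open>D\<close> does not change when a constant is added to \<zeta>. After subtracting the
    largest value over \<open>I\<close>, the point lies in \<open>K\<close> or has a coordinate
    below \<open>- R\<close>, where the choice of \<open>R\<close> applies.\<close>
  have glob: "D \<zeta> \<le> D \<phi>" for \<zeta>
  proof -
    obtain k where k: "k \<in> I" "\<And>i. i \<in> I \<Longrightarrow> \<zeta> i \<le> \<zeta> k"
      using Max_in[of "\<zeta> ` I"] Max_ge[of "\<zeta> ` I"] \<open>finite I\<close> I0 by (metis (no_types, lifting) finite_imageI image_iff image_is_empty)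
    define \<zeta>' where "\<zeta>' i = (if i \<in> I then \<zeta> i - \<zeta> k else 0)" for i
    have "S j \<zeta>' = S j \<zeta> * exp (- \<zeta> k / h)" for j
      unfolding S_def sum_distrib_right \<zeta>'_def
      by (intro sum.cong refl) (simp add: diff_divide_distrib flip: exp_add)
    then have lnS: "ln (S j \<zeta>') = ln (S j \<zeta>) - \<zeta> k / h" for j
      using S_pos[of j \<zeta>] by (simp add: ln_mult_pos)
    have a: "(\<Sum>j\<in>J. n j * ln (S j \<zeta>')) = (\<Sum>j\<in>J. n j * ln (S j \<zeta>)) - \<zeta> k / h"
      unfolding lnS right_diff_distrib sum_subtractf by (simp add: n(2) flip: sum_distrib_right sum_divide_distrib)
    have b: "(\<Sum>i\<in>I. \<zeta>' i * m i) = (\<Sum>i\<in>I. \<zeta> i * m i) - \<zeta> k"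
      using m(2) by (simp add: \<zeta>'_def left_diff_distrib sum_subtractf flip: sum_distrib_left)
    have D': "D \<zeta>' = D \<zeta>"
      unfolding D_def a b using h by (simp add: algebra_simps)
    show ?thesis
    proof (cases "\<zeta>' \<in> K")
      case True then show ?thesis using \<phi>(2)[OF True] D' by simp
    next
      case False
      then obtain i where i: "i \<in> I" "\<zeta> i - \<zeta> k < - R"
        using k(2) unfolding K_def \<zeta>'_def by (auto split: if_splits simp: not_le) (meson not_le)
      have "(\<Sum>l\<in>I - {i}. m l * (\<zeta> l - \<zeta> k)) \<le> 0"
        using k m(1) by (intro sum_nonpos mult_nonneg_nonpos) (auto simp: less_imp_le)
      then have "(\<Sum>l\<in>I. m l * (\<zeta> l - \<zeta> k)) \<le> m i * (\<zeta> i - \<zeta> k)"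
        using i(1) \<open>finite I\<close> by (subst sum.remove[of _ i]) auto
      also have "\<dots> \<le> m i * (- R)" using i m(1)[of i] by (intro mult_left_mono) auto
      finally have "D \<zeta> \<le> D0" using D_le[OF k(1), of \<zeta>] Rm[OF i(1)] by simp
      also have "D0 \<le> D \<phi>" using \<phi>(2)[OF K0] by (simp add: D0_def)
      finally show ?thesis .
    qed
  qed
  define \<pi> where "\<pi> i j = n j * exp ((\<phi> i - c i j) / h) / S j \<phi>" for i j
  define \<psi> where "\<psi> j = - h * ln (S j \<phi>)" for j
  have p0: "0 \<le> \<pi> i j" if "i \<in> I" "j \<in> J" for i j
    using n that S_pos[of j \<phi>] by (simp add: \<pi>_def)
  have eq: "\<phi> i + \<psi> j - c i j = h * ln (exp ((\<phi> i - c i j) / h) / S j \<phi>)" for i j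
    using h S_pos[of j \<phi>] by (simp add: \<psi>_def ln_div field_simps)
  have frac: "exp ((\<phi> i - c i j) / h) / S j \<phi> \<le> 1" if "i \<in> I" for i j
  proof -
    have "exp ((\<phi> i - c i j) / h) \<le> S j \<phi>" unfolding S_def
      using member_le_sum[of i I "\<lambda>i. exp ((\<phi> i - c i j) / h)"] that \<open>finite I\<close> by simp
    then show ?thesis using S_pos[of j \<phi>] by simp
  qed
  have le: "\<phi> i + \<psi> j \<le> c i j" if "i \<in> I" "j \<in> J" for i j
  proof -
    have "ln (exp ((\<phi> i - c i j) / h) / S j \<phi>) \<le> 0" using frac[OF that(1)] S_pos[of j \<phi>] by (simp add: ln_le_zero_iff)
    then show ?thesis using eq[of i j] h by (smt (verit) mult_nonneg_nonpos)
  qed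
  have col: "(\<Sum>i\<in>I. \<pi> i j) = n j" for j
    using S_pos[of j \<phi>] unfolding \<pi>_def
    by (simp flip: sum_distrib_left sum_divide_distrib add: S_def[symmetric])
  \<comment> \<open>The vanishing partial derivative of \<open>D\<close> in coordinate
    \<open>i\<close> is exactly this marginal condition. The other marginal holds for every \<phi>
    because of the division by \<open>S j\<close>.\<close>
  have row: "(\<Sum>j\<in>J. \<pi> i j) = m i" if i: "i \<in> I" for i
  proof -
    define g where "g t = D (\<phi>(i := t))" for t
    have S1: "S j (\<phi>(i := t)) = exp ((t - c i j) / h) + (\<Sum>l\<in>I - {i}. exp ((\<phi> l - c l j) / h))" for t j
      unfolding S_def using i \<open>finite I\<close> by (subst sum.remove[of _ i]) auto
    have dS: "((\<lambda>t. S j (\<phi>(i := t))) has_real_derivative exp ((\<phi> i - c i j) / h) / h) (at (\<phi> i))" for j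
      unfolding S1 using h by (auto intro!: derivative_eq_intros)
    have dln: "((\<lambda>t. ln (S j (\<phi>(i := t)))) has_real_derivative exp ((\<phi> i - c i j) / h) / h / S j \<phi>) (at (\<phi> i))" for j
      using DERIV_chain2[OF DERIV_ln dS] S_pos[of j \<phi>]
      by (force intro!: derivative_eq_intros dS simp: S_pos field_simps)
    have m1: "(\<Sum>l\<in>I. (\<phi>(i := t)) l * m l) = t * m i + (\<Sum>l\<in>I - {i}. \<phi> l * m l)" for t
      using i \<open>finite I\<close> by (subst sum.remove[of _ i]) auto
    have "(g has_real_derivative (m i - h * (\<Sum>j\<in>J. n j * (exp ((\<phi> i - c i j) / h) / h / S j \<phi>)))) (at (\<phi> i))"
      unfolding g_def D_def m1
      by (intro DERIV_diff DERIV_cmult DERIV_sum dln) (auto intro!: derivative_eq_intros)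
    then have "m i - h * (\<Sum>j\<in>J. n j * (exp ((\<phi> i - c i j) / h) / h / S j \<phi>)) = 0"
      by (rule DERIV_local_max[of _ _ _ 1]) (auto simp: g_def glob)
    then show ?thesis unfolding \<pi>_def using h by (simp add: sum_distrib_left)
  qed
  \<comment> \<open>Approximate complementary slackness: with \<open>x\<close> the ratio
    \<open>exp ((\<phi> i - c i j) / h) / S j \<phi>\<close>, the slack weighted by the plan is
    \<open>n j * h * x * ln x\<close>, and this is at least \<open>- h * n j\<close>.\<close>
  have xlnx: "-1 \<le> x * ln x" if "0 < x" for x :: real
  proof -
    have "ln (1 / x) \<le> 1 / x - 1" using that by (intro ln_le_minus_one) simp
    then have "x * ln (1 / x) \<le> x * (1 / x - 1)" using that by (intro mult_left_mono) auto
    then show ?thesis using that by (simp add: ln_div right_diff_distrib)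
  qed
  have "(\<Sum>i\<in>I. \<Sum>j\<in>J. \<pi> i j * c i j) \<le> (\<Sum>i\<in>I. \<Sum>j\<in>J. \<pi> i j * (\<phi> i + \<psi> j) + h * n j)"
  proof (intro sum_mono)
    fix i j assume ij: "i \<in> I" "j \<in> J"
    let ?x = "exp ((\<phi> i - c i j) / h) / S j \<phi>"
    have "n j * (h * -1) \<le> n j * (h * (?x * ln ?x))"
      using n ij h xlnx[of ?x] S_pos[of j \<phi>] by (intro mult_left_mono) auto
    also have "\<dots> = \<pi> i j * (\<phi> i + \<psi> j - c i j)" unfolding eq \<pi>_def by simp
    finally show "\<pi> i j * c i j \<le> \<pi> i j * (\<phi> i + \<psi> j) + h * n j" by (simp add: algebra_simps)
  qed
  also have "\<dots> = (\<Sum>i\<in>I. \<Sum>j\<in>J. \<pi> i j * \<phi> i) + (\<Sum>i\<in>I. \<Sum>j\<in>J. \<pi> i j * \<psi> j) + (\<Sum>i\<in>I. \<Sum>j\<in>J. h * n j)"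
    by (simp add: distrib_left sum.distrib)
  also have "(\<Sum>i\<in>I. \<Sum>j\<in>J. h * n j) = \<eta>"
  proof -
    have "(\<Sum>j\<in>J. h * n j) = h" using n(2) by (metis mult_1_right sum_distrib_left)
    then show ?thesis using card_pos by (simp only: sum_constant) (simp add: h_def)
  qed
  also have "(\<Sum>i\<in>I. \<Sum>j\<in>J. \<pi> i j * \<phi> i) = (\<Sum>i\<in>I. \<phi> i * m i)"
    by (intro sum.cong refl) (simp add: sum_distrib_left mult.commute flip: row)
  also have "(\<Sum>i\<in>I. \<Sum>j\<in>J. \<pi> i j * \<psi> j) = (\<Sum>j\<in>J. \<psi> j * n j)"
    by (subst sum.swap) (simp add: sum_distrib_left mult.commute flip: col)
  finally show thesis using that[of \<pi> \<phi> \<psi>] p0 le row col by blast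
qed

section \<open>Couplings with compactly supported marginals\<close>

lemma sets_borel_pair [simp]:
  "sets (borel \<Otimes>\<^sub>M borel) =
    sets (borel :: ('a::second_countable_topology \<times> 'b::second_countable_topology) measure)"
  by (simp only: borel_prod)

text \<open>By second countability the complement of the support is covered by countably many basis
  sets of measure zero.\<close>

lemma AE_spt:
  fixes \<mu> :: "'a::{metric_space, second_countable_topology} measure"
  assumes "sets \<mu> = sets borel"
  shows "AE x in \<mu>. x \<in> spt \<mu>"
proof -
  obtain \<B> :: "'a set set" where \<B>: "countable \<B>" "topological_basis \<B>"
    using ex_countable_basis by blast
  define U where "U = \<Union>{B \<in> \<B>. emeasure \<mu> B = 0}"
  have op: "open B" if "B \<in> \<B>" for B using topological_basis_open[OF \<B>(2) that] .
  have "(\<Union>B\<in>{B \<in> \<B>. emeasure \<mu> B = 0}. B) \<in> null_sets \<mu>"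
    using \<B>(1) assms op by (intro null_sets_UN') (auto simp: null_sets_def)
  then have "U \<in> null_sets \<mu>" by (simp add: U_def)
  moreover have "{x \<in> space \<mu>. x \<notin> spt \<mu>} \<subseteq> U"
  proof
    fix x assume "x \<in> {x \<in> space \<mu>. x \<notin> spt \<mu>}"
    then obtain e where e: "e > 0" "emeasure \<mu> (ball x e) = 0" unfolding spt_def by auto
    obtain B where B: "B \<in> \<B>" "x \<in> B" "B \<subseteq> ball x e"
      using topological_basisE[OF \<B>(2), of "ball x e" x] e by auto
    have "emeasure \<mu> B = 0"
      using emeasure_mono[OF B(3), of \<mu>] e(2) assms by auto
    then show "x \<in> U" using B unfolding U_def by auto
  qed
  ultimately show ?thesis by (rule AE_I')
qed

lemma AE_couplings:
  assumes \<gamma>: "\<gamma> \<in> couplings \<mu> \<nu>" and "compact (spt \<mu>)" "compact (spt \<nu>)"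
  shows "AE z in \<gamma>. z \<in> spt \<mu> \<times> spt \<nu>"
proof (rule AE_I)
  show "{z \<in> space \<gamma>. z \<notin> spt \<mu> \<times> spt \<nu>} \<subseteq> UNIV - spt \<mu> \<times> spt \<nu>" by auto
  show "emeasure \<gamma> (UNIV - spt \<mu> \<times> spt \<nu>) = 0" using \<gamma> by (simp add: couplings_def)
  have "open (UNIV - spt \<mu> \<times> spt \<nu>)"
    using assms by (simp add: compact_Times compact_imp_closed open_Diff)
  then show "UNIV - spt \<mu> \<times> spt \<nu> \<in> sets \<gamma>" using \<gamma> by (simp add: couplings_def)
qed

text \<open>Null cells can be discarded, so that later constructions may divide by the mass of a
  cell.\<close>

lemma (in prob_space) AE_positive_cell:
  fixes q :: "'a \<Rightarrow> nat"
  assumes q: "q \<in> measurable M (count_space UNIV)" and N: "AE x in M. q x < N"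
  shows "AE x in M. q x \<in> {j. j < N \<and> 0 < prob (q -` {j} \<inter> space M)}" (is "AE x in M. q x \<in> ?J")
proof -
  have "AE x in M. \<forall>i\<in>{..<N} - ?J. x \<notin> q -` {i} \<inter> space M"
  proof (intro AE_finite_allI)
    fix i assume "i \<in> {..<N} - ?J"
    then have "q -` {i} \<inter> space M \<in> null_sets M"
      using measurable_sets[OF q, of "{i}"] by (auto simp: emeasure_eq_measure not_less measure_le_0_iff)
    then show "AE x in M. x \<notin> q -` {i} \<inter> space M" by (rule AE_not_in)
  qed simp
  with N AE_space show ?thesis by eventually_elim auto
qed

lemma (in prob_space) nn_integral_finite_valued:
  fixes q :: "'a \<Rightarrow> 'i" and g :: "'i \<Rightarrow> ennreal"
  assumes [measurable]: "q \<in> measurable M (count_space UNIV)" and J: "finite J" and AEJ: "AE x in M. q x \<in> J"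
  shows "(\<integral>\<^sup>+x. g (q x) \<partial>M) = (\<Sum>j\<in>J. g j * emeasure M (q -` {j} \<inter> space M))"
proof -
  have [measurable]: "q -` {j} \<inter> space M \<in> sets M" for j by (rule measurable_sets[OF assms(1)]) simp
  have "(\<integral>\<^sup>+x. g (q x) \<partial>M) = (\<integral>\<^sup>+x. (\<Sum>j\<in>J. g j * indicator (q -` {j} \<inter> space M) x) \<partial>M)"
    using AEJ by (intro nn_integral_cong_AE) (auto simp: J indicator_def if_distrib[of "times _"] cong: if_cong)
  also have "\<dots> = (\<Sum>j\<in>J. g j * emeasure M (q -` {j} \<inter> space M))"
    by (subst nn_integral_sum) (auto simp: nn_integral_cmult_indicator)
  finally show ?thesis .
qed

lemma (in prob_space) integral_finite_valued:
  fixes q :: "'a \<Rightarrow> 'i" and g :: "'i \<Rightarrow> real"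
  assumes [measurable]: "q \<in> measurable M (count_space UNIV)" and J: "finite J" and AEJ: "AE x in M. q x \<in> J"
  shows "(\<integral>x. g (q x) \<partial>M) = (\<Sum>j\<in>J. g j * prob (q -` {j} \<inter> space M))"
proof -
  have [measurable]: "q -` {j} \<inter> space M \<in> sets M" for j by (rule measurable_sets[OF assms(1)]) simp
  have "(\<lambda>x. g (q x)) \<in> borel_measurable M" by (rule measurable_compose[OF assms(1)]) simp
  moreover have "(\<lambda>x. \<Sum>j\<in>J. g j * indicator (q -` {j} \<inter> space M) x) \<in> borel_measurable M" by measurable
  moreover have "AE x in M. g (q x) = (\<Sum>j\<in>J. g j * indicator (q -` {j} \<inter> space M) x)"
    using AEJ by (auto simp: J indicator_def if_distrib[of "times _"] cong: if_cong)
  ultimately have "(\<integral>x. g (q x) \<partial>M) = (\<integral>x. (\<Sum>j\<in>J. g j * indicator (q -` {j} \<inter> space M) x) \<partial>M)"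
    by (rule integral_cong_AE)
  also have "\<dots> = (\<Sum>j\<in>J. g j * prob (q -` {j} \<inter> space M))"
    by (subst Bochner_Integration.integral_sum) (auto intro!: integrable_mult_right integrable_real_indicator simp: emeasure_eq_measure)
  finally show ?thesis .
qed

lemma (in prob_space) sum_prob_finite_valued:
  fixes q :: "'a \<Rightarrow> 'i"
  assumes "q \<in> measurable M (count_space UNIV)" "finite J" "AE x in M. q x \<in> J"
  shows "(\<Sum>j\<in>J. prob (q -` {j} \<inter> space M)) = 1"
  using integral_finite_valued[OF assms, of "\<lambda>_. 1"] by (simp add: prob_space)

locale borel_prob_pair = M1: prob_space \<mu> + M2: prob_space \<nu>
  for \<mu> :: "'a::{metric_space, second_countable_topology} measure"
    and \<nu> :: "'b::{metric_space, second_countable_topology} measure" +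
  assumes sets_left[measurable_cong, simp]: "sets \<mu> = sets borel"
    and sets_right[measurable_cong, simp]: "sets \<nu> = sets borel"
    and compact_left: "compact (spt \<mu>)"
    and compact_right: "compact (spt \<nu>)"
begin

sublocale pair_prob_space \<mu> \<nu> ..

lemma space_left[simp]: "space \<mu> = UNIV" and space_right[simp]: "space \<nu> = UNIV"
  using sets_left sets_right by (metis sets_eq_imp_space_eq space_borel)+

lemma sets_pair[measurable_cong, simp]: "sets (\<mu> \<Otimes>\<^sub>M \<nu>) = sets borel"
  using sets_pair_measure_cong[OF sets_left sets_right] by simp

lemma measurable_pair_iff[simp]: "measurable (\<mu> \<Otimes>\<^sub>M \<nu>) L = measurable borel L"
  by (rule measurable_cong_sets) simp_all

lemma space_pair[simp]: "space (\<mu> \<Otimes>\<^sub>M \<nu>) = UNIV"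
  by (simp add: space_pair_measure)

lemma measurable_fst_borel[measurable]: "fst \<in> (borel :: ('a \<times> 'b) measure) \<rightarrow>\<^sub>M borel"
  and measurable_snd_borel[measurable]: "snd \<in> (borel :: ('a \<times> 'b) measure) \<rightarrow>\<^sub>M borel"
  by (intro borel_measurable_continuous_onI continuous_intros)+

lemma measurable_supports[measurable]:
  "spt \<mu> \<in> sets borel" "spt \<nu> \<in> sets borel" "spt \<mu> \<times> spt \<nu> \<in> sets borel"
  using compact_left compact_right by (auto intro!: borel_closed compact_imp_closed compact_Times)

lemma distr_fst: "distr (\<mu> \<Otimes>\<^sub>M \<nu>) borel fst = \<mu>"
  using M2.distr_pair_fst[of \<mu>] by (metis distr_cong sets_left)

lemma distr_snd: "distr (\<mu> \<Otimes>\<^sub>M \<nu>) borel snd = \<nu>"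
proof (rule measure_eqI)
  fix A assume "A \<in> sets (distr (\<mu> \<Otimes>\<^sub>M \<nu>) borel snd)"
  then have A[measurable]: "A \<in> sets borel" by simp
  have "emeasure (distr (\<mu> \<Otimes>\<^sub>M \<nu>) borel snd) A = emeasure (\<mu> \<Otimes>\<^sub>M \<nu>) (UNIV \<times> A)"
    by (subst emeasure_distr) (auto intro!: arg_cong[of _ _ "emeasure _"] measurable_snd_borel)
  also have "\<dots> = emeasure \<nu> A"
    using M1.emeasure_space_1 by (subst M2.emeasure_pair_measure_Times) auto
  finally show "emeasure (distr (\<mu> \<Otimes>\<^sub>M \<nu>) borel snd) A = emeasure \<nu> A" .
qed simp

lemma AE_fst:
  assumes "AE x in \<mu>. P x"
  shows "AE z in \<mu> \<Otimes>\<^sub>M \<nu>. P (fst z)"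
proof (rule AE_distrD[of fst "\<mu> \<Otimes>\<^sub>M \<nu>" borel P])
  show "fst \<in> (\<mu> \<Otimes>\<^sub>M \<nu>) \<rightarrow>\<^sub>M borel" by simp measurable
  show "AE x in distr (\<mu> \<Otimes>\<^sub>M \<nu>) borel fst. P x" unfolding distr_fst by (rule assms)
qed

lemma AE_snd:
  assumes "AE y in \<nu>. P y"
  shows "AE z in \<mu> \<Otimes>\<^sub>M \<nu>. P (snd z)"
proof (rule AE_distrD[of snd "\<mu> \<Otimes>\<^sub>M \<nu>" borel P])
  show "snd \<in> (\<mu> \<Otimes>\<^sub>M \<nu>) \<rightarrow>\<^sub>M borel" by simp measurable
  show "AE y in distr (\<mu> \<Otimes>\<^sub>M \<nu>) borel snd. P y" unfolding distr_snd by (rule assms)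
qed

lemma AE_pair_spt: "AE z in \<mu> \<Otimes>\<^sub>M \<nu>. z \<in> spt \<mu> \<times> spt \<nu>"
  using AE_fst[OF AE_spt[OF sets_left]] AE_snd[OF AE_spt[OF sets_right]] by eventually_elim auto

text \<open>By Tonelli the integrals over sections are the densities of the two marginals. The dual
  plan and the block plan are both built in this form.\<close>

lemma density_in_couplings:
  assumes \<rho>[measurable]: "\<rho> \<in> borel_measurable borel"
    and 1: "AE x in \<mu>. (\<integral>\<^sup>+y. \<rho> (x, y) \<partial>\<nu>) = 1"
    and 2: "AE y in \<nu>. (\<integral>\<^sup>+x. \<rho> (x, y) \<partial>\<mu>) = 1"
  shows "density (\<mu> \<Otimes>\<^sub>M \<nu>) \<rho> \<in> couplings \<mu> \<nu>"
proof -
  let ?\<gamma> = "density (\<mu> \<Otimes>\<^sub>M \<nu>) \<rho>"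
  have fst_eq: "distr ?\<gamma> borel fst = \<mu>"
  proof (rule measure_eqI)
    fix A assume "A \<in> sets (distr ?\<gamma> borel fst)"
    then have A[measurable]: "A \<in> sets borel" by simp
    have "emeasure (distr ?\<gamma> borel fst) A = (\<integral>\<^sup>+z. \<rho> z * indicator A (fst z) \<partial>(\<mu> \<Otimes>\<^sub>M \<nu>))"
    proof -
      have "(fst -` A :: ('a \<times> 'b) set) \<in> sets borel" using measurable_sets[OF measurable_fst_borel A] by simp
      then show ?thesis
        by (simp add: emeasure_distr emeasure_density measurable_density_eq1) (auto intro!: nn_integral_cong split: split_indicator)
    qed
    also have "\<dots> = (\<integral>\<^sup>+x. (\<integral>\<^sup>+y. \<rho> (x, y) * indicator A x \<partial>\<nu>) \<partial>\<mu>)"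
      by (subst M2.nn_integral_fst[symmetric]) (simp_all only: measurable_pair_iff fst_conv snd_conv, measurable)
    also have "\<dots> = (\<integral>\<^sup>+x. indicator A x \<partial>\<mu>)"
      using 1 by (intro nn_integral_cong_AE) (auto simp: nn_integral_multc)
    finally show "emeasure (distr ?\<gamma> borel fst) A = emeasure \<mu> A" by simp
  qed simp
  have snd_eq: "distr ?\<gamma> borel snd = \<nu>"
  proof (rule measure_eqI)
    fix A assume "A \<in> sets (distr ?\<gamma> borel snd)"
    then have A[measurable]: "A \<in> sets borel" by simp
    have "emeasure (distr ?\<gamma> borel snd) A = (\<integral>\<^sup>+z. \<rho> z * indicator A (snd z) \<partial>(\<mu> \<Otimes>\<^sub>M \<nu>))"
    proof -
      have "(snd -` A :: ('a \<times> 'b) set) \<in> sets borel" using measurable_sets[OF measurable_snd_borel A] by simp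
      then show ?thesis
        by (simp add: emeasure_distr emeasure_density measurable_density_eq1) (auto intro!: nn_integral_cong split: split_indicator)
    qed
    also have "\<dots> = (\<integral>\<^sup>+y. (\<integral>\<^sup>+x. \<rho> (x, y) * indicator A y \<partial>\<mu>) \<partial>\<nu>)"
      by (subst nn_integral_snd[symmetric]) (simp_all only: measurable_pair_iff fst_conv snd_conv, measurable)
    also have "\<dots> = (\<integral>\<^sup>+x. indicator A x \<partial>\<nu>)"
      using 2 by (intro nn_integral_cong_AE) (auto simp: nn_integral_multc)
    finally show "emeasure (distr ?\<gamma> borel snd) A = emeasure \<nu> A" by simp
  qed simp
  have "emeasure ?\<gamma> (space ?\<gamma>) = emeasure (distr ?\<gamma> borel fst) UNIV"
    by (subst emeasure_distr) (auto simp: measurable_density_eq1 intro!: measurable_fst_borel)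
  then have "prob_space ?\<gamma>"
    using M1.emeasure_space_1 by (intro prob_spaceI) (simp add: fst_eq)
  moreover have "emeasure ?\<gamma> (UNIV - spt \<mu> \<times> spt \<nu>) = 0"
  proof -
    have [measurable]: "UNIV - spt \<mu> \<times> spt \<nu> \<in> sets borel" by measurable
    have "(\<lambda>z. \<rho> z * indicator (UNIV - spt \<mu> \<times> spt \<nu>) z) \<in> borel_measurable borel" by measurable
    then show ?thesis
      using AE_pair_spt by (subst emeasure_density)
        (auto simp: nn_integral_0_iff_AE split: split_indicator elim!: eventually_mono)
  qed
  ultimately show ?thesis using fst_eq snd_eq by (simp add: couplings_def)
qed

lemma pair_in_couplings: "\<mu> \<Otimes>\<^sub>M \<nu> \<in> couplings \<mu> \<nu>"
  using density_in_couplings[of "\<lambda>_. 1"] M1.emeasure_space_1 M2.emeasure_space_1 by (simp add: density_1)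

end

context borel_prob_pair
begin

lemma integrable_couplings:
  fixes f :: "'a \<times> 'b \<Rightarrow> real"
  assumes \<gamma>: "\<gamma> \<in> couplings \<mu> \<nu>" and f: "f \<in> borel_measurable borel" "AE z in \<gamma>. \<bar>f z\<bar> \<le> B"
  shows "integrable \<gamma> f"
proof -
  interpret G: prob_space \<gamma> using \<gamma> by (simp add: couplings_def)
  have [measurable_cong]: "sets \<gamma> = sets borel" using \<gamma> by (simp add: couplings_def)
  show ?thesis by (rule G.integrable_const_bound[of _ B]) (use f in \<open>auto simp: measurable_cong_sets[OF \<open>sets \<gamma> = sets borel\<close>]\<close>)
qed

lemma measurable_cost:
  fixes c :: "'a \<times> 'b \<Rightarrow> real"
  assumes "continuous_on (spt \<mu> \<times> spt \<nu>) c"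
  shows "(\<lambda>z. indicator (spt \<mu> \<times> spt \<nu>) z *\<^sub>R c z) \<in> borel_measurable borel"
  using assms by (intro borel_measurable_continuous_on_indicator) auto

lemma integrable_cost:
  fixes c :: "'a \<times> 'b \<Rightarrow> real"
  assumes \<gamma>: "\<gamma> \<in> couplings \<mu> \<nu>" and c: "continuous_on (spt \<mu> \<times> spt \<nu>) c"
  shows "integrable \<gamma> (\<lambda>z. indicator (spt \<mu> \<times> spt \<nu>) z *\<^sub>R c z)"
proof -
  have "compact (spt \<mu> \<times> spt \<nu>)" using compact_left compact_right by (rule compact_Times)
  then have "bounded (c ` (spt \<mu> \<times> spt \<nu>))" using c compact_continuous_image compact_imp_bounded by blast
  then obtain B where B: "0 < B" "\<And>z. z \<in> spt \<mu> \<times> spt \<nu> \<Longrightarrow> \<bar>c z\<bar> \<le> B"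
    unfolding bounded_pos by (metis image_eqI real_norm_def)
  then show ?thesis
    by (intro integrable_couplings[OF \<gamma> measurable_cost[OF c], of B]) (auto split: split_indicator)
qed

lemma transport_cost_mono:
  fixes c :: "'a \<times> 'b \<Rightarrow> real"
  assumes \<gamma>: "\<gamma> \<in> couplings \<mu> \<nu>" and c: "continuous_on (spt \<mu> \<times> spt \<nu>) c"
    and g: "integrable \<gamma> g" and le: "AE z in \<gamma>. z \<in> spt \<mu> \<times> spt \<nu> \<longrightarrow> c z \<le> g z"
  shows "transport_cost \<mu> \<nu> c \<gamma> \<le> (\<integral>z. g z \<partial>\<gamma>)"
  unfolding transport_cost_def set_lebesgue_integral_def
  using le AE_couplings[OF \<gamma> compact_left compact_right]
  by (intro integral_mono_AE integrable_cost[OF \<gamma> c] g) (auto elim!: eventually_elim2)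

text \<open>The integral depends on the marginals only, so passing from the cost to the gap
  \<open>E\<close> subtracts the same number for every plan.\<close>

lemma integral_potentials:
  fixes \<phi> :: "'a \<Rightarrow> real" and \<psi> :: "'b \<Rightarrow> real"
  assumes \<gamma>: "\<gamma> \<in> couplings \<mu> \<nu>"
    and \<phi>[measurable]: "\<phi> \<in> borel_measurable borel" and B: "\<And>x. \<bar>\<phi> x\<bar> \<le> B"
    and \<psi>[measurable]: "\<psi> \<in> borel_measurable borel" and B': "\<And>y. \<bar>\<psi> y\<bar> \<le> B'"
  shows "integrable \<gamma> (\<lambda>z. \<phi> (fst z) + \<psi> (snd z))"
    "(\<integral>z. \<phi> (fst z) + \<psi> (snd z) \<partial>\<gamma>) = (\<integral>x. \<phi> x \<partial>\<mu>) + (\<integral>y. \<psi> y \<partial>\<nu>)"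
proof -
  have [measurable_cong]: "sets \<gamma> = sets borel" and d: "distr \<gamma> borel fst = \<mu>" "distr \<gamma> borel snd = \<nu>"
    using \<gamma> by (simp_all add: couplings_def)
  have i1: "integrable \<gamma> (\<lambda>z. \<phi> (fst z))" by (rule integrable_couplings[OF \<gamma>, of _ B]) (auto simp: B)
  have i2: "integrable \<gamma> (\<lambda>z. \<psi> (snd z))" by (rule integrable_couplings[OF \<gamma>, of _ B']) (auto simp: B')
  show "integrable \<gamma> (\<lambda>z. \<phi> (fst z) + \<psi> (snd z))" using i1 i2 by simp
  have "(\<integral>x. \<phi> x \<partial>\<mu>) = (\<integral>z. \<phi> (fst z) \<partial>\<gamma>)"
    by (subst d(1)[symmetric], subst integral_distr) auto
  moreover have "(\<integral>y. \<psi> y \<partial>\<nu>) = (\<integral>z. \<psi> (snd z) \<partial>\<gamma>)"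
    by (subst d(2)[symmetric], subst integral_distr) auto
  ultimately show "(\<integral>z. \<phi> (fst z) + \<psi> (snd z) \<partial>\<gamma>) = (\<integral>x. \<phi> x \<partial>\<mu>) + (\<integral>y. \<psi> y \<partial>\<nu>)"
    using i1 i2 by simp
qed

end

section \<open>Approximate Kantorovich duality\<close>

text \<open>The cells are the cubes of a coordinate grid of mesh \<delta>, with one further label
  for the complement of \<open>X\<close>. \<open>C\<close> serves all \<delta> at once, so the
  exponent in the bound on \<open>N\<close> becomes the coefficient of the logarithm in the entropy
  of the block plan.\<close>

lemma grid_partition:
  fixes X :: "'a::euclidean_space set"
  assumes "bounded X" and X[measurable]: "X \<in> sets borel"
  obtains C where "0 < C"
    "\<And>\<delta>. 0 < \<delta> \<Longrightarrow> \<delta> \<le> 1 \<Longrightarrow> \<exists>N (q :: 'a \<Rightarrow> nat). q \<in> borel \<rightarrow>\<^sub>M count_space UNIV \<and> (\<forall>x. q x < N \<longleftrightarrow> x \<in> X) \<and>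
       (\<forall>x\<in>X. \<forall>x'\<in>X. q x = q x' \<longrightarrow> (\<forall>b\<in>Basis. \<bar>(x - x') \<bullet> b\<bar> \<le> \<delta>)) \<and>
       real N \<le> C / \<delta> ^ DIM('a)"
proof -
  obtain B where B: "0 < B" "\<And>x. x \<in> X \<Longrightarrow> norm x \<le> B"
    using \<open>bounded X\<close> bounded_pos by blast
  \<comment> \<open>Each coordinate takes at most \<open>2 * B / \<delta> + 3\<close> integer
    values, and \<open>\<delta> \<le> 1\<close> absorbs the 3 into
    \<open>(2 * B + 3) / \<delta>\<close>.\<close>
  define C where "C = (2 * B + 3) ^ DIM('a)"
  show thesis
  proof (rule that[of C])
    show "0 < C" using B by (simp add: C_def)
    fix \<delta> :: real assume \<delta>: "0 < \<delta>" "\<delta> \<le> 1"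
    define m where "m = \<lceil>B / \<delta>\<rceil>"
    define k :: "'a \<Rightarrow> 'a \<Rightarrow> int" where "k x = (\<lambda>b\<in>Basis. \<lfloor>x \<bullet> b / \<delta>\<rfloor>)" for x
    define F where "F = PiE (Basis :: 'a set) (\<lambda>_. {-m..m})"
    have finF: "finite F" unfolding F_def by (intro finite_PiE) auto
    have "0 < B / \<delta>" using B \<delta> by simp
    then have m0: "0 \<le> m" unfolding m_def by linarith
    have cardF: "card F = nat (2 * m + 1) ^ DIM('a)"
      using m0 by (simp add: F_def card_PiE)
    obtain h where h: "bij_betw h F {0..<card F}" using ex_bij_betw_finite_nat[OF finF] by blast
    \<comment> \<open>Cell numbers run below \<open>card F\<close>; the value \<open>card F\<close>
      itself marks the points outside \<open>X\<close>.\<close>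
    define q where "q x = (if x \<in> X then h (k x) else card F)" for x
    have kF: "k x \<in> F" if "x \<in> X" for x
    proof -
      have "\<lfloor>x \<bullet> b / \<delta>\<rfloor> \<in> {-m..m}" if b: "b \<in> Basis" for b
      proof -
        have a: "\<bar>x \<bullet> b\<bar> \<le> B" using B(2)[OF \<open>x \<in> X\<close>] Basis_le_norm[OF b, of x] by linarith
        have "\<bar>x \<bullet> b / \<delta>\<bar> \<le> B / \<delta>" using a \<delta> by (simp add: divide_right_mono)
        moreover have "B / \<delta> \<le> real_of_int m" unfolding m_def by (rule le_of_int_ceiling)
        ultimately have "- real_of_int m \<le> x \<bullet> b / \<delta>" "x \<bullet> b / \<delta> \<le> real_of_int m" by linarith+
        then show ?thesis by (simp add: le_floor_iff floor_le_iff)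
      qed
      then show ?thesis by (auto simp: F_def k_def)
    qed
    have "k -` {g} \<in> sets borel" if "g \<in> F" for g
    proof -
      have "k -` {g} = (\<Inter>b\<in>Basis. {x. \<lfloor>x \<bullet> b / \<delta>\<rfloor> = g b})"
        using that by (auto simp: k_def F_def fun_eq_iff PiE_iff extensional_def)
      moreover have "{x :: 'a. \<lfloor>x \<bullet> b / \<delta>\<rfloor> = g b} \<in> sets borel" for b
        by measurable
      ultimately show ?thesis by auto
    qed
    note km = this
    have "q -` {i} \<in> sets borel" for i
    proof -
      have "q -` {i} = (if i = card F then - X else if i < card F then X \<inter> k -` {the_inv_into F h i} else {})"
        using h kF by (auto simp: q_def bij_betw_def the_inv_into_f_f f_the_inv_into_f dest: the_inv_into_f_f) 
          (metis atLeastLessThan_iff image_eqI less_irrefl)+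
      moreover have "the_inv_into F h i \<in> F" if "i < card F"
        using h that by (intro the_inv_into_into) (auto simp: bij_betw_def)
      ultimately show ?thesis using km by auto
    qed
    then have qm: "q \<in> borel \<rightarrow>\<^sub>M count_space UNIV"
      by (simp add: measurable_count_space_eq2_countable)
    have q1: "q x < card F \<longleftrightarrow> x \<in> X" for x
      using h kF unfolding q_def bij_betw_def by auto
    have q2: "\<bar>(x - x') \<bullet> b\<bar> \<le> \<delta>" if "x \<in> X" "x' \<in> X" "q x = q x'" "b \<in> Basis" for x x' b
    proof -
      have "k x = k x'" using that h kF unfolding q_def bij_betw_def inj_on_def by auto
      then have "\<lfloor>x \<bullet> b / \<delta>\<rfloor> = \<lfloor>x' \<bullet> b / \<delta>\<rfloor>"
        using \<open>b \<in> Basis\<close> unfolding k_def by (metis restrict_apply')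
      then have "\<bar>x \<bullet> b / \<delta> - x' \<bullet> b / \<delta>\<bar> \<le> 1" by linarith
      then have "\<bar>(x - x') \<bullet> b\<bar> / \<delta> \<le> 1" using \<delta> by (simp add: inner_diff_left flip: diff_divide_distrib)
      then show ?thesis using \<delta> by simp
    qed
    have "real (card F) = (2 * real_of_int m + 1) ^ DIM('a)"
      using m0 by (simp add: cardF)
    also have "\<dots> \<le> ((2 * B + 3) / \<delta>) ^ DIM('a)"
    proof (rule power_mono)
      have "real_of_int m \<le> B / \<delta> + 1" unfolding m_def by linarith
      then have "2 * real_of_int m + 1 \<le> 2 * B / \<delta> + 3 * 1" by simp
      also have "\<dots> \<le> 2 * B / \<delta> + 3 * (1 / \<delta>)" using \<delta> by (intro add_left_mono mult_left_mono) auto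
      finally show "2 * real_of_int m + 1 \<le> (2 * B + 3) / \<delta>" by (simp add: add_divide_distrib)
    qed (use m0 in auto)
    also have "\<dots> = C / \<delta> ^ DIM('a)" by (simp add: C_def power_divide)
    finally show "\<exists>N (q :: 'a \<Rightarrow> nat). q \<in> borel \<rightarrow>\<^sub>M count_space UNIV \<and> (\<forall>x. q x < N \<longleftrightarrow> x \<in> X) \<and>
       (\<forall>x\<in>X. \<forall>x'\<in>X. q x = q x' \<longrightarrow> (\<forall>b\<in>Basis. \<bar>(x - x') \<bullet> b\<bar> \<le> \<delta>)) \<and>
       real N \<le> C / \<delta> ^ DIM('a)"
      using qm q1 q2 by blast
  qed
qed

lemma finite_partition:
  fixes X :: "'a::euclidean_space set"
  assumes "bounded X" "X \<in> sets borel" "0 < e"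
  obtains N and q :: "'a \<Rightarrow> nat" where "q \<in> borel \<rightarrow>\<^sub>M count_space UNIV" "\<And>x. q x < N \<longleftrightarrow> x \<in> X"
    "\<And>x x'. x \<in> X \<Longrightarrow> x' \<in> X \<Longrightarrow> q x = q x' \<Longrightarrow> dist x x' < e"
proof -
  define \<delta> where "\<delta> = min 1 (e / (2 * DIM('a)))"
  have \<delta>: "0 < \<delta>" "\<delta> \<le> 1" using \<open>0 < e\<close> by (auto simp: \<delta>_def)
  obtain N and q :: "'a \<Rightarrow> nat" where q: "q \<in> borel \<rightarrow>\<^sub>M count_space UNIV" "\<And>x. q x < N \<longleftrightarrow> x \<in> X"
    "\<And>x x' b. x \<in> X \<Longrightarrow> x' \<in> X \<Longrightarrow> q x = q x' \<Longrightarrow> b \<in> Basis \<Longrightarrow> \<bar>(x - x') \<bullet> b\<bar> \<le> \<delta>"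
    using grid_partition[OF assms(1,2)] \<delta> by metis
  have "dist x x' < e" if "x \<in> X" "x' \<in> X" "q x = q x'" for x x'
  proof -
    have "dist x x' \<le> (\<Sum>b\<in>Basis. \<bar>(x - x') \<bullet> b\<bar>)" by (simp add: dist_norm norm_le_l1)
    also have "\<dots> \<le> (\<Sum>b\<in>(Basis :: 'a set). \<delta>)" using q(3)[OF that] by (intro sum_mono)
    also have "\<dots> = real DIM('a) * \<delta>" by simp
    also have "\<dots> \<le> real DIM('a) * (e / (2 * DIM('a)))"
      by (intro mult_left_mono) (simp_all only: \<delta>_def min.cobounded2 of_nat_0_le_iff)
    also have "\<dots> < e" using \<open>0 < e\<close> by simp
    finally show ?thesis .
  qed
  then show thesis using that[of q N] q by blast
qed

text \<open>Both supports are cut into cells on whose products \<open>c\<close> stays within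
  \<open>\<eta> / 3\<close> of a sample value, and the finite duality is applied to the masses of
  the cells. The potentials are constant on cells, and on each product of cells the plan is a
  multiple of the product measure. Discretising the cost loses \<open>2 * \<eta> / 3\<close> and the
  finite problem \<open>\<eta> / 3\<close>.\<close>

lemma approx_kantorovich_duality:
  fixes \<mu> :: "'a::euclidean_space measure" and \<nu> :: "'b::euclidean_space measure" and c :: "'a \<times> 'b \<Rightarrow> real"
  assumes "borel_prob_pair \<mu> \<nu>" and c: "continuous_on (spt \<mu> \<times> spt \<nu>) c" and "0 < \<eta>"
  obtains \<phi> \<psi> \<rho> where
    "\<phi> \<in> borel_measurable borel" "bounded (range \<phi>)" "\<psi> \<in> borel_measurable borel" "bounded (range \<psi>)"
    "\<And>x y. x \<in> spt \<mu> \<Longrightarrow> y \<in> spt \<nu> \<Longrightarrow> \<phi> x + \<psi> y \<le> c (x, y)"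
    "\<rho> \<in> borel_measurable borel" "AE x in \<mu>. (\<integral>\<^sup>+y. \<rho> (x, y) \<partial>\<nu>) = 1" "AE y in \<nu>. (\<integral>\<^sup>+x. \<rho> (x, y) \<partial>\<mu>) = 1"
    "transport_cost \<mu> \<nu> c (density (\<mu> \<Otimes>\<^sub>M \<nu>) \<rho>) \<le> (\<integral>x. \<phi> x \<partial>\<mu>) + (\<integral>y. \<psi> y \<partial>\<nu>) + \<eta>"
proof -
  interpret borel_prob_pair \<mu> \<nu> by fact
  let ?X = "spt \<mu>" and ?Y = "spt \<nu>"
  have cXY: "compact (?X \<times> ?Y)" using compact_left compact_right by (rule compact_Times)
  then have "uniformly_continuous_on (?X \<times> ?Y) c" using c compact_uniformly_continuous by blast
  then obtain d where d: "0 < d" "\<And>z z'. z \<in> ?X \<times> ?Y \<Longrightarrow> z' \<in> ?X \<times> ?Y \<Longrightarrow> dist z z' < d \<Longrightarrow> \<bar>c z - c z'\<bar> < \<eta> / 3"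
    unfolding uniformly_continuous_on_def dist_real_def using \<open>0 < \<eta>\<close> by (metis dist_commute zero_less_divide_iff zero_less_numeral)
  have "bounded (c ` (?X \<times> ?Y))" using c cXY compact_continuous_image compact_imp_bounded by blast
  then obtain B where B: "0 < B" "\<And>z. z \<in> ?X \<times> ?Y \<Longrightarrow> \<bar>c z\<bar> \<le> B"
    unfolding bounded_pos by (metis image_eqI real_norm_def)
  obtain N and q :: "'a \<Rightarrow> nat" where q[measurable]: "q \<in> borel \<rightarrow>\<^sub>M count_space UNIV"
    and qN: "\<And>x. q x < N \<longleftrightarrow> x \<in> ?X" and qd: "\<And>x x'. x \<in> ?X \<Longrightarrow> x' \<in> ?X \<Longrightarrow> q x = q x' \<Longrightarrow> dist x x' < d / 2"
    using finite_partition[of ?X "d / 2"] compact_left compact_imp_bounded d(1) by (metis half_gt_zero measurable_supports(1))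
  obtain N' and q' :: "'b \<Rightarrow> nat" where q'[measurable]: "q' \<in> borel \<rightarrow>\<^sub>M count_space UNIV"
    and q'N: "\<And>x. q' x < N' \<longleftrightarrow> x \<in> ?Y" and q'd: "\<And>x x'. x \<in> ?Y \<Longrightarrow> x' \<in> ?Y \<Longrightarrow> q' x = q' x' \<Longrightarrow> dist x x' < d / 2"
    using finite_partition[of ?Y "d / 2"] compact_right compact_imp_bounded d(1) by (metis half_gt_zero measurable_supports(2))
  define m where "m i = M1.prob (q -` {i})" for i
  define n where "n j = M2.prob (q' -` {j})" for j
  define I where "I = {i. i < N \<and> m i > 0}"
  define J where "J = {j. j < N' \<and> n j > 0}"
  have fin: "finite I" "finite J" by (auto simp: I_def J_def)
  have ms: "q -` {i} \<in> sets borel" "q' -` {i} \<in> sets borel" for i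
    using measurable_sets[OF q, of "{i}"] measurable_sets[OF q', of "{i}"] by auto
  have AEI: "AE x in \<mu>. q x \<in> I"
    using M1.AE_positive_cell[of q N] AE_spt[OF sets_left] by (simp add: I_def m_def qN)
  have AEJ: "AE x in \<nu>. q' x \<in> J"
    using M2.AE_positive_cell[of q' N'] AE_spt[OF sets_right] by (simp add: J_def n_def q'N)
  have mI: "sum m I = 1" using M1.sum_prob_finite_valued[OF _ fin(1) AEI] by (simp add: m_def)
  have nJ: "sum n J = 1" using M2.sum_prob_finite_valued[OF _ fin(2) AEJ] by (simp add: n_def)
  have "\<exists>x. x \<in> ?X \<and> q x = i" if "i \<in> I" for i
  proof -
    have "q -` {i} \<noteq> {}" using that by (auto simp: I_def m_def)
    then show ?thesis using that qN by (auto simp: I_def)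
  qed
  then obtain xx where xx: "\<And>i. i \<in> I \<Longrightarrow> xx i \<in> ?X" "\<And>i. i \<in> I \<Longrightarrow> q (xx i) = i" by metis
  have "\<exists>x. x \<in> ?Y \<and> q' x = i" if "i \<in> J" for i
  proof -
    have "q' -` {i} \<noteq> {}" using that by (auto simp: J_def n_def)
    then show ?thesis using that q'N by (auto simp: J_def)
  qed
  then obtain yy where yy: "\<And>i. i \<in> J \<Longrightarrow> yy i \<in> ?Y" "\<And>i. i \<in> J \<Longrightarrow> q' (yy i) = i" by metis
  \<comment> \<open>Lowering the sample value by the oscillation turns the finite constraint
    \<open>f i + g j \<le> cc i j\<close> into an exact inequality for \<open>c\<close> at all
    points of the product cell.\<close>
  define cc where "cc i j = c (xx i, yy j) - \<eta> / 3" for i j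
  have cc: "cc (q x) (q' y) \<le> c (x, y)" "c (x, y) \<le> cc (q x) (q' y) + 2 * \<eta> / 3"
    if "x \<in> ?X" "y \<in> ?Y" "q x \<in> I" "q' y \<in> J" for x y
  proof -
    have "dist (x, y) (xx (q x), yy (q' y)) \<le> dist x (xx (q x)) + dist y (yy (q' y))"
      unfolding dist_Pair_Pair using sqrt_sum_squares_le_sum by simp
    also have "\<dots> < d" using qd[of x "xx (q x)"] q'd[of y "yy (q' y)"] that xx yy by fastforce
    finally have "\<bar>c (x, y) - c (xx (q x), yy (q' y))\<bar> < \<eta> / 3" using that xx yy by (intro d) auto
    then show "cc (q x) (q' y) \<le> c (x, y)" "c (x, y) \<le> cc (q x) (q' y) + 2 * \<eta> / 3"
      unfolding cc_def by linarith+
  qed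
  have mpos: "0 < m i" if "i \<in> I" for i using that by (simp add: I_def)
  have npos: "0 \<le> n j" if "j \<in> J" for j using that by (simp add: J_def)
  have e3: "0 < \<eta> / 3" using \<open>0 < \<eta>\<close> by simp
  obtain f g \<pi> where p0: "\<And>i j. i \<in> I \<Longrightarrow> j \<in> J \<Longrightarrow> 0 \<le> \<pi> i j"
    and fg: "\<And>i j. i \<in> I \<Longrightarrow> j \<in> J \<Longrightarrow> f i + g j \<le> cc i j"
    and row: "\<And>i. i \<in> I \<Longrightarrow> (\<Sum>j\<in>J. \<pi> i j) = m i"
    and col: "\<And>j. j \<in> J \<Longrightarrow> (\<Sum>i\<in>I. \<pi> i j) = n j"
    and dual: "(\<Sum>i\<in>I. \<Sum>j\<in>J. \<pi> i j * cc i j) \<le> (\<Sum>i\<in>I. f i * m i) + (\<Sum>j\<in>J. g j * n j) + \<eta> / 3"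
    by (rule finite_transport_duality[OF fin mpos mI npos nJ e3, of cc]; (assumption | (rule that; (assumption | blast))))
  define Sf Sg where "Sf = (\<Sum>i\<in>I. \<bar>f i\<bar>)" and "Sg = (\<Sum>j\<in>J. \<bar>g j\<bar>)"
  \<comment> \<open>Points of a support may lie in null cells, about which the finite problem says
    nothing. The value \<open>- L\<close> there is low enough against any partner, so the constraint
    holds at every point of the supports and not merely almost everywhere.\<close>
  define L where "L = B + Sf + Sg"
  have fL: "\<bar>f i\<bar> \<le> Sf" if "i \<in> I" for i
    using member_le_sum[of i I "\<lambda>i. \<bar>f i\<bar>"] that fin by (simp add: Sf_def)
  have gL: "\<bar>g i\<bar> \<le> Sg" if "i \<in> J" for i
    using member_le_sum[of i J "\<lambda>i. \<bar>g i\<bar>"] that fin by (simp add: Sg_def)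
  have sum0: "0 \<le> Sf" "0 \<le> Sg" by (simp_all add: Sf_def Sg_def)
  define \<phi> where "\<phi> x = (if q x \<in> I then f (q x) else - L)" for x
  define \<psi> where "\<psi> y = (if q' y \<in> J then g (q' y) else - L)" for y
  have \<phi>[measurable]: "\<phi> \<in> borel_measurable borel"
    unfolding \<phi>_def by (rule measurable_compose[OF q, of "\<lambda>i. if i \<in> I then f i else - L"]) simp
  have \<psi>[measurable]: "\<psi> \<in> borel_measurable borel"
    unfolding \<psi>_def by (rule measurable_compose[OF q', of "\<lambda>i. if i \<in> J then g i else - L"]) simp
  have \<phi>L: "\<bar>\<phi> x\<bar> \<le> L" for x using fL[of "q x"] B(1) sum0 by (auto simp: \<phi>_def L_def)
  have \<psi>L: "\<bar>\<psi> x\<bar> \<le> L" for x using gL[of "q' x"] B(1) sum0 by (auto simp: \<psi>_def L_def)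
  have le: "\<phi> x + \<psi> y \<le> c (x, y)" if "x \<in> ?X" "y \<in> ?Y" for x y
  proof (cases "q x \<in> I \<and> q' y \<in> J")
    case True
    then show ?thesis using cc(1)[OF that] fg[of "q x" "q' y"] by (simp add: \<phi>_def \<psi>_def)
  next
    case False
    have "- B \<le> c (x, y)" using B(2)[of "(x, y)"] that by auto
    then show ?thesis using False fL[of "q x"] gL[of "q' y"] B(1) sum0 by (auto simp: \<phi>_def \<psi>_def L_def)
  qed
  \<comment> \<open>The mass \<open>\<pi> i j\<close> is spread over the product cell in proportion
    to the product measure, whose mass there is \<open>m i * n j\<close>.\<close>
  define r where "r i j = (if i \<in> I \<and> j \<in> J then \<pi> i j / (m i * n j) else 0)" for i j
  define \<rho> where "\<rho> z = ennreal (r (q (fst z)) (q' (snd z)))" for z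
  have r0: "0 \<le> r i j" for i j using p0 by (auto simp: r_def I_def J_def)
  have qq: "(\<lambda>z. (q (fst z), q' (snd z))) \<in> borel \<rightarrow>\<^sub>M count_space UNIV"
    by measurable
  have \<rho>: "\<rho> \<in> borel_measurable borel"
    unfolding \<rho>_def using measurable_compose[OF qq, of "\<lambda>p. ennreal (r (fst p) (snd p))" borel] by simp
  have \<rho>1: "AE x in \<mu>. (\<integral>\<^sup>+y. \<rho> (x, y) \<partial>\<nu>) = 1"
    using AEI
  proof eventually_elim
    case (elim x)
    have "(\<integral>\<^sup>+y. \<rho> (x, y) \<partial>\<nu>) = (\<Sum>j\<in>J. ennreal (r (q x) j) * emeasure \<nu> (q' -` {j} \<inter> space \<nu>))"
      unfolding \<rho>_def fst_conv snd_conv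
      by (rule M2.nn_integral_finite_valued[OF _ fin(2) AEJ, of "\<lambda>j. ennreal (r (q x) j)"]) simp
    also have "\<dots> = (\<Sum>j\<in>J. ennreal (\<pi> (q x) j / m (q x)))"
      using elim by (intro sum.cong refl) (auto simp: M2.emeasure_eq_measure r_def J_def n_def simp flip: ennreal_mult'')
    also have "\<dots> = ennreal (\<Sum>j\<in>J. \<pi> (q x) j / m (q x))"
      using elim p0 by (intro sum_ennreal) (auto simp: I_def)
    also have "\<dots> = 1" using elim row by (simp add: I_def flip: sum_divide_distrib)
    finally show ?case .
  qed
  have \<rho>2: "AE y in \<nu>. (\<integral>\<^sup>+x. \<rho> (x, y) \<partial>\<mu>) = 1"
    using AEJ
  proof eventually_elim
    case (elim y)
    have "(\<integral>\<^sup>+x. \<rho> (x, y) \<partial>\<mu>) = (\<Sum>i\<in>I. ennreal (r i (q' y)) * emeasure \<mu> (q -` {i} \<inter> space \<mu>))"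
      unfolding \<rho>_def fst_conv snd_conv
      by (rule M1.nn_integral_finite_valued[OF _ fin(1) AEI, of "\<lambda>i. ennreal (r i (q' y))"]) simp
    also have "\<dots> = (\<Sum>i\<in>I. ennreal (\<pi> i (q' y) / n (q' y)))"
      using elim by (intro sum.cong refl) (auto simp: M1.emeasure_eq_measure r_def I_def m_def simp flip: ennreal_mult'')
    also have "\<dots> = ennreal (\<Sum>i\<in>I. \<pi> i (q' y) / n (q' y))"
      using elim p0 by (intro sum_ennreal) (auto simp: J_def)
    also have "\<dots> = 1" using elim col by (simp add: J_def flip: sum_divide_distrib)
    finally show ?case .
  qed
  let ?\<gamma> = "density (\<mu> \<Otimes>\<^sub>M \<nu>) \<rho>"
  have \<gamma>: "?\<gamma> \<in> couplings \<mu> \<nu>" by (rule density_in_couplings[OF \<rho> \<rho>1 \<rho>2])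
  have AEIJ: "AE z in \<mu> \<Otimes>\<^sub>M \<nu>. (q (fst z), q' (snd z)) \<in> I \<times> J"
    using AE_fst[OF AEI] AE_snd[OF AEJ] by eventually_elim auto
  define G where "G p = (if p \<in> I \<times> J then cc (fst p) (snd p) + 2 * \<eta> / 3 else 0)" for p
  have Gm: "(\<lambda>z. G (q (fst z), q' (snd z))) \<in> borel_measurable borel"
    using measurable_compose[OF qq, of G borel] by simp
  have Gint: "integrable ?\<gamma> (\<lambda>z. G (q (fst z), q' (snd z)))"
  proof (rule integrable_couplings[OF \<gamma> Gm])
    have "\<bar>G p\<bar> \<le> (\<Sum>p\<in>I\<times>J. \<bar>G p\<bar>)" for p
      using member_le_sum[of p "I \<times> J" "\<lambda>p. \<bar>G p\<bar>"] fin
      by (cases "p \<in> I \<times> J") (auto simp: G_def sum_nonneg)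
    then show "AE z in ?\<gamma>. \<bar>G (q (fst z), q' (snd z))\<bar> \<le> (\<Sum>p\<in>I\<times>J. \<bar>G p\<bar>)" by simp
  qed
  have "transport_cost \<mu> \<nu> c ?\<gamma> \<le> (\<integral>z. G (q (fst z), q' (snd z)) \<partial>?\<gamma>)"
  proof (rule transport_cost_mono[OF \<gamma> c Gint])
    show "AE z in ?\<gamma>. z \<in> ?X \<times> ?Y \<longrightarrow> c z \<le> G (q (fst z), q' (snd z))"
    proof -
      have "AE z in \<mu> \<Otimes>\<^sub>M \<nu>. 0 < \<rho> z \<longrightarrow> z \<in> ?X \<times> ?Y \<longrightarrow> c z \<le> G (q (fst z), q' (snd z))"
        using AEIJ
      proof eventually_elim
        case (elim z)
        then show ?case using cc(2)[of "fst z" "snd z"] by (auto simp: G_def)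
      qed
      then show ?thesis using \<rho> by (simp add: AE_density)
    qed
  qed
  also have "\<dots> = (\<integral>z. r (q (fst z)) (q' (snd z)) * G (q (fst z), q' (snd z)) \<partial>(\<mu> \<Otimes>\<^sub>M \<nu>))"
    unfolding \<rho>_def using r0 Gm measurable_compose[OF qq, of "\<lambda>p. r (fst p) (snd p)" borel]
    by (subst integral_density) auto
  also have "\<dots> = (\<Sum>p\<in>I\<times>J. (r (fst p) (snd p) * G p) * prob ((\<lambda>z. (q (fst z), q' (snd z))) -` {p} \<inter> space (\<mu> \<Otimes>\<^sub>M \<nu>)))"
    using integral_finite_valued[OF _ _ AEIJ, of "\<lambda>p. r (fst p) (snd p) * G p"] qq fin by simp
  also have "\<dots> = (\<Sum>p\<in>I\<times>J. \<pi> (fst p) (snd p) * (cc (fst p) (snd p) + 2 * \<eta> / 3))"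
  proof (intro sum.cong refl)
    fix p assume p: "p \<in> I \<times> J"
    have "(\<lambda>z. (q (fst z), q' (snd z))) -` {p} \<inter> space (\<mu> \<Otimes>\<^sub>M \<nu>) = q -` {fst p} \<times> q' -` {snd p}"
      by auto
    moreover have "prob (q -` {fst p} \<times> q' -` {snd p}) = m (fst p) * n (snd p)"
      unfolding m_def n_def measure_def by (subst M2.emeasure_pair_measure_Times) (auto simp: ms enn2real_mult)
    ultimately show "(r (fst p) (snd p) * G p) * prob ((\<lambda>z. (q (fst z), q' (snd z))) -` {p} \<inter> space (\<mu> \<Otimes>\<^sub>M \<nu>))
      = \<pi> (fst p) (snd p) * (cc (fst p) (snd p) + 2 * \<eta> / 3)"
      using p by (auto simp: r_def G_def I_def J_def)
  qed
  also have "\<dots> = (\<Sum>i\<in>I. \<Sum>j\<in>J. \<pi> i j * cc i j) + (\<Sum>i\<in>I. \<Sum>j\<in>J. \<pi> i j * (2 * \<eta> / 3))"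
    unfolding sum.cartesian_product by (simp add: case_prod_unfold distrib_left sum.distrib)
  also have "(\<Sum>i\<in>I. \<Sum>j\<in>J. \<pi> i j * (2 * \<eta> / 3)) = 2 * \<eta> / 3"
  proof -
    have "(\<Sum>i\<in>I. \<Sum>j\<in>J. \<pi> i j * (2 * \<eta> / 3)) = (\<Sum>i\<in>I. (\<Sum>j\<in>J. \<pi> i j) * (2 * \<eta> / 3))"
      by (simp only: sum_distrib_right)
    also have "\<dots> = sum m I * (2 * \<eta> / 3)" unfolding sum_distrib_right by (intro sum.cong refl) (simp only: row flip: sum_distrib_right)
    finally show ?thesis using mI by simp
  qed
  finally have "transport_cost \<mu> \<nu> c ?\<gamma> \<le> (\<Sum>i\<in>I. f i * m i) + (\<Sum>j\<in>J. g j * n j) + \<eta>"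
    using dual by simp
  also have "(\<Sum>i\<in>I. f i * m i) = (\<integral>x. \<phi> x \<partial>\<mu>)"
    unfolding \<phi>_def using M1.integral_finite_valued[OF _ fin(1) AEI, of "\<lambda>i. if i \<in> I then f i else - L"]
    by (simp add: m_def)
  also have "(\<Sum>j\<in>J. g j * n j) = (\<integral>y. \<psi> y \<partial>\<nu>)"
    unfolding \<psi>_def using M2.integral_finite_valued[OF _ fin(2) AEJ, of "\<lambda>i. if i \<in> J then g i else - L"]
    by (simp add: n_def)
  finally show thesis
    using that[OF \<phi> _ \<psi> _ le \<rho> \<rho>1 \<rho>2] \<phi>L \<psi>L by (auto simp: bounded_iff)
qed

section \<open>Gibbs' variational principle\<close>

text \<open>This is \<open>ln t \<le> t - 1\<close> at \<open>t = b / a\<close>, the pointwise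
  inequality behind the nonnegativity of relative entropy.\<close>

lemma mult_ln_ge: "a - b \<le> a * ln (a / b)" if "0 \<le> a" "0 < b" for a b :: real
proof (cases "a = 0")
  case False
  then have "ln (b / a) \<le> b / a - 1" using that by (intro ln_le_minus_one) simp
  then have "a * ln (b / a) \<le> a * (b / a - 1)" using that by (intro mult_left_mono) auto
  moreover have "ln (b / a) = - ln (a / b)" using False that by (simp add: ln_div)
  ultimately show ?thesis using False by (simp add: right_diff_distrib)
qed (use that in auto)

context borel_prob_pair
begin

text \<open>The Radon-Nikodym derivative agrees with \<open>r\<close> almost everywhere, and
  integrability makes both parts of the extended difference in \<open>Ent\<close> finite.\<close>

lemma Ent_density:
  assumes [measurable]: "r \<in> borel_measurable borel" and r0: "\<And>z. 0 \<le> r z"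
    and prob: "prob_space (density (\<mu> \<Otimes>\<^sub>M \<nu>) (\<lambda>z. ennreal (r z)))"
    and int: "integrable (\<mu> \<Otimes>\<^sub>M \<nu>) (\<lambda>z. r z * ln (r z))"
  shows "Ent (density (\<mu> \<Otimes>\<^sub>M \<nu>) (\<lambda>z. ennreal (r z))) (\<mu> \<Otimes>\<^sub>M \<nu>) = ereal (\<integral>z. r z * ln (r z) \<partial>(\<mu> \<Otimes>\<^sub>M \<nu>))"
proof -
  let ?P = "\<mu> \<Otimes>\<^sub>M \<nu>" and ?\<gamma> = "density (\<mu> \<Otimes>\<^sub>M \<nu>) (\<lambda>z. ennreal (r z))"
  define \<rho> where "\<rho> z = enn2real (RN_deriv ?P ?\<gamma> z)" for z
  have "AE z in ?P. ennreal (r z) = RN_deriv ?P ?\<gamma> z"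
    by (rule RN_deriv_unique) auto
  then have ae: "AE z in ?P. \<rho> z = r z"
    by eventually_elim (metis \<rho>_def enn2real_ennreal r0)
  have ac: "absolutely_continuous ?P ?\<gamma>" by (rule absolutely_continuousI_density) simp
  have m: "\<rho> \<in> borel_measurable borel"
    unfolding \<rho>_def using borel_measurable_RN_deriv[of ?P ?\<gamma>] by simp
  let ?f = "\<lambda>z. r z * ln (r z)"
  have p: "(\<integral>\<^sup>+z. ennreal (\<rho> z * ln (\<rho> z)) \<partial>?P) = (\<integral>\<^sup>+z. ennreal (?f z) \<partial>?P)"
    and n: "(\<integral>\<^sup>+z. ennreal (- (\<rho> z * ln (\<rho> z))) \<partial>?P) = (\<integral>\<^sup>+z. ennreal (- ?f z) \<partial>?P)"
    using ae by (auto intro!: nn_integral_cong_AE)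
  have fin: "(\<integral>\<^sup>+z. ennreal (?f z) \<partial>?P) < \<infinity>" "(\<integral>\<^sup>+z. ennreal (- ?f z) \<partial>?P) < \<infinity>"
    using int unfolding real_integrable_def by (auto simp: less_top)
  have "enn2ereal a - enn2ereal b = ereal (enn2real a - enn2real b)" if "a < \<infinity>" "b < \<infinity>" for a b
    using that by (cases a; cases b) (auto simp: enn2ereal_ennreal)
  from this[OF fin] show ?thesis
    unfolding Ent_def Let_def using ac by (simp add: \<rho>_def[symmetric] p n real_lebesgue_integral_def[OF int])
qed

text \<open>The plan is compared with the reference density \<open>exp (- (c - \<phi> - \<psi>) / \<epsilon>) / Z\<close>.\<close>
lemma entropic_cost_ge:
  fixes \<phi> :: "'a \<Rightarrow> real" and \<psi> :: "'b \<Rightarrow> real" and c :: "'a \<times> 'b \<Rightarrow> real"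
  assumes \<gamma>: "\<gamma> \<in> couplings \<mu> \<nu>" and c: "continuous_on (spt \<mu> \<times> spt \<nu>) c"
    and \<phi>[measurable]: "\<phi> \<in> borel_measurable borel" and B: "\<And>x. \<bar>\<phi> x\<bar> \<le> B"
    and \<psi>[measurable]: "\<psi> \<in> borel_measurable borel" and B': "\<And>y. \<bar>\<psi> y\<bar> \<le> B'"
    and "0 < \<epsilon>" "0 < Z"
    and Z: "(\<integral>\<^sup>+z. ennreal (indicator (spt \<mu> \<times> spt \<nu>) z * exp (- (c z - \<phi> (fst z) - \<psi> (snd z)) / \<epsilon>)) \<partial>(\<mu> \<Otimes>\<^sub>M \<nu>)) \<le> ennreal Z"
  shows "ereal ((\<integral>x. \<phi> x \<partial>\<mu>) + (\<integral>y. \<psi> y \<partial>\<nu>) - \<epsilon> * ln Z)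
    \<le> ereal (transport_cost \<mu> \<nu> c \<gamma>) + ereal \<epsilon> * Ent \<gamma> (\<mu> \<Otimes>\<^sub>M \<nu>)"
proof -
  let ?P = "\<mu> \<Otimes>\<^sub>M \<nu>" and ?XY = "spt \<mu> \<times> spt \<nu>"
  interpret G: prob_space \<gamma> using \<gamma> by (simp add: couplings_def)
  have sets\<gamma>: "sets \<gamma> = sets borel" using \<gamma> by (simp add: couplings_def)
  define \<rho> where "\<rho> z = enn2real (RN_deriv ?P \<gamma> z)" for z
  show ?thesis
  proof (cases "absolutely_continuous ?P \<gamma>")
    case False
    then show ?thesis using \<open>0 < \<epsilon>\<close> by (simp add: Ent_def)
  next
    case ac: True
    have \<rho>[measurable]: "\<rho> \<in> borel_measurable borel"
      unfolding \<rho>_def using borel_measurable_RN_deriv[of ?P \<gamma>] by simp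
    have \<rho>0: "0 \<le> \<rho> z" for z by (simp add: \<rho>_def)
    have "AE z in ?P. RN_deriv ?P \<gamma> z \<noteq> \<infinity>"
      using ac sets\<gamma> by (intro RN_deriv_finite) (auto intro: prob_space_imp_sigma_finite G.prob_space_axioms)
    then have "AE z in ?P. RN_deriv ?P \<gamma> z = ennreal (\<rho> z)"
      by eventually_elim (auto simp: \<rho>_def ennreal_enn2real_if)
    then have "density ?P (RN_deriv ?P \<gamma>) = density ?P (\<lambda>z. ennreal (\<rho> z))"
      by (intro density_cong) (auto simp: borel_measurable_RN_deriv)
    then have dens: "\<gamma> = density ?P (\<lambda>z. ennreal (\<rho> z))"
      using density_RN_deriv[OF ac] sets\<gamma> by simp
    have \<rho>_nn: "(\<integral>\<^sup>+z. ennreal (\<rho> z) \<partial>?P) = 1"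
      using G.emeasure_space_1 unfolding dens by (subst (asm) emeasure_density) auto
    have \<rho>_int: "integrable ?P \<rho>"
      using \<rho>_nn \<rho>0 by (intro integrableI_nonneg) auto
    have \<rho>_1: "(\<integral>z. \<rho> z \<partial>?P) = 1"
      using \<rho>_nn nn_integral_eq_integral[OF \<rho>_int] \<rho>0 by simp
    let ?f = "\<lambda>z. \<rho> z * ln (\<rho> z)"
    \<comment> \<open>The negative part of \<open>\<rho> z * ln (\<rho> z)\<close> is thus always
      integrable, so the entropy is either infinite, where nothing is left to prove, or an ordinary
      integral.\<close>
    have fge: "-1 \<le> ?f z" for z
      using mult_ln_ge[of "\<rho> z" 1] \<rho>0[of z] by simp
    have neg: "(\<integral>\<^sup>+z. ennreal (- ?f z) \<partial>?P) < \<infinity>"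
    proof -
      have "(\<integral>\<^sup>+z. ennreal (- ?f z) \<partial>?P) \<le> (\<integral>\<^sup>+z. 1 \<partial>?P)"
        using fge by (intro nn_integral_mono) (simp add: ennreal_le_1 minus_le_iff)
      also have "\<dots> < \<infinity>" using emeasure_space_1 by simp
      finally show ?thesis .
    qed
    show ?thesis
    proof (cases "(\<integral>\<^sup>+z. ennreal (?f z) \<partial>?P) = \<infinity>")
      case True
      obtain b where "(\<integral>\<^sup>+z. ennreal (- ?f z) \<partial>?P) = ennreal b" "0 \<le> b"
        using neg by (cases "\<integral>\<^sup>+z. ennreal (- ?f z) \<partial>?P") auto
      then have "Ent \<gamma> ?P = \<infinity>"
        unfolding Ent_def Let_def using ac sets\<gamma> True by (simp add: \<rho>_def[symmetric] enn2ereal_ennreal)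
      then show ?thesis using \<open>0 < \<epsilon>\<close> by simp
    next
      case False
      have fint: "integrable ?P ?f"
        using False neg unfolding real_integrable_def by (auto simp: less_top)
      have Ent: "Ent \<gamma> ?P = ereal (\<integral>z. ?f z \<partial>?P)"
        unfolding dens using Ent_density[OF \<rho> \<rho>0 _ fint] G.prob_space_axioms unfolding dens[symmetric] by simp
      define E where "E z = indicator ?XY z *\<^sub>R c z - (\<phi> (fst z) + \<psi> (snd z))" for z
      have Em[measurable]: "E \<in> borel_measurable borel"
        unfolding E_def by (intro borel_measurable_diff measurable_cost[OF c]) measurable
      note ip = integral_potentials[OF \<gamma> \<phi> B \<psi> B']
      have Eint: "integrable \<gamma> E"
        unfolding E_def using integrable_cost[OF \<gamma> c] ip(1) by simp
      have tc: "transport_cost \<mu> \<nu> c \<gamma> = (\<integral>z. E z \<partial>\<gamma>) + ((\<integral>x. \<phi> x \<partial>\<mu>) + (\<integral>y. \<psi> y \<partial>\<nu>))"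
        unfolding E_def transport_cost_def set_lebesgue_integral_def
        using integrable_cost[OF \<gamma> c] ip by simp
      have EP: "(\<integral>z. E z \<partial>\<gamma>) = (\<integral>z. \<rho> z * E z \<partial>?P)"
        unfolding dens using \<rho>0 by (subst integral_density) auto
      have EPint: "integrable ?P (\<lambda>z. \<rho> z * E z)"
        using Eint \<rho>0 unfolding dens by (subst (asm) integrable_density) auto
      define k where "k z = indicator ?XY z * exp (- (c z - \<phi> (fst z) - \<psi> (snd z)) / \<epsilon>)" for z
      have k_eq: "k z = indicator ?XY z * exp (- E z / \<epsilon>)" for z
        by (auto simp: k_def E_def split: split_indicator)
      have km[measurable]: "k \<in> borel_measurable borel" unfolding k_eq by measurable
      have k0: "0 \<le> k z" for z by (simp add: k_def)
      have kZ': "(\<integral>\<^sup>+z. ennreal (k z) \<partial>?P) \<le> ennreal Z" using Z unfolding k_def .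
      have kint: "integrable ?P k"
        using k0 le_less_trans[OF kZ'] by (intro integrableI_nonneg) auto
      have kZ: "(\<integral>z. k z \<partial>?P) \<le> Z"
        using kZ' nn_integral_eq_integral[OF kint] k0 \<open>0 < Z\<close> by simp
      \<comment> \<open>This is \<open>mult_ln_ge\<close> for the density \<rho> of the plan and the
        reference density \<open>k z / Z\<close>. After integration the first two terms on the left
        are nonnegative together, because \<rho> has integral 1 and \<open>k\<close> at most
        \<open>Z\<close>; what remains is \<open>- ln Z\<close>.\<close>
      have "AE z in ?P. \<rho> z - k z / Z - \<rho> z * ln Z \<le> \<rho> z * E z / \<epsilon> + ?f z"
        using AE_pair_spt
      proof eventually_elim
        case (elim z)
        have kz: "k z = exp (- E z / \<epsilon>)" using elim by (simp add: k_eq)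
        then have kpos: "0 < k z / Z" using \<open>0 < Z\<close> by simp
        have "\<rho> z - k z / Z \<le> \<rho> z * ln (\<rho> z / (k z / Z))"
          using \<rho>0 kpos by (rule mult_ln_ge)
        also have "\<dots> = ?f z + \<rho> z * E z / \<epsilon> + \<rho> z * ln Z"
        proof (cases "\<rho> z = 0")
          case False
          then have "ln (\<rho> z / (k z / Z)) = ln (\<rho> z) - (ln (k z) - ln Z)"
            using \<rho>0[of z] \<open>0 < Z\<close> by (simp add: kz ln_div ln_mult)
          moreover have "ln (k z) = - E z / \<epsilon>" by (simp add: kz)
          ultimately show ?thesis by (simp add: algebra_simps)
        qed simp
        finally show ?case by simp
      qed
      then have "(\<integral>z. \<rho> z - k z / Z - \<rho> z * ln Z \<partial>?P) \<le> (\<integral>z. \<rho> z * E z / \<epsilon> + ?f z \<partial>?P)"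
        using \<rho>_int kint EPint fint by (intro integral_mono_AE) auto
      then have "1 - (\<integral>z. k z \<partial>?P) / Z - ln Z \<le> (\<integral>z. \<rho> z * E z \<partial>?P) / \<epsilon> + (\<integral>z. ?f z \<partial>?P)"
        using \<rho>_int kint EPint fint \<rho>_1 by simp
      moreover have "(\<integral>z. k z \<partial>?P) / Z \<le> 1" using kZ \<open>0 < Z\<close> by simp
      ultimately have "- ln Z \<le> (\<integral>z. E z \<partial>\<gamma>) / \<epsilon> + (\<integral>z. ?f z \<partial>?P)" unfolding EP by linarith
      then have "\<epsilon> * - ln Z \<le> \<epsilon> * ((\<integral>z. E z \<partial>\<gamma>) / \<epsilon> + (\<integral>z. ?f z \<partial>?P))"
        using \<open>0 < \<epsilon>\<close> by (intro mult_left_mono) auto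
      then show ?thesis
        using \<open>0 < \<epsilon>\<close> unfolding tc Ent by (simp add: algebra_simps)
    qed
  qed
qed

end

section \<open>Laplace bound for twisted costs\<close>

text \<open>The integrand factors over the coordinates into multiples of normal densities of
  variance \<open>a / 2\<close>. With \<open>a\<close> proportional to \<epsilon> this is the source
  of the factor \<open>sqrt \<epsilon> ^ DIM('a)\<close> in the lower bound.\<close>

lemma nn_integral_gaussian:
  fixes x0 :: "'a::euclidean_space"
  assumes "0 < a"
  shows "(\<integral>\<^sup>+x. ennreal (exp (- (norm (x - x0))\<^sup>2 / a)) \<partial>lborel) = ennreal (sqrt (pi * a) ^ DIM('a))"
proof -
  define \<sigma> where "\<sigma> = sqrt (a / 2)"
  have \<sigma>: "0 < \<sigma>" "2 * \<sigma>\<^sup>2 = a" using assms by (auto simp: \<sigma>_def)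
  have eq: "exp (- (t - s)\<^sup>2 / a) = sqrt (pi * a) * normal_density s \<sigma> t" for s t :: real
  proof -
    have "2 * pi * \<sigma>\<^sup>2 = pi * a" using \<sigma>(2) by simp
    then have "normal_density s \<sigma> t = 1 / sqrt (pi * a) * exp (- (t - s)\<^sup>2 / a)"
      unfolding normal_density_def using \<sigma>(2) by (simp only:)
    then show ?thesis using assms by simp
  qed
  have one: "(\<integral>\<^sup>+t. ennreal (exp (- (t - s)\<^sup>2 / a)) \<partial>lborel) = ennreal (sqrt (pi * a))" for s :: real
  proof -
    have "(\<integral>\<^sup>+t. ennreal (normal_density s \<sigma> t) \<partial>lborel) = 1"
      using nn_integral_eq_integral[OF integrable_normal_density[OF \<sigma>(1), of s]] \<sigma>(1) by simp
    then show ?thesis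
      unfolding eq using assms by (simp add: ennreal_mult' nn_integral_cmult)
  qed
  have "(\<integral>\<^sup>+x. ennreal (exp (- (norm (x - x0))\<^sup>2 / a)) \<partial>lborel)
      = (\<integral>\<^sup>+x. (\<Prod>b\<in>Basis. ennreal (exp (- (x \<bullet> b - x0 \<bullet> b)\<^sup>2 / a))) \<partial>lborel)"
  proof (intro nn_integral_cong)
    fix x :: 'a
    have "(norm (x - x0))\<^sup>2 = (\<Sum>b\<in>Basis. (x \<bullet> b - x0 \<bullet> b)\<^sup>2)"
      by (subst power2_norm_eq_inner, subst euclidean_inner) (simp add: inner_diff_left power2_eq_square)
    then have "- (norm (x - x0))\<^sup>2 / a = (\<Sum>b\<in>Basis. - (x \<bullet> b - x0 \<bullet> b)\<^sup>2 / a)"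
      by (simp add: sum_divide_distrib sum_negf)
    then have "exp (- (norm (x - x0))\<^sup>2 / a) = (\<Prod>b\<in>Basis. exp (- (x \<bullet> b - x0 \<bullet> b)\<^sup>2 / a))"
      using exp_sum[OF finite_Basis, of "\<lambda>b. - (x \<bullet> b - x0 \<bullet> b)\<^sup>2 / a"] by (rule ssubst)
    then show "ennreal (exp (- (norm (x - x0))\<^sup>2 / a)) = (\<Prod>b\<in>Basis. ennreal (exp (- (x \<bullet> b - x0 \<bullet> b)\<^sup>2 / a)))"
      using prod_ennreal[of Basis "\<lambda>b. exp (- (x \<bullet> b - x0 \<bullet> b)\<^sup>2 / a)"] by (metis exp_ge_zero)
  qed
  also have "\<dots> = (\<Prod>b\<in>(Basis :: 'a set). \<integral>\<^sup>+t. ennreal (exp (- (t - x0 \<bullet> b)\<^sup>2 / a)) \<partial>lborel)"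
    by (rule nn_integral_lborel_prod) simp_all
  also have "\<dots> = ennreal (sqrt (pi * a)) ^ DIM('a)"
    unfolding one by (rule prod_constant)
  also have "\<dots> = ennreal (sqrt (pi * a) ^ DIM('a))"
    using assms by (intro ennreal_power) simp
  finally show ?thesis .
qed

lemma nn_integral_lborel_translate:
  fixes f :: "'a::euclidean_space \<Rightarrow> ennreal"
  assumes [measurable]: "f \<in> borel_measurable borel"
  shows "(\<integral>\<^sup>+x. f (a + x) \<partial>lborel) = (\<integral>\<^sup>+x. f x \<partial>lborel)"
proof -
  have "(\<integral>\<^sup>+x. f x \<partial>lborel) = (\<integral>\<^sup>+x. f x \<partial>(distr lborel borel ((+) a)))"
    by (simp only: lborel_distr_plus)
  also have "\<dots> = (\<integral>\<^sup>+x. f (a + x) \<partial>lborel)" by (subst nn_integral_distr) auto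
  finally show ?thesis ..
qed

text \<open>The shear \<open>(x, w) \<mapsto> (x, T x + w)\<close> preserves Lebesgue measure:
  translation invariance in \<open>y\<close> for fixed \<open>x\<close>, then Tonelli.\<close>

lemma nn_integral_slices:
  fixes F :: "'a::euclidean_space \<times> 'a \<Rightarrow> ennreal" and T :: "'a \<Rightarrow> 'a"
  assumes F[measurable]: "F \<in> borel_measurable borel" and T[measurable]: "T \<in> borel_measurable borel"
  shows "(\<integral>\<^sup>+x. \<integral>\<^sup>+y. F (x, y) \<partial>lborel \<partial>lborel) = (\<integral>\<^sup>+w. \<integral>\<^sup>+x. F (x, T x + w) \<partial>lborel \<partial>lborel)"
proof -
  have "(\<integral>\<^sup>+x. \<integral>\<^sup>+y. F (x, y) \<partial>lborel \<partial>lborel) = (\<integral>\<^sup>+x. \<integral>\<^sup>+w. F (x, T x + w) \<partial>lborel \<partial>lborel)"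
    by (intro nn_integral_cong nn_integral_lborel_translate[symmetric]) measurable
  also have "\<dots> = (\<integral>\<^sup>+w. \<integral>\<^sup>+x. F (x, T x + w) \<partial>lborel \<partial>lborel)"
  proof (rule lborel_pair.Fubini'[symmetric])
    have "(\<lambda>p. F (fst p, T (fst p) + snd p)) \<in> borel_measurable (borel \<Otimes>\<^sub>M borel)"
      by measurable
    then show "(\<lambda>(x, w). F (x, T x + w)) \<in> borel_measurable (lborel \<Otimes>\<^sub>M lborel)"
      by (simp add: case_prod_unfold measurable_cong_sets[OF sets_pair_measure_cong[OF sets_lborel sets_lborel] refl])
  qed
  finally show ?thesis .
qed

text \<open>The mean value theorem is applied twice: in the second variable to the difference of
  \<open>c\<close> at \<open>x\<close> and at \<open>x'\<close>, then in the first variable to the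
  resulting difference of derivatives. Convexity keeps the intermediate points in \<open>A\<close>
  and \<open>B\<close>.\<close>

lemma mixed_second_difference:
  fixes c :: "'a::real_normed_vector \<times> 'b::real_normed_vector \<Rightarrow> real"
  assumes c: "second_derivs S c c' c''" and S: "A \<times> B \<subseteq> S"
    and A: "convex A" "x \<in> A" "x' \<in> A" and B: "convex B" "y \<in> B" "y' \<in> B"
  obtains \<xi> \<zeta> where "\<xi> \<in> A" "\<zeta> \<in> B"
    "c (x, y) - c (x', y) - (c (x, y') - c (x', y')) = c'' (\<xi>, \<zeta>) (x - x', 0) (0, y - y')"
proof -
  define yy where "yy s = y' + s *\<^sub>R (y - y')" for s :: real
  define xx where "xx s = x' + s *\<^sub>R (x - x')" for s :: real
  have yyB: "yy s \<in> B" if "0 \<le> s" "s \<le> 1" for s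
  proof -
    have "yy s = (1 - s) *\<^sub>R y' + s *\<^sub>R y" by (simp add: yy_def algebra_simps)
    then show ?thesis using convexD_alt[OF B(1) B(3) B(2)] that by simp
  qed
  have xxA: "xx s \<in> A" if "0 \<le> s" "s \<le> 1" for s
  proof -
    have "xx s = (1 - s) *\<^sub>R x' + s *\<^sub>R x" by (simp add: xx_def algebra_simps)
    then show ?thesis using convexD_alt[OF A(1) A(3) A(2)] that by simp
  qed
  have d1: "(c has_derivative c' z) (at z)" if "z \<in> A \<times> B" for z
    using c S that unfolding second_derivs_def by auto
  have d2: "(c' has_derivative c'' z) (at z)" if "z \<in> A \<times> B" for z
    using c S that unfolding second_derivs_def by auto
  have g: "((\<lambda>s. c (p, yy s)) has_derivative (\<lambda>h. c' (p, yy s) (0, h *\<^sub>R (y - y')))) (at s within {0..1})"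
    if "p \<in> A" "0 \<le> s" "s \<le> 1" for p s
  proof -
    have "((\<lambda>s. (p, yy s)) has_derivative (\<lambda>h. (0, h *\<^sub>R (y - y')))) (at s within {0..1})"
      unfolding yy_def by (auto intro!: derivative_eq_intros)
    then show ?thesis using yyB that by (intro has_derivative_compose[OF _ d1]) auto
  qed
  have "\<exists>s\<in>{0..1}. (c (x, yy 1) - c (x', yy 1)) - (c (x, yy 0) - c (x', yy 0))
      = c' (x, yy s) (0, (1 - 0) *\<^sub>R (y - y')) - c' (x', yy s) (0, (1 - 0) *\<^sub>R (y - y'))"
    using A by (intro mvt_very_simple has_derivative_diff g) auto
  then obtain s where s: "0 \<le> s" "s \<le> 1" and
    s_eq: "c (x, y) - c (x', y) - (c (x, y') - c (x', y')) = c' (x, yy s) (0, y - y') - c' (x', yy s) (0, y - y')"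
    by (auto simp: yy_def)
  have h: "((\<lambda>t. c' (xx t, yy s) (0, y - y')) has_derivative (\<lambda>h. c'' (xx t, yy s) (h *\<^sub>R (x - x'), 0) (0, y - y'))) (at t within {0..1})"
    if "0 \<le> t" "t \<le> 1" for t
  proof -
    have "((\<lambda>t. (xx t, yy s)) has_derivative (\<lambda>h. (h *\<^sub>R (x - x'), 0))) (at t within {0..1})"
      unfolding xx_def by (auto intro!: derivative_eq_intros)
    then have "((\<lambda>t. c' (xx t, yy s)) has_derivative (\<lambda>h. c'' (xx t, yy s) (h *\<^sub>R (x - x'), 0))) (at t within {0..1})"
      using xxA yyB s that by (intro has_derivative_compose[OF _ d2]) auto
    then show ?thesis by (rule bounded_linear.has_derivative[OF blinfun.bounded_linear_left])
  qed
  have "\<exists>t\<in>{0..1}. c' (xx 1, yy s) (0, y - y') - c' (xx 0, yy s) (0, y - y') = c'' (xx t, yy s) ((1 - 0) *\<^sub>R (x - x'), 0) (0, y - y')"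
    by (intro mvt_very_simple h) auto
  then obtain t where t: "0 \<le> t" "t \<le> 1" and
    "c' (x, yy s) (0, y - y') - c' (x', yy s) (0, y - y') = c'' (xx t, yy s) (x - x', 0) (0, y - y')"
    by (auto simp: xx_def)
  then show thesis using that[of "xx t" "yy s"] xxA[of t] yyB[of s] s s_eq by simp
qed

lemma mixed_hessian_apply:
  fixes c'' :: "(real^'n) \<times> (real^'n) \<Rightarrow> ((real^'n) \<times> (real^'n)) \<Rightarrow>\<^sub>L (((real^'n) \<times> (real^'n)) \<Rightarrow>\<^sub>L real)"
  shows "c'' (x, y) (u, 0) (0, v) = u \<bullet> (mixed_hessian c'' x y *v v)"
proof -
  have u: "(u, 0) = (\<Sum>i\<in>UNIV. u $ i *\<^sub>R (axis i 1, 0))" for u :: "real^'n"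
    by (simp add: prod_eq_iff fst_sum snd_sum) (simp add: vec_eq_iff axis_def if_distrib[of "times _"] cong: if_cong)
  have v: "(0, v) = (\<Sum>i\<in>UNIV. v $ i *\<^sub>R (0, axis i 1))" for v :: "real^'n"
    by (simp add: prod_eq_iff fst_sum snd_sum) (simp add: vec_eq_iff axis_def if_distrib[of "times _"] cong: if_cong)
  have "c'' (x, y) (u, 0) (0, v) = (\<Sum>j\<in>UNIV. \<Sum>i\<in>UNIV. v $ j * (u $ i * c'' (x, y) (axis i 1, 0) (0, axis j 1)))"
    by (subst u, subst v) (simp add: blinfun.sum_right blinfun.sum_left blinfun.scaleR_right blinfun.scaleR_left sum_distrib_left del: scaleR_Pair)
  also have "\<dots> = (\<Sum>i\<in>UNIV. u $ i * (\<Sum>j\<in>UNIV. v $ j * c'' (x, y) (axis i 1, 0) (0, axis j 1)))"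
    by (subst sum.swap) (simp add: sum_distrib_left mult.left_commute)
  also have "\<dots> = u \<bullet> (mixed_hessian c'' x y *v v)"
    by (simp add: inner_vec_def mixed_hessian_def matrix_vector_mult_def mult.commute)
  finally show ?thesis .
qed

text \<open>Minty's change of variables: along the slices \<open>y = T x + w\<close>, with \<open>T\<close> the inverse of the mixed
  Hessian at the centre, the mixed second difference of the cost is uniformly convex.\<close>
lemma local_slices:
  fixes c :: "(real^'n) \<times> (real^'n) \<Rightarrow> real"
  assumes c: "second_derivs (\<Omega>m \<times> \<Omega>p) c c' c''" and cont: "continuous_on (\<Omega>m \<times> \<Omega>p) c''"
    and \<Omega>: "open \<Omega>m" "open \<Omega>p" "x0 \<in> \<Omega>m" "y0 \<in> \<Omega>p"
    and inv: "invertible (mixed_hessian c'' x0 y0)"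
  obtains r and T :: "real^'n \<Rightarrow> real^'n" where "0 < r" "linear T" "ball x0 r \<subseteq> \<Omega>m" "ball y0 r \<subseteq> \<Omega>p"
    "\<And>x x' y y'. x \<in> ball x0 r \<Longrightarrow> x' \<in> ball x0 r \<Longrightarrow> y \<in> ball y0 r \<Longrightarrow> y' \<in> ball y0 r \<Longrightarrow> y - y' = T (x - x') \<Longrightarrow>
      (norm (x - x'))\<^sup>2 / 2 \<le> c (x, y) - c (x', y) - (c (x, y') - c (x', y'))"
proof -
  define H where "H = mixed_hessian c'' x0 y0"
  obtain N where N: "H ** N = mat 1" using inv unfolding H_def invertible_def by blast
  define T where "T v = N *v v" for v
  have lin: "linear T" unfolding T_def by (rule matrix_vector_mul_linear)
  \<comment> \<open>At the centre the mixed form in the directions \<open>u\<close> and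
    \<open>T u\<close> is therefore \<open>u \<bullet> u\<close>.\<close>
  have HT: "H *v T v = v" for v
    by (simp add: T_def matrix_vector_mul_assoc N)
  obtain K where K: "0 < K" "\<And>v. norm (T v) \<le> K * norm v"
    using linear_bounded_pos[OF lin] by blast
  have "open (\<Omega>m \<times> \<Omega>p)" using \<Omega> by (simp add: open_Times)
  moreover have "isCont c'' (x0, y0)"
    using cont \<Omega> \<open>open (\<Omega>m \<times> \<Omega>p)\<close> by (simp add: continuous_on_eq_continuous_at)
  \<comment> \<open>With this tolerance the variation of \<open>c''\<close> changes the form in the
    directions \<open>u\<close> and \<open>T u\<close> by at most half the squared norm of
    \<open>u\<close>, so half of the value at the centre survives.\<close>
  moreover have "0 < 1 / (2 * K)" using K by simp
  ultimately obtain d where d: "0 < d" "\<And>z. dist z (x0, y0) < d \<Longrightarrow> dist (c'' z) (c'' (x0, y0)) < 1 / (2 * K)"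
    unfolding continuous_at_eps_delta by metis
  obtain r1 where r1: "0 < r1" "ball x0 r1 \<subseteq> \<Omega>m" using \<Omega> open_contains_ball by blast
  obtain r2 where r2: "0 < r2" "ball y0 r2 \<subseteq> \<Omega>p" using \<Omega> open_contains_ball by blast
  define r where "r = min (d / 2) (min r1 r2)"
  have r: "0 < r" "ball x0 r \<subseteq> \<Omega>m" "ball y0 r \<subseteq> \<Omega>p" using r1 r2 d by (auto simp: r_def)
  have "(norm (x - x'))\<^sup>2 / 2 \<le> c (x, y) - c (x', y) - (c (x, y') - c (x', y'))"
    if pts: "x \<in> ball x0 r" "x' \<in> ball x0 r" "y \<in> ball y0 r" "y' \<in> ball y0 r" "y - y' = T (x - x')" for x x' y y'
  proof -
    obtain \<xi> \<zeta> where \<xi>: "\<xi> \<in> ball x0 r" "\<zeta> \<in> ball y0 r"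
      "c (x, y) - c (x', y) - (c (x, y') - c (x', y')) = c'' (\<xi>, \<zeta>) (x - x', 0) (0, y - y')"
      by (rule mixed_second_difference[OF c, of "ball x0 r" "ball y0 r" x x' y y']) (use pts r in auto)
    let ?u = "x - x'" and ?D = "c'' (\<xi>, \<zeta>) - c'' (x0, y0)"
    have "dist (\<xi>, \<zeta>) (x0, y0) \<le> dist \<xi> x0 + dist \<zeta> y0"
      unfolding dist_Pair_Pair using sqrt_sum_squares_le_sum by simp
    also have "\<dots> < d" using \<xi> by (simp add: r_def dist_commute)
    finally have "norm ?D < 1 / (2 * K)" using d by (simp add: dist_norm)
    have "\<bar>?D (?u, 0) (0, T ?u)\<bar> \<le> norm (?D (?u, 0)) * norm (0 :: real^'n, T ?u)"
      using norm_blinfun[of "?D (?u, 0)" "(0, T ?u)"] by simp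
    also have "\<dots> \<le> (norm ?D * norm (?u, 0 :: real^'n)) * norm (0 :: real^'n, T ?u)"
      by (intro mult_right_mono norm_blinfun) simp
    also have "\<dots> \<le> (1 / (2 * K) * norm ?u) * (K * norm ?u)"
      using K \<open>norm ?D < _\<close> by (intro mult_mono) (auto simp: norm_Pair)
    also have "\<dots> = (norm ?u)\<^sup>2 / 2" using K by (simp add: power2_eq_square)
    finally have "- ((norm ?u)\<^sup>2 / 2) \<le> ?D (?u, 0) (0, T ?u)" by linarith
    moreover have "?D (?u, 0) (0, T ?u) = c'' (\<xi>, \<zeta>) (?u, 0) (0, T ?u) - (norm ?u)\<^sup>2"
      by (simp add: blinfun.diff_left mixed_hessian_apply H_def[symmetric] HT power2_norm_eq_inner)
    ultimately show ?thesis using \<xi>(3) pts(5) by simp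
  qed
  then show thesis using that[OF r(1) lin r(2,3)] by blast
qed

text \<open>The constant precedes \<epsilon> and the potentials: the same Gaussian bound holds on
  every slice, and only slices with \<open>w\<close> in the fixed ball \<open>W\<close> meet
  \<open>A \<times> B\<close>.\<close>

lemma laplace_local:
  fixes c :: "'a::euclidean_space \<times> 'a \<Rightarrow> real" and T :: "'a \<Rightarrow> 'a"
  assumes "linear T" "0 < r" and AB: "A \<subseteq> ball x0 r" "B \<subseteq> ball y0 r"
    and c: "\<And>x x' y y'. x \<in> ball x0 r \<Longrightarrow> x' \<in> ball x0 r \<Longrightarrow> y \<in> ball y0 r \<Longrightarrow> y' \<in> ball y0 r \<Longrightarrow> y - y' = T (x - x') \<Longrightarrow>
      (norm (x - x'))\<^sup>2 / 2 \<le> c (x, y) - c (x', y) - (c (x, y') - c (x', y'))"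
  obtains C where "0 < C"
    "\<And>\<epsilon> \<phi> \<psi>. 0 < \<epsilon> \<Longrightarrow> (\<And>x y. x \<in> A \<Longrightarrow> y \<in> B \<Longrightarrow> \<phi> x + \<psi> y \<le> c (x, y)) \<Longrightarrow>
      (\<lambda>z. ennreal (indicator (A \<times> B) z * exp (- (c z - \<phi> (fst z) - \<psi> (snd z)) / \<epsilon>))) \<in> borel_measurable borel \<Longrightarrow>
      (\<integral>\<^sup>+x. \<integral>\<^sup>+y. ennreal (indicator (A \<times> B) (x, y) * exp (- (c (x, y) - \<phi> x - \<psi> y) / \<epsilon>)) \<partial>lborel \<partial>lborel)
        \<le> ennreal (C * sqrt \<epsilon> ^ DIM('a))"
proof -
  obtain K where K: "0 < K" "\<And>v. norm (T v) \<le> K * norm v"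
    using linear_bounded_pos[OF \<open>linear T\<close>] by blast
  \<comment> \<open>If the slice of \<open>w\<close> passes through \<open>A \<times> B\<close> over
    \<open>p\<close>, then \<open>T p + w\<close> is within \<open>r\<close> of \<open>y0\<close>
    and \<open>T p\<close> within \<open>K * r\<close> of \<open>T x0\<close>.\<close>
  define W where "W = cball (y0 - T x0) (r + K * r)"
  define V where "V = measure lborel W"
  have V: "emeasure lborel W = ennreal V"
  proof -
    have "emeasure lborel W < \<infinity>" unfolding W_def by (rule emeasure_bounded_finite) simp
    then show ?thesis unfolding V_def by (intro emeasure_eq_ennreal_measure) simp
  qed
  define C where "C = (V + 1) * (2 * sqrt (4 * pi) ^ DIM('a))"
  have T[measurable]: "T \<in> borel_measurable borel"
    using \<open>linear T\<close> by (intro borel_measurable_continuous_onI linear_continuous_on linear_conv_bounded_linear[THEN iffD1])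
  have V0: "0 \<le> V" by (simp add: V_def)
  show thesis
  proof (rule that[of C])
    show "0 < C" using V0 by (simp add: C_def)
    fix \<epsilon> :: real and \<phi> \<psi> :: "'a \<Rightarrow> real"
    assume \<epsilon>: "0 < \<epsilon>" and le: "\<And>x y. x \<in> A \<Longrightarrow> y \<in> B \<Longrightarrow> \<phi> x + \<psi> y \<le> c (x, y)"
    let ?F = "\<lambda>z. ennreal (indicator (A \<times> B) z * exp (- (c z - \<phi> (fst z) - \<psi> (snd z)) / \<epsilon>))"
    assume meas: "?F \<in> borel_measurable borel"
    let ?G = "2 * sqrt (pi * (4 * \<epsilon>)) ^ DIM('a)"
    have slice: "(\<integral>\<^sup>+x. ?F (x, T x + w) \<partial>lborel) \<le> ennreal ?G * indicator W w" for w
    proof -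
      define S where "S = {x \<in> A. T x + w \<in> B}"
      define e where "e x = c (x, T x + w) - \<phi> x - \<psi> (T x + w)" for x
      show ?thesis
      proof (cases "S = {}")
        case True
        then have "?F (x, T x + w) = 0" for x by (auto simp: S_def indicator_def)
        then show ?thesis by simp
      next
        case False
        then obtain p where p: "p \<in> S" by auto
        have "w \<in> W"
        proof -
          have "norm (T p + w - y0) < r" "norm (p - x0) < r"
            using p AB by (auto simp: S_def dist_norm norm_minus_commute)
          moreover have "norm (T (p - x0)) \<le> K * norm (p - x0)" by (rule K)
          moreover have "K * norm (p - x0) \<le> K * r" using K \<open>norm (p - x0) < r\<close> by simp
          ultimately have "norm ((T p + w - y0) - T (p - x0)) \<le> r + K * r"
            using norm_triangle_ineq4[of "T p + w - y0" "T (p - x0)"] by simp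
          also have "(T p + w - y0) - T (p - x0) = w - (y0 - T x0)"
            using \<open>linear T\<close> by (simp add: linear_diff)
          finally have "norm (w - (y0 - T x0)) \<le> r + K * r" .
          then show ?thesis by (simp add: W_def dist_norm norm_minus_commute)
        qed
        have e0: "0 \<le> e x" if "x \<in> S" for x
          using le[of x "T x + w"] that by (simp add: S_def e_def)
        have bdd: "bdd_below (e ` S)" using e0 by (auto intro!: bdd_belowI[of _ 0])
        \<comment> \<open>The potentials are only measurable, so \<open>e\<close> need not attain
          its infimum on \<open>S\<close>. After division by \<epsilon>, the tolerance \<epsilon>
          costs merely the factor \<open>exp (1 / 2)\<close>.\<close>
        obtain x1 where x1: "x1 \<in> S" "e x1 < Inf (e ` S) + \<epsilon>"
          using cInf_lessD[of "e ` S" "Inf (e ` S) + \<epsilon>"] False \<epsilon> by auto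
        have near: "e x1 - \<epsilon> \<le> e x" if "x \<in> S" for x
          using cINF_lower[OF bdd that] x1(2) by linarith
        \<comment> \<open>Exchange the second coordinates of the points over \<open>x\<close> and
          \<open>x1\<close>: the potentials cancel, and \<open>e x + e x1\<close> is the mixed
          second difference of \<open>c\<close> plus the gap at the two exchanged points, which also
          lie in \<open>A \<times> B\<close>. Near-minimality of \<open>x1\<close> then removes
          \<open>e x1\<close>.\<close>
        have quad: "(norm (x - x1))\<^sup>2 / (4 * \<epsilon>) - 1 / 2 \<le> e x / \<epsilon>" if x: "x \<in> S" for x
        proof -
          let ?y = "T x + w" and ?y1 = "T x1 + w"
          have "(norm (x - x1))\<^sup>2 / 2 \<le> c (x, ?y) - c (x1, ?y) - (c (x, ?y1) - c (x1, ?y1))"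
            using x x1 AB \<open>linear T\<close> by (intro c) (auto simp: S_def linear_diff)
          moreover have "\<phi> x + \<psi> ?y1 \<le> c (x, ?y1)" "\<phi> x1 + \<psi> ?y \<le> c (x1, ?y)"
            using x x1 by (auto simp: S_def intro!: le)
          ultimately have "(norm (x - x1))\<^sup>2 / 2 \<le> e x + e x1" unfolding e_def by linarith
          then have "(norm (x - x1))\<^sup>2 / 4 - \<epsilon> / 2 \<le> e x" using near[OF x] by linarith
          then have "((norm (x - x1))\<^sup>2 / 4 - \<epsilon> / 2) / \<epsilon> \<le> e x / \<epsilon>" using \<epsilon> by (intro divide_right_mono) auto
          then show ?thesis using \<epsilon> by (simp add: diff_divide_distrib)
        qed
        have "(\<integral>\<^sup>+x. ?F (x, T x + w) \<partial>lborel) \<le> (\<integral>\<^sup>+x. ennreal 2 * ennreal (exp (- (norm (x - x1))\<^sup>2 / (4 * \<epsilon>))) \<partial>lborel)"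
        proof (intro nn_integral_mono)
          fix x
          have exp_half: "exp (1 / 2) \<le> (2 :: real)" using exp_half_le2 by simp
          show "?F (x, T x + w) \<le> ennreal 2 * ennreal (exp (- (norm (x - x1))\<^sup>2 / (4 * \<epsilon>)))"
          proof (cases "x \<in> S")
            case True
            have "exp (- e x / \<epsilon>) \<le> exp (1 / 2 - (norm (x - x1))\<^sup>2 / (4 * \<epsilon>))" using quad[OF True] by simp
            also have "\<dots> = exp (1 / 2) * exp (- (norm (x - x1))\<^sup>2 / (4 * \<epsilon>))" by (simp flip: exp_add)
            also have "\<dots> \<le> 2 * exp (- (norm (x - x1))\<^sup>2 / (4 * \<epsilon>))" using exp_half by (intro mult_right_mono) auto
            finally have "ennreal (exp (- e x / \<epsilon>)) \<le> ennreal (2 * exp (- (norm (x - x1))\<^sup>2 / (4 * \<epsilon>)))"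
              by (rule ennreal_leI)
            also have "\<dots> = ennreal 2 * ennreal (exp (- (norm (x - x1))\<^sup>2 / (4 * \<epsilon>)))"
              by (rule ennreal_mult) simp_all
            finally show ?thesis using True by (simp add: S_def e_def)
          next
            case False
            then show ?thesis by (auto simp: S_def indicator_def)
          qed
        qed
        also have "\<dots> = ennreal ?G"
        proof -
          have "(\<integral>\<^sup>+x. ennreal 2 * ennreal (exp (- (norm (x - x1))\<^sup>2 / (4 * \<epsilon>))) \<partial>lborel)
            = ennreal 2 * (\<integral>\<^sup>+x. ennreal (exp (- (norm (x - x1))\<^sup>2 / (4 * \<epsilon>))) \<partial>lborel)"
            by (rule nn_integral_cmult) measurable
          also have "\<dots> = ennreal 2 * ennreal (sqrt (pi * (4 * \<epsilon>)) ^ DIM('a))"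
            using \<epsilon> by (subst nn_integral_gaussian) simp_all
          also have "\<dots> = ennreal ?G"
            using \<epsilon> by (intro ennreal_mult[symmetric]) simp_all
          finally show ?thesis .
        qed
        finally show ?thesis using \<open>w \<in> W\<close> by simp
      qed
    qed
    have "(\<integral>\<^sup>+x. \<integral>\<^sup>+y. ?F (x, y) \<partial>lborel \<partial>lborel) = (\<integral>\<^sup>+w. \<integral>\<^sup>+x. ?F (x, T x + w) \<partial>lborel \<partial>lborel)"
      by (rule nn_integral_slices[OF meas T])
    also have "\<dots> \<le> (\<integral>\<^sup>+w. ennreal ?G * indicator W w \<partial>lborel)"
      by (intro nn_integral_mono slice)
    also have "\<dots> = ennreal ?G * ennreal V"
      by (subst nn_integral_cmult_indicator) (auto simp: V W_def V[unfolded W_def])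
    also have "\<dots> \<le> ennreal (C * sqrt \<epsilon> ^ DIM('a))"
    proof -
      have "?G * V = V * (2 * sqrt (4 * pi) ^ DIM('a)) * sqrt \<epsilon> ^ DIM('a)"
        by (simp add: real_sqrt_mult power_mult_distrib mult.assoc mult.left_commute)
      also have "\<dots> \<le> C * sqrt \<epsilon> ^ DIM('a)" unfolding C_def using V0 \<epsilon> by (intro mult_right_mono) auto
      finally show ?thesis using ennreal_mult''[OF V0, of ?G] by (metis ennreal_leI)
    qed
    finally show "(\<integral>\<^sup>+x. \<integral>\<^sup>+y. ennreal (indicator (A \<times> B) (x, y) * exp (- (c (x, y) - \<phi> x - \<psi> y) / \<epsilon>)) \<partial>lborel \<partial>lborel)
        \<le> ennreal (C * sqrt \<epsilon> ^ DIM('a))" by simp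
  qed
qed

text \<open>Compactness reduces the claim to finitely many product balls on which
  \<open>laplace_local\<close> applies. The factor \<open>M * M\<close> pays for replacing both
  marginals by Lebesgue measure.\<close>

lemma laplace_bound:
  fixes c :: "(real^'n) \<times> (real^'n) \<Rightarrow> real" and \<mu> \<nu> :: "(real^'n) measure"
  assumes "borel_prob_pair \<mu> \<nu>"
    and c: "second_derivs (\<Omega>m \<times> \<Omega>p) c c' c''" "continuous_on (\<Omega>m \<times> \<Omega>p) c''"
    and \<Omega>: "open \<Omega>m" "open \<Omega>p" "spt \<mu> \<subseteq> \<Omega>m" "spt \<nu> \<subseteq> \<Omega>p"
    and inv: "\<And>x y. x \<in> \<Omega>m \<Longrightarrow> y \<in> \<Omega>p \<Longrightarrow> invertible (mixed_hessian c'' x y)"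
    and M: "0 < M" "\<And>f. f \<in> borel_measurable borel \<Longrightarrow> (\<integral>\<^sup>+x. f x \<partial>\<mu>) \<le> ennreal M * (\<integral>\<^sup>+x. f x \<partial>lborel)"
      "\<And>f. f \<in> borel_measurable borel \<Longrightarrow> (\<integral>\<^sup>+x. f x \<partial>\<nu>) \<le> ennreal M * (\<integral>\<^sup>+x. f x \<partial>lborel)"
  obtains C where "0 < C"
    "\<And>\<epsilon> \<phi> \<psi>. 0 < \<epsilon> \<Longrightarrow> \<phi> \<in> borel_measurable borel \<Longrightarrow> \<psi> \<in> borel_measurable borel \<Longrightarrow>
      (\<And>x y. x \<in> spt \<mu> \<Longrightarrow> y \<in> spt \<nu> \<Longrightarrow> \<phi> x + \<psi> y \<le> c (x, y)) \<Longrightarrow>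
      (\<integral>\<^sup>+z. ennreal (indicator (spt \<mu> \<times> spt \<nu>) z * exp (- (c z - \<phi> (fst z) - \<psi> (snd z)) / \<epsilon>)) \<partial>(\<mu> \<Otimes>\<^sub>M \<nu>))
        \<le> ennreal (C * sqrt \<epsilon> ^ CARD('n))"
proof -
  interpret borel_prob_pair \<mu> \<nu> by fact
  let ?X = "spt \<mu>" and ?Y = "spt \<nu>"
  have contc: "continuous_on (?X \<times> ?Y) c"
  proof (rule continuous_at_imp_continuous_on, intro ballI)
    fix z assume "z \<in> ?X \<times> ?Y"
    then have "z \<in> \<Omega>m \<times> \<Omega>p" using \<Omega> by auto
    then have "(c has_derivative c' z) (at z)" using c(1) unfolding second_derivs_def by blast
    then show "isCont c z" by (rule has_derivative_continuous)
  qed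
  \<comment> \<open>\<open>Q\<close> contains the quantifiers over \<epsilon> and the potentials, so
    that radius and constant at each point are selected once, before the finite subcover is
    taken.\<close>
  define Q where "Q z r C \<longleftrightarrow> (\<forall>\<epsilon> \<phi> \<psi>. 0 < \<epsilon> \<longrightarrow> \<phi> \<in> borel_measurable borel \<longrightarrow> \<psi> \<in> borel_measurable borel \<longrightarrow>
      (\<forall>x\<in>?X. \<forall>y\<in>?Y. \<phi> x + \<psi> y \<le> c (x, y)) \<longrightarrow>
      (\<integral>\<^sup>+x. \<integral>\<^sup>+y. ennreal (indicator ((?X \<inter> ball (fst z) r) \<times> (?Y \<inter> ball (snd z) r)) (x, y) * exp (- (c (x, y) - \<phi> x - \<psi> y) / \<epsilon>)) \<partial>lborel \<partial>lborel)
        \<le> ennreal (C * sqrt \<epsilon> ^ CARD('n)))" for z r C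
  have "\<forall>z\<in>?X \<times> ?Y. \<exists>r C. 0 < r \<and> 0 < C \<and> Q z r C"
  proof
    fix z assume "z \<in> ?X \<times> ?Y"
    then obtain x0 y0 where z: "z = (x0, y0)" "x0 \<in> ?X" "y0 \<in> ?Y" by auto
    have z\<Omega>: "x0 \<in> \<Omega>m" "y0 \<in> \<Omega>p" using z \<Omega> by auto
    obtain r and T :: "real^'n \<Rightarrow> real^'n" where r: "0 < r" "linear T"
      and rT: "\<And>x x' y y'. x \<in> ball x0 r \<Longrightarrow> x' \<in> ball x0 r \<Longrightarrow> y \<in> ball y0 r \<Longrightarrow> y' \<in> ball y0 r \<Longrightarrow> y - y' = T (x - x') \<Longrightarrow>
      (norm (x - x'))\<^sup>2 / 2 \<le> c (x, y) - c (x', y) - (c (x, y') - c (x', y'))"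
      using local_slices[OF c \<Omega>(1,2) z\<Omega> inv[OF z\<Omega>]] by metis
    let ?A = "?X \<inter> ball x0 r" and ?B = "?Y \<inter> ball y0 r"
    have sub: "?A \<subseteq> ball x0 r" "?B \<subseteq> ball y0 r" by auto
    obtain C where C: "0 < C"
      "\<And>\<epsilon> \<phi> \<psi>. 0 < \<epsilon> \<Longrightarrow> (\<And>x y. x \<in> ?A \<Longrightarrow> y \<in> ?B \<Longrightarrow> \<phi> x + \<psi> y \<le> c (x, y)) \<Longrightarrow>
      (\<lambda>z. ennreal (indicator (?A \<times> ?B) z * exp (- (c z - \<phi> (fst z) - \<psi> (snd z)) / \<epsilon>))) \<in> borel_measurable borel \<Longrightarrow>
      (\<integral>\<^sup>+x. \<integral>\<^sup>+y. ennreal (indicator (?A \<times> ?B) (x, y) * exp (- (c (x, y) - \<phi> x - \<psi> y) / \<epsilon>)) \<partial>lborel \<partial>lborel)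
        \<le> ennreal (C * sqrt \<epsilon> ^ DIM(real^'n))"
      by (rule laplace_local[OF r(2,1) sub rT]; (assumption | (rule that; (assumption | blast))))
    have meas: "(\<lambda>z. ennreal (indicator (?A \<times> ?B) z * exp (- (c z - \<phi> (fst z) - \<psi> (snd z)) / \<epsilon>))) \<in> borel_measurable borel"
      if [measurable]: "\<phi> \<in> borel_measurable borel" "\<psi> \<in> borel_measurable borel" for \<phi> \<psi> :: "real^'n \<Rightarrow> real" and \<epsilon>
    proof -
      have eq: "indicator (?A \<times> ?B) z * exp (- (c z - \<phi> (fst z) - \<psi> (snd z)) / \<epsilon>) =
        indicator (?A \<times> ?B) z * exp (- (indicator (?X \<times> ?Y) z *\<^sub>R c z - \<phi> (fst z) - \<psi> (snd z)) / \<epsilon>)" for z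
        by (auto split: split_indicator)
      have [measurable]: "?A \<times> ?B \<in> sets borel" by (intro borel_Times) auto
      note measurable_cost[OF contc, measurable]
      show ?thesis unfolding eq by measurable
    qed
    show "\<exists>r C. 0 < r \<and> 0 < C \<and> Q z r C"
      unfolding Q_def
    proof (intro exI conjI allI impI)
      fix \<epsilon> :: real and \<phi> \<psi> :: "real^'n \<Rightarrow> real"
      assume h: "0 < \<epsilon>" "\<phi> \<in> borel_measurable borel" "\<psi> \<in> borel_measurable borel" "\<forall>x\<in>?X. \<forall>y\<in>?Y. \<phi> x + \<psi> y \<le> c (x, y)"
      have a: "\<phi> x + \<psi> y \<le> c (x, y)" if "x \<in> ?A" "y \<in> ?B" for x y using h(4) that by blast
      show "(\<integral>\<^sup>+x. \<integral>\<^sup>+y. ennreal (indicator ((?X \<inter> ball (fst z) r) \<times> (?Y \<inter> ball (snd z) r)) (x, y) * exp (- (c (x, y) - \<phi> x - \<psi> y) / \<epsilon>)) \<partial>lborel \<partial>lborel)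
        \<le> ennreal (C * sqrt \<epsilon> ^ CARD('n))"
        using C(2)[OF h(1) a meas[OF h(2,3)]] by (simp only: z(1) fst_conv snd_conv DIM_cart DIM_real mult_1_right)
    qed (fact r(1), fact C(1))
  qed
  then obtain r C where rC: "\<And>z. z \<in> ?X \<times> ?Y \<Longrightarrow> 0 < r z" "\<And>z. z \<in> ?X \<times> ?Y \<Longrightarrow> 0 < C z"
    and QrC: "\<And>z. z \<in> ?X \<times> ?Y \<Longrightarrow> Q z (r z) (C z)"
    by metis
  have "compact (?X \<times> ?Y)" using compact_left compact_right by (rule compact_Times)
  moreover have "\<And>z. z \<in> ?X \<times> ?Y \<Longrightarrow> open (ball (fst z) (r z) \<times> ball (snd z) (r z))" by (simp add: open_Times)
  moreover have "?X \<times> ?Y \<subseteq> (\<Union>z\<in>?X \<times> ?Y. ball (fst z) (r z) \<times> ball (snd z) (r z))"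
    using rC(1) by force
  ultimately obtain D where D: "D \<subseteq> ?X \<times> ?Y" "finite D"
    "?X \<times> ?Y \<subseteq> (\<Union>z\<in>D. ball (fst z) (r z) \<times> ball (snd z) (r z))"
    by (rule compactE_image)
  define C' where "C' = M * M * ((\<Sum>z\<in>D. C z) + 1)"
  have sumC: "0 \<le> (\<Sum>z\<in>D. C z)" using rC(2) D(1) by (intro sum_nonneg) (auto simp: less_imp_le subset_iff)
  show thesis
  proof (rule that[of C'])
    show "0 < C'" using sumC M(1) by (simp add: C'_def)
    fix \<epsilon> :: real and \<phi> \<psi> :: "real^'n \<Rightarrow> real"
    assume \<epsilon>: "0 < \<epsilon>" and [measurable]: "\<phi> \<in> borel_measurable borel" "\<psi> \<in> borel_measurable borel"
      and le: "\<And>x y. x \<in> ?X \<Longrightarrow> y \<in> ?Y \<Longrightarrow> \<phi> x + \<psi> y \<le> c (x, y)"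
    define e where "e z = exp (- (indicator (?X \<times> ?Y) z *\<^sub>R c z - \<phi> (fst z) - \<psi> (snd z)) / \<epsilon>)" for z
    have em[measurable]: "e \<in> borel_measurable borel"
      using measurable_cost[OF contc] unfolding e_def by measurable
    define F where "F z = ennreal (indicator (?X \<times> ?Y) z * e z)" for z
    have Fm[measurable]: "F \<in> borel_measurable borel" unfolding F_def by measurable
    let ?A = "\<lambda>z. ?X \<inter> ball (fst z) (r z)" and ?B = "\<lambda>z. ?Y \<inter> ball (snd z) (r z)"
    define G where "G d z = ennreal (indicator (?A d \<times> ?B d) z * e z)" for d z
    have Gm[measurable]: "G d \<in> borel_measurable borel" for d
    proof -
      have [measurable]: "?A d \<times> ?B d \<in> sets borel" by (intro borel_Times) auto
      show ?thesis unfolding G_def by measurable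
    qed
    have FG: "F z \<le> (\<Sum>d\<in>D. G d z)" for z
    proof (cases "z \<in> ?X \<times> ?Y")
      case True
      then obtain d where d: "d \<in> D" "z \<in> ball (fst d) (r d) \<times> ball (snd d) (r d)" using D(3) by blast
      then have "F z = G d z" using True by (auto simp: F_def G_def indicator_def)
      also have "\<dots> \<le> (\<Sum>d\<in>D. G d z)" using member_le_sum[of d D "\<lambda>d. G d z"] d D(2) by simp
      finally show ?thesis .
    qed (simp add: F_def)
    have eq: "(\<integral>\<^sup>+z. ennreal (indicator (?X \<times> ?Y) z * exp (- (c z - \<phi> (fst z) - \<psi> (snd z)) / \<epsilon>)) \<partial>(\<mu> \<Otimes>\<^sub>M \<nu>))
      = (\<integral>\<^sup>+z. F z \<partial>(\<mu> \<Otimes>\<^sub>M \<nu>))"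
      by (intro nn_integral_cong) (auto simp: F_def e_def split: split_indicator)
    also have "\<dots> = (\<integral>\<^sup>+x. \<integral>\<^sup>+y. F (x, y) \<partial>\<nu> \<partial>\<mu>)"
      by (subst M2.nn_integral_fst) auto
    also have "\<dots> \<le> (\<integral>\<^sup>+x. ennreal M * (\<integral>\<^sup>+y. F (x, y) \<partial>lborel) \<partial>\<mu>)"
      by (intro nn_integral_mono M(3)) measurable
    also have "\<dots> \<le> ennreal M * (\<integral>\<^sup>+x. ennreal M * (\<integral>\<^sup>+y. F (x, y) \<partial>lborel) \<partial>lborel)"
      by (intro M(2)) measurable
    also have "\<dots> \<le> ennreal M * (\<integral>\<^sup>+x. ennreal M * (\<integral>\<^sup>+y. (\<Sum>d\<in>D. G d (x, y)) \<partial>lborel) \<partial>lborel)"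
      by (intro mult_left_mono nn_integral_mono FG) auto
    also have "\<dots> = ennreal M * (ennreal M * (\<Sum>d\<in>D. (\<integral>\<^sup>+x. \<integral>\<^sup>+y. G d (x, y) \<partial>lborel \<partial>lborel)))"
      by (simp add: nn_integral_cmult nn_integral_sum)
    also have "\<dots> \<le> ennreal M * (ennreal M * (\<Sum>d\<in>D. ennreal (C d * sqrt \<epsilon> ^ CARD('n))))"
    proof (intro mult_left_mono sum_mono)
      fix d assume "d \<in> D"
      then have "(\<integral>\<^sup>+x. \<integral>\<^sup>+y. ennreal (indicator (?A d \<times> ?B d) (x, y) * exp (- (c (x, y) - \<phi> x - \<psi> y) / \<epsilon>)) \<partial>lborel \<partial>lborel)
        \<le> ennreal (C d * sqrt \<epsilon> ^ CARD('n))"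
        using QrC[of d] D(1) le \<epsilon> unfolding Q_def by auto
      also have "(\<integral>\<^sup>+x. \<integral>\<^sup>+y. ennreal (indicator (?A d \<times> ?B d) (x, y) * exp (- (c (x, y) - \<phi> x - \<psi> y) / \<epsilon>)) \<partial>lborel \<partial>lborel)
        = (\<integral>\<^sup>+x. \<integral>\<^sup>+y. G d (x, y) \<partial>lborel \<partial>lborel)"
        by (intro nn_integral_cong) (auto simp: G_def e_def split: split_indicator)
      finally show "(\<integral>\<^sup>+x. \<integral>\<^sup>+y. G d (x, y) \<partial>lborel \<partial>lborel) \<le> ennreal (C d * sqrt \<epsilon> ^ CARD('n))" .
    qed auto
    also have "(\<Sum>d\<in>D. ennreal (C d * sqrt \<epsilon> ^ CARD('n))) = ennreal ((\<Sum>d\<in>D. C d) * sqrt \<epsilon> ^ CARD('n))"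
      using D(1) rC(2) \<epsilon> by (subst sum_ennreal) (auto simp: sum_distrib_right less_imp_le subset_iff)
    also have "ennreal M * (ennreal M * ennreal ((\<Sum>d\<in>D. C d) * sqrt \<epsilon> ^ CARD('n))) = ennreal (M * M * (\<Sum>d\<in>D. C d) * sqrt \<epsilon> ^ CARD('n))"
      using M(1) sumC \<epsilon> by (simp add: mult.assoc flip: ennreal_mult)
    also have "\<dots> \<le> ennreal (C' * sqrt \<epsilon> ^ CARD('n))"
      using M(1) sumC \<epsilon> unfolding C'_def by (intro ennreal_leI mult_right_mono mult_left_mono) auto
    finally show "(\<integral>\<^sup>+z. ennreal (indicator (?X \<times> ?Y) z * exp (- (c z - \<phi> (fst z) - \<psi> (snd z)) / \<epsilon>)) \<partial>(\<mu> \<Otimes>\<^sub>M \<nu>))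
        \<le> ennreal (C' * sqrt \<epsilon> ^ CARD('n))" .
  qed
qed

section \<open>Second differences and the duality gap\<close>

lemma integrable_bounded_support:
  fixes f :: "'a::euclidean_space \<Rightarrow> real"
  assumes "f \<in> borel_measurable borel" "bounded A" "A \<in> sets borel" "\<And>x. \<bar>f x\<bar> \<le> L * indicator A x"
  shows "integrable lborel f"
proof (rule Bochner_Integration.integrable_bound)
  show "integrable lborel (\<lambda>x. L * indicator A x)"
    using assms(3) emeasure_bounded_finite[OF assms(2)] by (intro integrable_mult_right integrable_real_indicator) auto
  show "AE x in lborel. norm (f x) \<le> norm (L * indicator A x)"
    using assms(4) by (intro AE_I2) (metis abs_ge_self order_trans real_norm_def)
qed (use assms in simp)

lemma integral_lborel_translate:
  fixes f :: "'a::euclidean_space \<Rightarrow> real"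
  assumes [measurable]: "f \<in> borel_measurable borel"
  shows "(\<integral>x. f (a + x) \<partial>lborel) = (\<integral>x. f x \<partial>lborel)"
proof -
  have "(\<integral>x. f x \<partial>lborel) = (\<integral>x. f x \<partial>(distr lborel borel ((+) a)))"
    by (simp only: lborel_distr_plus)
  also have "\<dots> = (\<integral>x. f (a + x) \<partial>lborel)" by (subst integral_distr) auto
  finally show ?thesis ..
qed

text \<open>The second difference is moved onto the cutoff \<open>max 0 (1 - |x - b|\<^sup>2 / s\<^sup>2)\<close>, which is
  semiconvex; since \<open>f \<le> 0\<close>, a lower bound on its second difference suffices.\<close>
lemma integral_second_difference:
  fixes f :: "'a::euclidean_space \<Rightarrow> real"
  assumes f[measurable]: "f \<in> borel_measurable borel" and fL: "\<And>x. - L \<le> f x" "\<And>x. f x \<le> 0"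
    and s: "0 < s" "norm z \<le> s"
    and nonneg: "\<And>x. x \<in> ball b s \<Longrightarrow> 0 \<le> f (x + z) + f (x - z) - 2 * f x"
  shows "(\<integral>\<^sup>+x. ennreal (f (x + z) + f (x - z) - 2 * f x) * indicator (ball b (s / 2)) x \<partial>lborel)
    \<le> ennreal (4 * L * measure lborel (ball b s) / s\<^sup>2 * (norm z)\<^sup>2)"
proof -
  define \<theta> where "\<theta> x = max 0 (1 - (norm (x - b))\<^sup>2 / s\<^sup>2)" for x
  have \<theta>m[measurable]: "\<theta> \<in> borel_measurable borel" unfolding \<theta>_def by measurable
  have \<theta>01: "0 \<le> \<theta> x" "\<theta> x \<le> 1" for x by (auto simp: \<theta>_def)
  have \<theta>0: "\<theta> x = 0" if "x \<notin> ball b s" for x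
  proof -
    have "s\<^sup>2 \<le> (norm (x - b))\<^sup>2" using that s by (intro power_mono) (auto simp: dist_norm norm_minus_commute)
    then show ?thesis using s by (simp add: \<theta>_def)
  qed
  have L0: "0 \<le> L" using fL[of b] by linarith
  let ?\<Delta> = "\<lambda>x. f (x + z) + f (x - z) - 2 * f x"
  let ?\<Delta>\<theta> = "\<lambda>x. \<theta> (x - z) + \<theta> (x + z) - 2 * \<theta> x"
  have supp: "\<theta> (x + w) = 0" if "x \<notin> cball b (2 * s)" "norm w \<le> s" for x w
  proof (rule \<theta>0)
    have "dist b x \<le> dist b (x + w) + norm w" using dist_triangle[of b x "x + w"] by (simp add: dist_norm)
    then show "x + w \<notin> ball b s" using that by auto
  qed
  have int: "integrable lborel (\<lambda>x. \<theta> (x + v) * f (x + w))" if "norm v \<le> s" for v w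
  proof (rule integrable_bounded_support[where A = "cball b (2 * s)" and L = L])
    fix x
    have "\<bar>f (x + w)\<bar> \<le> L" using fL[of "x + w"] by linarith
    then have "\<theta> (x + v) * \<bar>f (x + w)\<bar> \<le> 1 * L" using \<theta>01 by (intro mult_mono) auto
    then show "\<bar>\<theta> (x + v) * f (x + w)\<bar> \<le> L * indicator (cball b (2 * s)) x"
      using supp[of x v] that \<theta>01 L0 by (auto simp: abs_mult split: split_indicator)
  qed auto
  have shift: "(\<integral>x. \<theta> x * f (x + w) \<partial>lborel) = (\<integral>x. \<theta> (x - w) * f x \<partial>lborel)" for w
    using integral_lborel_translate[of "\<lambda>x. \<theta> (x - w) * f x" w] by (simp add: add.commute)
  have z: "norm (0 :: 'a) \<le> s" "norm z \<le> s" "norm (- z) \<le> s" using s by auto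
  note i = int[OF z(1), of z] int[OF z(1), of "- z"] int[OF z(1), of 0]
    int[OF z(3), of 0] int[OF z(2), of 0]
  have "(\<integral>x. \<theta> x * ?\<Delta> x \<partial>lborel) = (\<integral>x. \<theta> x * f (x + z) + \<theta> x * f (x - z) - 2 * (\<theta> x * f x) \<partial>lborel)"
    by (simp add: algebra_simps)
  also have "\<dots> = (\<integral>x. \<theta> x * f (x + z) \<partial>lborel) + (\<integral>x. \<theta> x * f (x - z) \<partial>lborel) - 2 * (\<integral>x. \<theta> x * f x \<partial>lborel)"
    using i by simp
  also have "\<dots> = (\<integral>x. \<theta> (x - z) * f x \<partial>lborel) + (\<integral>x. \<theta> (x + z) * f x \<partial>lborel) - 2 * (\<integral>x. \<theta> x * f x \<partial>lborel)"
    using shift[of z] shift[of "- z"] by simp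
  also have "\<dots> = (\<integral>x. \<theta> (x - z) * f x + \<theta> (x + z) * f x - 2 * (\<theta> x * f x) \<partial>lborel)"
    using i by simp
  also have "\<dots> \<le> (\<integral>x. 2 * L * (norm z)\<^sup>2 / s\<^sup>2 * indicator (ball b s) x \<partial>lborel)"
  proof (intro integral_mono)
    show "integrable lborel (\<lambda>x. \<theta> (x - z) * f x + \<theta> (x + z) * f x - 2 * (\<theta> x * f x))"
      using i by simp
    show "integrable lborel (\<lambda>x. 2 * L * (norm z)\<^sup>2 / s\<^sup>2 * indicator (ball b s) x)"
      using emeasure_bounded_finite[OF bounded_ball, of b s] by (intro integrable_mult_right integrable_real_indicator) auto
    fix x
    \<comment> \<open>Because \<open>- f x\<close> lies between 0 and \<open>L\<close>, an upper
      bound on \<open>- ?\<Delta>\<theta> x\<close> is enough. Inside the ball the parallelogram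
      identity bounds it by \<open>2 * ((norm z)\<^sup>2 / s\<^sup>2)\<close>; outside it is
      nonpositive, as \<theta> vanishes at \<open>x\<close> and is nonnegative everywhere.\<close>
    have eq: "\<theta> (x - z) * f x + \<theta> (x + z) * f x - 2 * (\<theta> x * f x) = (- f x) * (- ?\<Delta>\<theta> x)"
      by (simp add: algebra_simps)
    show "\<theta> (x - z) * f x + \<theta> (x + z) * f x - 2 * (\<theta> x * f x) \<le> 2 * L * (norm z)\<^sup>2 / s\<^sup>2 * indicator (ball b s) x"
    proof (cases "x \<in> ball b s")
      case True
      have "(norm (x - b))\<^sup>2 < s\<^sup>2" using True s by (intro power_strict_mono) (auto simp: dist_norm norm_minus_commute)
      then have "\<theta> x = 1 - (norm (x - b))\<^sup>2 / s\<^sup>2" using s by (simp add: \<theta>_def)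
      moreover have "1 - (norm (x - z - b))\<^sup>2 / s\<^sup>2 \<le> \<theta> (x - z)" "1 - (norm (x + z - b))\<^sup>2 / s\<^sup>2 \<le> \<theta> (x + z)"
        by (simp_all add: \<theta>_def)
      moreover have "(norm (x - z - b))\<^sup>2 + (norm (x + z - b))\<^sup>2 = 2 * (norm (x - b))\<^sup>2 + 2 * (norm z)\<^sup>2"
        by (simp add: power2_norm_eq_inner inner_diff inner_add inner_commute)
      then have "(norm (x - z - b))\<^sup>2 / s\<^sup>2 + (norm (x + z - b))\<^sup>2 / s\<^sup>2 = 2 * ((norm (x - b))\<^sup>2 / s\<^sup>2) + 2 * ((norm z)\<^sup>2 / s\<^sup>2)"
        by (metis add_divide_distrib times_divide_eq_right)
      ultimately have d: "- ?\<Delta>\<theta> x \<le> 2 * ((norm z)\<^sup>2 / s\<^sup>2)" by linarith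
      have "(- f x) * (- ?\<Delta>\<theta> x) \<le> (- f x) * (2 * ((norm z)\<^sup>2 / s\<^sup>2))"
        using d fL(2)[of x] by (intro mult_left_mono) auto
      also have "\<dots> \<le> L * (2 * ((norm z)\<^sup>2 / s\<^sup>2))"
        using fL(1)[of x] by (intro mult_right_mono) auto
      finally show ?thesis using True unfolding eq by (simp add: mult_ac)
    next
      case False
      then have "- ?\<Delta>\<theta> x \<le> 0" using \<theta>0[OF False] \<theta>01(1)[of "x - z"] \<theta>01(1)[of "x + z"] by simp
      then have "(- f x) * (- ?\<Delta>\<theta> x) \<le> 0" using fL(2)[of x] by (intro mult_nonneg_nonpos) auto
      then show ?thesis using False unfolding eq by simp
    qed
  qed
  also have "\<dots> = 2 * L * (norm z)\<^sup>2 / s\<^sup>2 * measure lborel (ball b s)" by simp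
  finally have main: "(\<integral>x. \<theta> x * ?\<Delta> x \<partial>lborel) \<le> 2 * L * (norm z)\<^sup>2 / s\<^sup>2 * measure lborel (ball b s)" .
  have \<Delta>int: "integrable lborel (\<lambda>x. \<theta> x * ?\<Delta> x)"
    using i by (simp add: ring_distribs mult.left_commute[of _ 2])
  have \<Delta>0: "0 \<le> \<theta> x * ?\<Delta> x" for x
    using nonneg[of x] \<theta>01[of x] \<theta>0[of x] by (cases "x \<in> ball b s") auto
  have "(\<integral>\<^sup>+x. ennreal (?\<Delta> x) * indicator (ball b (s / 2)) x \<partial>lborel) \<le> (\<integral>\<^sup>+x. ennreal (2 * (\<theta> x * ?\<Delta> x)) \<partial>lborel)"
  proof (intro nn_integral_mono)
    fix x
    show "ennreal (?\<Delta> x) * indicator (ball b (s / 2)) x \<le> ennreal (2 * (\<theta> x * ?\<Delta> x))"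
    proof (cases "x \<in> ball b (s / 2)")
      case True
      \<comment> \<open>On the half ball \<theta> is at least \<open>3 / 4\<close>, so
        \<open>2 * \<theta> x\<close> dominates the indicator.\<close>
      then have "(norm (x - b))\<^sup>2 \<le> (s / 2)\<^sup>2" by (intro power_mono) (auto simp: dist_norm norm_minus_commute)
      then have "(norm (x - b))\<^sup>2 / s\<^sup>2 \<le> 1 / 4" using s by (simp add: power_divide divide_le_eq)
      moreover have "1 - (norm (x - b))\<^sup>2 / s\<^sup>2 \<le> \<theta> x" by (simp add: \<theta>_def)
      ultimately have "1 \<le> 2 * \<theta> x" by linarith
      moreover have "0 \<le> ?\<Delta> x" using True s by (intro nonneg) auto
      ultimately have "1 * ?\<Delta> x \<le> 2 * \<theta> x * ?\<Delta> x" by (intro mult_right_mono)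
      then show ?thesis using True by (simp add: ennreal_leI mult.assoc)
    qed simp
  qed
  also have "\<dots> = ennreal (\<integral>x. 2 * (\<theta> x * ?\<Delta> x) \<partial>lborel)"
    using \<Delta>int \<Delta>0 by (intro nn_integral_eq_integral integrable_mult_right) auto
  also have "\<dots> \<le> ennreal (4 * L * measure lborel (ball b s) / s\<^sup>2 * (norm z)\<^sup>2)"
  proof (rule ennreal_leI)
    have "(\<integral>x. 2 * (\<theta> x * ?\<Delta> x) \<partial>lborel) = 2 * (\<integral>x. \<theta> x * ?\<Delta> x \<partial>lborel)"
      by (rule integral_mult_right_zero)
    moreover have "4 * L * measure lborel (ball b s) / s\<^sup>2 * (norm z)\<^sup>2 = 2 * (2 * L * (norm z)\<^sup>2 / s\<^sup>2 * measure lborel (ball b s))"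
      by simp
    ultimately show "(\<integral>x. 2 * (\<theta> x * ?\<Delta> x) \<partial>lborel) \<le> 4 * L * measure lborel (ball b s) / s\<^sup>2 * (norm z)\<^sup>2"
      using main by linarith
  qed
  finally show ?thesis .
qed

text \<open>Along a segment the second derivative of \<open>c (x, _)\<close> is at most
  \<open>L\<close> times the squared length in absolute value, and the quadratic term adds exactly
  that amount. The sign \<sigma> covers semiconvexity and semiconcavity at once; the centre
  \<open>a\<close> is free because moving it changes the function by an affine one.\<close>

lemma convex_on_along_slice:
  fixes c :: "'a::real_normed_vector \<times> 'b::real_inner \<Rightarrow> real"
  assumes c: "second_derivs S c c' c''" and D: "convex D" "{x} \<times> D \<subseteq> S"
    and L: "\<And>y. y \<in> D \<Longrightarrow> norm (c'' (x, y)) \<le> L" and \<sigma>: "\<bar>\<sigma>\<bar> = 1"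
  shows "convex_on D (\<lambda>y. \<sigma> * c (x, y) + L / 2 * (norm (y - a))\<^sup>2)"
proof (rule convex_onI)
  fix t :: real and u v assume t: "0 < t" "t < 1" and uv: "u \<in> D" "v \<in> D"
  define w where "w = v - u"
  have inD: "u + s *\<^sub>R w \<in> D" if "s \<in> {0..1}" for s
  proof -
    have "u + s *\<^sub>R w = (1 - s) *\<^sub>R u + s *\<^sub>R v" by (simp add: w_def algebra_simps)
    then show ?thesis using convexD_alt[OF D(1) uv] that by simp
  qed
  let ?p = "\<lambda>s. (x, u + s *\<^sub>R w)"
  define k where "k s = \<sigma> * c (?p s) + L / 2 * ((u + s *\<^sub>R w - a) \<bullet> (u + s *\<^sub>R w - a))" for s
  define k' where "k' s = \<sigma> * c' (?p s) (0, w) + L * ((u + s *\<^sub>R w - a) \<bullet> w)" for s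
  define k'' where "k'' s = \<sigma> * c'' (?p s) (0, w) (0, w) + L * (w \<bullet> w)" for s
  have p: "(?p has_derivative (\<lambda>h. h *\<^sub>R (0, w))) (at s)" for s
    by (auto intro!: derivative_eq_intros)
  have d1: "((\<lambda>s. c (?p s)) has_real_derivative c' (?p s) (0, w)) (at s)" if "s \<in> {0..1}" for s
  proof -
    have "(c has_derivative c' (?p s)) (at (?p s))"
      using c D(2) inD[OF that] unfolding second_derivs_def by auto
    from has_derivative_compose[OF p this] show ?thesis
      by (simp add: has_field_derivative_def blinfun.scaleR_right mult.commute[of _ "blinfun_apply _ _"] del: scaleR_Pair)
  qed
  have d2: "((\<lambda>s. c' (?p s) (0, w)) has_real_derivative c'' (?p s) (0, w) (0, w)) (at s)" if "s \<in> {0..1}" for s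
  proof -
    have "(c' has_derivative c'' (?p s)) (at (?p s))"
      using c D(2) inD[OF that] unfolding second_derivs_def by auto
    from bounded_linear.has_derivative[OF blinfun.bounded_linear_left has_derivative_compose[OF p this], of "(0, w)"]
    show ?thesis
      by (simp add: has_field_derivative_def blinfun.scaleR_right blinfun.scaleR_left mult.commute[of _ "blinfun_apply _ _"] del: scaleR_Pair)
  qed
  have "convex_on {0..1} k"
  proof (rule f''_ge0_imp_convex[where f' = k' and f'' = k''])
    fix s :: real assume s: "s \<in> {0..1}"
    have q: "((\<lambda>s. (u + s *\<^sub>R w - a) \<bullet> (u + s *\<^sub>R w - a)) has_real_derivative 2 * ((u + s *\<^sub>R w - a) \<bullet> w)) (at s)"
      unfolding has_field_derivative_def
      by (auto intro!: derivative_eq_intros simp: inner_commute algebra_simps)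
    have q': "((\<lambda>s. (u + s *\<^sub>R w - a) \<bullet> w) has_real_derivative w \<bullet> w) (at s)"
      unfolding has_field_derivative_def
      by (auto intro!: derivative_eq_intros)
    show "(k has_real_derivative k' s) (at s)"
      unfolding k_def k'_def using DERIV_add[OF DERIV_cmult[OF d1[OF s], of \<sigma>] DERIV_cmult[OF q, of "L / 2"]] by simp
    show "(k' has_real_derivative k'' s) (at s)"
      unfolding k'_def k''_def by (intro DERIV_add DERIV_cmult d2 s q')
    have "\<bar>c'' (?p s) (0, w) (0, w)\<bar> \<le> norm (c'' (?p s) (0, w)) * norm (0 :: 'a, w)"
      using norm_blinfun[of "c'' (?p s) (0, w)" "(0, w)"] by simp
    also have "\<dots> \<le> (norm (c'' (?p s)) * norm (0 :: 'a, w)) * norm (0 :: 'a, w)"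
      by (intro mult_right_mono norm_blinfun) simp
    also have "\<dots> \<le> (L * norm w) * norm w"
      using L[OF inD[OF s]] order_trans[OF norm_ge_zero L[OF inD[OF s]]] by (intro mult_mono) (auto simp: norm_Pair)
    finally have "\<bar>\<sigma> * c'' (?p s) (0, w) (0, w)\<bar> \<le> L * (w \<bullet> w)"
      using \<sigma> by (simp add: abs_mult power2_norm_eq_inner[symmetric] power2_eq_square mult.assoc)
    then show "0 \<le> k'' s" unfolding k''_def by linarith
  qed simp
  from convex_onD[OF this, of t 0 1] have "k t \<le> (1 - t) * k 0 + t * k 1" using t by simp
  moreover have "u + t *\<^sub>R w = (1 - t) *\<^sub>R u + t *\<^sub>R v" "u + w = v" by (simp_all add: w_def algebra_simps)
  ultimately show "\<sigma> * c (x, (1 - t) *\<^sub>R u + t *\<^sub>R v) + L / 2 * (norm ((1 - t) *\<^sub>R u + t *\<^sub>R v - a))\<^sup>2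
      \<le> (1 - t) * (\<sigma> * c (x, u) + L / 2 * (norm (u - a))\<^sup>2) + t * (\<sigma> * c (x, v) + L / 2 * (norm (v - a))\<^sup>2)"
    by (simp add: k_def power2_norm_eq_inner)
qed (rule D)

lemma convex_on_midpoint:
  assumes "convex_on D f" "y + z \<in> D" "y - z \<in> D"
  shows "2 * f y \<le> f (y + z) + f (y - z)"
proof -
  have "f ((1 - 1 / 2) *\<^sub>R (y + z) + (1 / 2) *\<^sub>R (y - z)) \<le> (1 - 1 / 2) * f (y + z) + 1 / 2 * f (y - z)"
    using assms by (intro convex_onD) auto
  moreover have "(1 - 1 / 2 :: real) *\<^sub>R (y + z) + (1 / 2) *\<^sub>R (y - z) = y"
    by (simp add: scaleR_add_right scaleR_diff_right flip: scaleR_add_left)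
  ultimately show ?thesis by simp
qed

text \<open>The gap is compared at \<open>y'\<close>, \<open>y\<close> and the reflected point \<open>2 y - y'\<close>. The second difference of \<psi> at
  \<open>y\<close> is then controlled by those at an independent base point \<open>x0\<close> in the finitely many directions
  \<open>\<sigma> \<in> V\<close>, because semiconvex functions on a cube are bounded by their values at the vertices.\<close>
lemma gap_doubling:
  fixes c :: "'a::real_normed_vector \<times> 'b::euclidean_space \<Rightarrow> real" and V :: "'b set" and L R l :: real
  assumes c: "second_derivs S c c' c''" and D: "convex D" "X \<times> D \<subseteq> S"
    and L: "\<And>x y. x \<in> X \<Longrightarrow> y \<in> D \<Longrightarrow> norm (c'' (x, y)) \<le> L"
    and \<psi>: "\<And>x y. x \<in> X \<Longrightarrow> y \<in> D \<Longrightarrow> \<phi> x + \<psi> y \<le> c (x, y)"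
    and \<psi>_inf: "\<And>y \<tau>. y \<in> D \<Longrightarrow> 0 < \<tau> \<Longrightarrow> \<exists>x\<in>X. c (x, y) < \<phi> x + \<psi> y + \<tau>"
    and V: "finite V" "cbox (- One) One = convex hull V" and R: "\<And>v :: 'b. v \<in> cbox (- One) One \<Longrightarrow> norm v \<le> R"
    and xD: "\<And>v. v \<in> cbox (- One) One \<Longrightarrow> x0 + l *\<^sub>R v \<in> D"
    and pts: "x \<in> X" "y \<in> D" "y' = x0 + l *\<^sub>R u1" "2 *\<^sub>R y - y' = x0 + l *\<^sub>R u2"
      "u1 \<in> cbox (- One) One" "u2 \<in> cbox (- One) One"
  shows "c (x, y') - \<phi> x - \<psi> y' \<le> 2 * (c (x, y) - \<phi> x - \<psi> y) + (2 + 2 * card V) * (L * (l * R)\<^sup>2)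
    + 2 * (\<Sum>\<sigma>\<in>V. L * (norm (l *\<^sub>R \<sigma>))\<^sup>2 - (\<psi> (x0 + l *\<^sub>R \<sigma>) + \<psi> (x0 - l *\<^sub>R \<sigma>) - 2 * \<psi> x0))"
proof -
  let ?Q = "cbox (- One) One :: 'b set"
  have neg: "- v \<in> ?Q" if "v \<in> ?Q" for v using that by (auto simp: mem_box)
  have Q0: "0 \<in> ?Q" by (simp add: mem_box)
  have VQ: "v \<in> ?Q" if "v \<in> V" for v using that V(2) by (simp add: hull_inc)
  have R0: "0 \<le> R" using R[OF Q0] by simp
  have x0: "x0 \<in> D" using xD[OF Q0] by simp
  have L0: "0 \<le> L" using L[OF pts(1,2)] norm_ge_zero order_trans by blast
  have cvx: "convex_on D (\<lambda>y. \<sigma> * c (x, y) + L / 2 * (norm (y - a))\<^sup>2)" if "\<bar>\<sigma>\<bar> = 1" "x \<in> X" for \<sigma> x a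
    using D(2) that by (intro convex_on_along_slice[OF c D(1)] L) auto
  \<comment> \<open>Semiconcavity passes from the functions \<open>c (z, y) - \<phi> z\<close> to
    \<psi>: they all lie above \<psi>, and one of them nearly touches it at the intermediate
    point.\<close>
  have cvx_\<psi>: "convex_on D (\<lambda>y. L / 2 * (norm (y - a))\<^sup>2 - \<psi> y)" for a
  proof (rule convex_onI)
    fix t :: real and u v assume t: "0 < t" "t < 1" and uv: "u \<in> D" "v \<in> D"
    let ?w = "(1 - t) *\<^sub>R u + t *\<^sub>R v"
    have w: "?w \<in> D" using convexD_alt[OF D(1) uv] t by simp
    show "L / 2 * (norm (?w - a))\<^sup>2 - \<psi> ?w \<le> (1 - t) * (L / 2 * (norm (u - a))\<^sup>2 - \<psi> u) + t * (L / 2 * (norm (v - a))\<^sup>2 - \<psi> v)"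
    proof (rule field_le_epsilon)
      fix \<tau> :: real assume "0 < \<tau>"
      then obtain z where z: "z \<in> X" "c (z, ?w) < \<phi> z + \<psi> ?w + \<tau>" using \<psi>_inf[OF w] by blast
      have "- c (z, ?w) + L / 2 * (norm (?w - a))\<^sup>2 \<le> (1 - t) * (- c (z, u) + L / 2 * (norm (u - a))\<^sup>2) + t * (- c (z, v) + L / 2 * (norm (v - a))\<^sup>2)"
        using convex_onD[OF cvx[of "-1" z a], of t u v] z(1) t uv by simp
      also have "\<dots> \<le> (1 - t) * (- (\<phi> z + \<psi> u) + L / 2 * (norm (u - a))\<^sup>2) + t * (- (\<phi> z + \<psi> v) + L / 2 * (norm (v - a))\<^sup>2)"
        using \<psi>[OF z(1) uv(1)] \<psi>[OF z(1) uv(2)] t L0 by (intro add_mono mult_left_mono) auto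
      also have "\<dots> = (1 - t) * (L / 2 * (norm (u - a))\<^sup>2 - \<psi> u) + t * (L / 2 * (norm (v - a))\<^sup>2 - \<psi> v) - \<phi> z"
        by (simp add: algebra_simps)
      finally show "L / 2 * (norm (?w - a))\<^sup>2 - \<psi> ?w \<le> (1 - t) * (L / 2 * (norm (u - a))\<^sup>2 - \<psi> u) + t * (L / 2 * (norm (v - a))\<^sup>2 - \<psi> v) + \<tau>"
        using z(2) by linarith
    qed
  qed (rule D)
  have convex_combination_add: "r + r' \<le> (1 - t) * (A + A') + t * (B + B')"
    if "r \<le> (1 - t) * A + t * B" "r' \<le> (1 - t) * A' + t * B'" for r r' t A A' B B' :: real
    using add_mono[OF that] by (simp add: algebra_simps)
  \<comment> \<open>The second difference at \<open>x0\<close> in direction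
    \<open>l *\<^sub>R \<sigma>\<close> of the convex function
    \<open>L / 2 * (norm y)\<^sup>2 - \<psi> y\<close>.\<close>
  define P where "P \<sigma> = L * (norm (l *\<^sub>R \<sigma>))\<^sup>2 - (\<psi> (x0 + l *\<^sub>R \<sigma>) + \<psi> (x0 - l *\<^sub>R \<sigma>) - 2 * \<psi> x0)" for \<sigma>
  have c_up: "c (x, y + z) + c (x, y - z) - 2 * c (x, y) \<le> L * (norm z)\<^sup>2"
    if "x \<in> X" "y + z \<in> D" "y - z \<in> D" for x y z
    using convex_on_midpoint[OF cvx[of "-1" x y] that(2,3)] that(1) by (simp add: algebra_simps)
  have c_low: "- (L * (norm z)\<^sup>2) \<le> c (x, y + z) + c (x, y - z) - 2 * c (x, y)"
    if "x \<in> X" "y + z \<in> D" "y - z \<in> D" for x y z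
    using convex_on_midpoint[OF cvx[of 1 x y] that(2,3)] that(1) by (simp add: algebra_simps)
  have lR: "(norm (l *\<^sub>R v))\<^sup>2 \<le> (l * R)\<^sup>2" if "v \<in> ?Q" for v
  proof -
    have "\<bar>l\<bar> * norm v \<le> \<bar>l\<bar> * R" using R[OF that] by (intro mult_left_mono) auto
    then have "(\<bar>l\<bar> * norm v)\<^sup>2 \<le> (\<bar>l\<bar> * R)\<^sup>2" by (intro power_mono) auto
    then show ?thesis by (simp add: power_mult_distrib)
  qed
  define z where "z = y' - y"
  have z: "y + z = y'" "y - z = 2 *\<^sub>R y - y'" by (simp_all add: z_def scaleR_2)
  have zD: "y + z \<in> D" "y - z \<in> D" using xD[OF pts(5)] xD[OF pts(6)] pts(3,4) z by simp_all
  have zR: "(norm z)\<^sup>2 \<le> (l * R)\<^sup>2"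
  proof -
    have "2 *\<^sub>R z = y' - (2 *\<^sub>R y - y')" by (simp add: z_def scaleR_2 algebra_simps)
    also have "\<dots> = l *\<^sub>R u1 - l *\<^sub>R u2" unfolding pts(4) by (simp add: pts(3))
    finally have "2 * norm z \<le> norm (l *\<^sub>R u1) + norm (l *\<^sub>R u2)"
      using norm_triangle_ineq4[of "l *\<^sub>R u1" "l *\<^sub>R u2"] by (metis abs_numeral norm_scaleR)
    also have "\<dots> \<le> \<bar>l\<bar> * R + \<bar>l\<bar> * R" using R pts by (intro add_mono) (auto intro: mult_left_mono)
    finally have "norm z \<le> \<bar>l\<bar> * R" by (simp add: mult.commute)
    then have "(norm z)\<^sup>2 \<le> (\<bar>l\<bar> * R)\<^sup>2" by (intro power_mono) auto
    then show ?thesis by (simp add: power_mult_distrib)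
  qed
  have "c (x, y') - \<phi> x - \<psi> y' \<le> 2 * (c (x, y) - \<phi> x - \<psi> y) + (2 + 2 * card V) * (L * (l * R)\<^sup>2) + 2 * (\<Sum>\<sigma>\<in>V. P \<sigma>)"
  proof (rule field_le_epsilon)
    fix e :: real assume "0 < e"
    \<comment> \<open>Two values of \<open>g\<close> will be bounded, each by a sum over
      \<open>V\<close> with \<open>2 * \<tau>\<close> per vertex, which amounts to
      \<open>4 * card V * \<tau>\<close>.\<close>
    define \<tau> where "\<tau> = e / (4 * card V + 1)"
    have \<tau>: "0 < \<tau>" "4 * card V * \<tau> \<le> e" using \<open>0 < e\<close> by (auto simp: \<tau>_def field_simps)
    \<comment> \<open>The function \<open>g\<close> built from \<open>p\<close> is nonnegative,
      nearly zero at \<open>x0\<close> and semiconvex. It stands in for \<open>- \<psi>\<close>,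
      with the advantage that its second differences at \<open>x0\<close> control its size.\<close>
    obtain p where p: "p \<in> X" "c (p, x0) < \<phi> p + \<psi> x0 + \<tau>" using \<psi>_inf[OF x0 \<tau>(1)] by blast
    define g where "g w = c (p, w) - \<phi> p - \<psi> w" for w
    have g0: "0 \<le> g w" if "w \<in> D" for w using \<psi>[OF p(1) that] by (simp add: g_def)
    \<comment> \<open>Nonnegativity of \<open>g\<close> at the opposite point
      \<open>x0 - l *\<^sub>R \<sigma>\<close> lets the second difference of \<open>g\<close> at
      \<open>x0\<close> bound the single value at \<open>x0 + l *\<^sub>R \<sigma>\<close>.\<close>
    have gV: "g (x0 + l *\<^sub>R \<sigma>) \<le> 2 * \<tau> + P \<sigma>" if "\<sigma> \<in> V" for \<sigma>
    proof -
      have d: "x0 + l *\<^sub>R \<sigma> \<in> D" "x0 - l *\<^sub>R \<sigma> \<in> D"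
        using xD[OF VQ[OF that]] xD[OF neg[OF VQ[OF that]]] by simp_all
      then show ?thesis
        using g0[OF d(2)] c_up[OF p(1) d] p(2) unfolding g_def P_def by linarith
    qed
    \<comment> \<open>Up to a constant, \<open>k\<close> is \<open>g\<close> plus a quadratic and
      convex on the cube, hence bounded by its values on \<open>V\<close>. The terms are
      nonnegative, so their sum dominates each of them.\<close>
    have gw: "g (x0 + l *\<^sub>R u) \<le> (\<Sum>\<sigma>\<in>V. 2 * \<tau> + P \<sigma> + L * (l * R)\<^sup>2)" if "u \<in> ?Q" for u
    proof -
      define k where "k u = (c (p, x0 + l *\<^sub>R u) + L / 2 * (norm (x0 + l *\<^sub>R u - x0))\<^sup>2)
        + (L / 2 * (norm (x0 + l *\<^sub>R u - x0))\<^sup>2 - \<psi> (x0 + l *\<^sub>R u))" for u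
      have k_eq: "k u - \<phi> p = g (x0 + l *\<^sub>R u) + L * (norm (l *\<^sub>R u))\<^sup>2" for u
        by (simp add: k_def g_def)
      have kcvx: "convex_on ?Q k"
      proof (rule convex_onI)
        fix t :: real and u v assume t: "0 < t" "t < 1" and uv: "u \<in> ?Q" "v \<in> ?Q"
        have w: "x0 + l *\<^sub>R ((1 - t) *\<^sub>R u + t *\<^sub>R v) = (1 - t) *\<^sub>R (x0 + l *\<^sub>R u) + t *\<^sub>R (x0 + l *\<^sub>R v)"
          by (simp add: algebra_simps)
        have "c (p, (1 - t) *\<^sub>R (x0 + l *\<^sub>R u) + t *\<^sub>R (x0 + l *\<^sub>R v)) + L / 2 * (norm ((1 - t) *\<^sub>R (x0 + l *\<^sub>R u) + t *\<^sub>R (x0 + l *\<^sub>R v) - x0))\<^sup>2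
          \<le> (1 - t) * (c (p, x0 + l *\<^sub>R u) + L / 2 * (norm (x0 + l *\<^sub>R u - x0))\<^sup>2) + t * (c (p, x0 + l *\<^sub>R v) + L / 2 * (norm (x0 + l *\<^sub>R v - x0))\<^sup>2)"
          using convex_onD[OF cvx[of 1 p x0], of t "x0 + l *\<^sub>R u" "x0 + l *\<^sub>R v"] p(1) t xD uv by simp
        moreover have "L / 2 * (norm ((1 - t) *\<^sub>R (x0 + l *\<^sub>R u) + t *\<^sub>R (x0 + l *\<^sub>R v) - x0))\<^sup>2 - \<psi> ((1 - t) *\<^sub>R (x0 + l *\<^sub>R u) + t *\<^sub>R (x0 + l *\<^sub>R v))
          \<le> (1 - t) * (L / 2 * (norm (x0 + l *\<^sub>R u - x0))\<^sup>2 - \<psi> (x0 + l *\<^sub>R u)) + t * (L / 2 * (norm (x0 + l *\<^sub>R v - x0))\<^sup>2 - \<psi> (x0 + l *\<^sub>R v))"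
          using convex_onD[OF cvx_\<psi>[of x0], of t "x0 + l *\<^sub>R u" "x0 + l *\<^sub>R v"] t xD uv by simp
        ultimately show "k ((1 - t) *\<^sub>R u + t *\<^sub>R v) \<le> (1 - t) * k u + t * k v"
          unfolding k_def w by (rule convex_combination_add)
      qed simp
      let ?b = "\<phi> p + (\<Sum>\<sigma>\<in>V. 2 * \<tau> + P \<sigma> + L * (l * R)\<^sup>2)"
      have term0: "0 \<le> 2 * \<tau> + P \<sigma> + L * (l * R)\<^sup>2" if "\<sigma> \<in> V" for \<sigma>
        using gV[OF that] g0[OF xD[OF VQ[OF that]]] L0 by (simp add: add_nonneg_nonneg)
      have "k \<sigma> \<le> ?b" if "\<sigma> \<in> V" for \<sigma>
      proof -
        have "L * (norm (l *\<^sub>R \<sigma>))\<^sup>2 \<le> L * (l * R)\<^sup>2" using L0 lR[OF VQ[OF that]] by (intro mult_left_mono)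
        then have "k \<sigma> \<le> \<phi> p + (2 * \<tau> + P \<sigma> + L * (l * R)\<^sup>2)"
          using gV[OF that] k_eq[of \<sigma>] by linarith
        also have "2 * \<tau> + P \<sigma> + L * (l * R)\<^sup>2 \<le> (\<Sum>\<sigma>\<in>V. 2 * \<tau> + P \<sigma> + L * (l * R)\<^sup>2)"
          using member_le_sum[of \<sigma> V "\<lambda>\<sigma>. 2 * \<tau> + P \<sigma> + L * (l * R)\<^sup>2"] that V(1) term0 by blast
        finally show ?thesis by simp
      qed
      then have "k u \<le> ?b"
        using convex_on_convex_hull_bound[of V k ?b] kcvx that V(2) by simp
      moreover have "0 \<le> L * (norm (l *\<^sub>R u))\<^sup>2" using L0 by simp
      ultimately show ?thesis using k_eq[of u] by linarith
    qed
    \<comment> \<open>The second difference of the gap at \<open>x\<close> differs from that of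
      \<open>g\<close> only through \<open>c (x, _)\<close> in place of \<open>c (p, _)\<close>,
      which costs at most \<open>2 * (L * (norm z)\<^sup>2)\<close>. The nonnegative values of
      \<open>g\<close> at \<open>y\<close> and of the gap at the reflected point are
      dropped.\<close>
    have "c (x, y') - \<phi> x - \<psi> y' + (c (x, y - z) - \<phi> x - \<psi> (y - z)) - 2 * (c (x, y) - \<phi> x - \<psi> y)
      = (c (x, y + z) + c (x, y - z) - 2 * c (x, y)) - (\<psi> (y + z) + \<psi> (y - z) - 2 * \<psi> y)"
      unfolding z(1) by simp
    also have "\<dots> \<le> L * (norm z)\<^sup>2 - (\<psi> (y + z) + \<psi> (y - z) - 2 * \<psi> y)"
      using c_up[OF pts(1) zD] by simp
    also have "\<dots> \<le> 2 * (L * (norm z)\<^sup>2) + g (y + z) + g (y - z) - 2 * g y"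
      using c_low[OF p(1) zD] unfolding g_def by simp
    also have "\<dots> \<le> 2 * (L * (norm z)\<^sup>2) + g (y + z) + g (y - z)" using g0[OF pts(2)] by simp
    finally have "c (x, y') - \<phi> x - \<psi> y' \<le> 2 * (c (x, y) - \<phi> x - \<psi> y) + 2 * (L * (norm z)\<^sup>2) + g (y + z) + g (y - z)"
      using \<psi>[OF pts(1) zD(2)] by linarith
    moreover have "g (y + z) \<le> (\<Sum>\<sigma>\<in>V. 2 * \<tau> + P \<sigma> + L * (l * R)\<^sup>2)" using gw[OF pts(5)] unfolding z(1) pts(3) .
    moreover have "g (y - z) \<le> (\<Sum>\<sigma>\<in>V. 2 * \<tau> + P \<sigma> + L * (l * R)\<^sup>2)" using gw[OF pts(6)] unfolding z(2) pts(4) .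
    moreover have "L * (norm z)\<^sup>2 \<le> L * (l * R)\<^sup>2" using zR L0 by (rule mult_left_mono)
    moreover have "(\<Sum>\<sigma>\<in>V. 2 * \<tau> + P \<sigma> + L * (l * R)\<^sup>2) = card V * (2 * \<tau>) + (\<Sum>\<sigma>\<in>V. P \<sigma>) + card V * (L * (l * R)\<^sup>2)"
      by (simp add: sum.distrib)
    ultimately show "c (x, y') - \<phi> x - \<psi> y' \<le> 2 * (c (x, y) - \<phi> x - \<psi> y) + (2 + 2 * card V) * (L * (l * R)\<^sup>2) + 2 * (\<Sum>\<sigma>\<in>V. P \<sigma>) + e"
      using \<tau>(2) by (simp add: distrib_right)
  qed
  then show ?thesis unfolding P_def .
qed

section \<open>Block approximation\<close>

context borel_prob_pair
begin

text \<open>Only the target is blocked: the mass that \<open>x\<close> sends to a cell is redistributed proportionally to \<nu>.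
  This keeps the density below the reciprocal mass of the cell, hence the entropy below \<open>ln N\<close>.\<close>
lemma block_approximation:
  fixes \<rho> :: "'a \<times> 'b \<Rightarrow> ennreal" and q :: "'b \<Rightarrow> nat"
  assumes \<rho>[measurable]: "\<rho> \<in> borel_measurable borel"
    and row: "AE x in \<mu>. (\<integral>\<^sup>+y. \<rho> (x, y) \<partial>\<nu>) = 1" and col: "AE y in \<nu>. (\<integral>\<^sup>+x. \<rho> (x, y) \<partial>\<mu>) = 1"
    and q[measurable]: "q \<in> borel \<rightarrow>\<^sub>M count_space UNIV" and qN: "\<And>y. q y < N \<longleftrightarrow> y \<in> spt \<nu>"
  obtains \<gamma> where "\<gamma> \<in> couplings \<mu> \<nu>" "Ent \<gamma> (\<mu> \<Otimes>\<^sub>M \<nu>) \<le> ereal (ln N)"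
    "\<And>E E0 h. E \<in> borel_measurable borel \<Longrightarrow> E0 \<in> borel_measurable borel \<Longrightarrow> h \<in> borel_measurable borel \<Longrightarrow>
      (\<And>x y y' x0. x \<in> spt \<mu> \<Longrightarrow> y \<in> spt \<nu> \<Longrightarrow> y' \<in> spt \<nu> \<Longrightarrow> x0 \<in> spt \<nu> \<Longrightarrow> q y' = q y \<Longrightarrow> q x0 = q y \<Longrightarrow>
        E (x, y') \<le> E0 (x, y) + h x0) \<Longrightarrow>
      (\<integral>\<^sup>+z. E z \<partial>\<gamma>) \<le> (\<integral>\<^sup>+z. E0 z \<partial>density (\<mu> \<Otimes>\<^sub>M \<nu>) \<rho>) + (\<integral>\<^sup>+y. h y \<partial>\<nu>)"
proof -
  let ?P = "\<mu> \<Otimes>\<^sub>M \<nu>" and ?X = "spt \<mu>" and ?Y = "spt \<nu>"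
  define n where "n j = M2.prob (q -` {j})" for j
  define J where "J = {j. j < N \<and> n j > 0}"
  have finJ: "finite J" by (simp add: J_def)
  have qs[measurable]: "q -` {j} \<in> sets borel" for j using measurable_sets[OF q, of "{j}"] by simp
  have AEJ: "AE y in \<nu>. q y \<in> J"
    using M2.AE_positive_cell[of q N] AE_spt[OF sets_right] by (simp add: J_def n_def qN)
  have npos: "0 < n j" if "j \<in> J" for j using that by (simp add: J_def)
  have nn: "(\<integral>\<^sup>+y. indicator (q -` {j}) y \<partial>\<nu>) = ennreal (n j)" for j
    by (simp add: n_def M2.emeasure_eq_measure)
  define I where "I j y = (indicator (q -` {j}) y :: ennreal)" for j y
  have Im[measurable]: "I j \<in> borel_measurable borel" for j unfolding I_def by measurable
  have I_eq: "I j y = (if q y = j then 1 else 0)" for j y by (auto simp: I_def)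
  have sumI: "(\<Sum>j\<in>J. I j y * f j) = (if q y \<in> J then f (q y) else 0)" for y and f :: "nat \<Rightarrow> ennreal"
    using finJ by (simp add: I_eq if_distrib[of "\<lambda>x. x * _"] cong: if_cong)
  have nI: "(\<integral>\<^sup>+y. I j y \<partial>\<nu>) = ennreal (n j)" for j unfolding I_def by (rule nn)
  \<comment> \<open>The mass that \<open>x\<close> sends into cell \<open>j\<close>, relative to the
    \<nu>-mass of the cell; \<open>\<rho>'\<close> takes this value throughout the cell.\<close>
  define s where "s j x = ennreal (1 / n j) * (\<integral>\<^sup>+y. I j y * \<rho> (x, y) \<partial>\<nu>)" for j x
  have sm[measurable]: "s j \<in> borel_measurable borel" for j
    unfolding s_def by measurable
  define \<rho>' where "\<rho>' z = (\<Sum>j\<in>J. I j (snd z) * s j (fst z))" for z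
  have \<rho>'m[measurable]: "\<rho>' \<in> borel_measurable borel" unfolding \<rho>'_def by measurable
  have ns: "ennreal (n j) * s j x = (\<integral>\<^sup>+y. I j y * \<rho> (x, y) \<partial>\<nu>)" if "j \<in> J" for j x
    using npos[OF that] unfolding s_def by (simp add: mult.assoc[symmetric] ennreal_mult[symmetric])
  have row': "AE x in \<mu>. (\<integral>\<^sup>+y. \<rho>' (x, y) \<partial>\<nu>) = 1"
    using row
  proof eventually_elim
    case (elim x)
    have "(\<integral>\<^sup>+y. \<rho>' (x, y) \<partial>\<nu>) = (\<Sum>j\<in>J. (\<integral>\<^sup>+y. I j y * s j x \<partial>\<nu>))"
      unfolding \<rho>'_def fst_conv snd_conv by (rule nn_integral_sum) measurable
    also have "\<dots> = (\<Sum>j\<in>J. (\<integral>\<^sup>+y. I j y * \<rho> (x, y) \<partial>\<nu>))"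
      by (intro sum.cong refl) (simp add: nn_integral_multc nI ns)
    also have "\<dots> = (\<integral>\<^sup>+y. (\<Sum>j\<in>J. I j y * \<rho> (x, y)) \<partial>\<nu>)"
      by (rule nn_integral_sum[symmetric]) measurable
    also have "\<dots> = (\<integral>\<^sup>+y. \<rho> (x, y) \<partial>\<nu>)"
      using AEJ by (intro nn_integral_cong_AE) (auto simp: sumI)
    finally show ?case using elim by simp
  qed
  have I\<rho>: "(\<integral>\<^sup>+x. \<integral>\<^sup>+y. I j y * \<rho> (x, y) \<partial>\<nu> \<partial>\<mu>) = ennreal (n j)" for j
  proof -
    have "(\<integral>\<^sup>+x. \<integral>\<^sup>+y. I j y * \<rho> (x, y) \<partial>\<nu> \<partial>\<mu>) = (\<integral>\<^sup>+y. \<integral>\<^sup>+x. I j y * \<rho> (x, y) \<partial>\<mu> \<partial>\<nu>)"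
      by (rule Fubini'[symmetric]) (simp add: case_prod_unfold)
    also have "\<dots> = (\<integral>\<^sup>+y. I j y \<partial>\<nu>)"
      using col by (intro nn_integral_cong_AE) (auto simp: nn_integral_cmult)
    finally show ?thesis by (simp add: nI)
  qed
  have col': "AE y in \<nu>. (\<integral>\<^sup>+x. \<rho>' (x, y) \<partial>\<mu>) = 1"
    using AEJ
  proof eventually_elim
    case (elim y)
    have "(\<integral>\<^sup>+x. \<rho>' (x, y) \<partial>\<mu>) = (\<integral>\<^sup>+x. s (q y) x \<partial>\<mu>)"
      using elim by (simp add: \<rho>'_def sumI)
    also have "\<dots> = ennreal (1 / n (q y)) * ennreal (n (q y))"
      unfolding s_def I\<rho>[symmetric] by (rule nn_integral_cmult) measurable
    also have "\<dots> = 1" using npos[OF elim] by (simp add: ennreal_mult[symmetric])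
    finally show ?case .
  qed
  define r where "r z = enn2real (\<rho>' z)" for z
  have rm[measurable]: "r \<in> borel_measurable borel" unfolding r_def by measurable
  have r0: "0 \<le> r z" for z by (simp add: r_def)
  \<comment> \<open>Since \<open>x\<close> sends out total mass 1, it sends at most 1 into any cell,
    whence the bound by the reciprocal mass.\<close>
  have "AE z in ?P. \<rho>' z = ennreal (r z) \<and> q (snd z) \<in> J \<and> r z \<le> 1 / n (q (snd z))"
    using AE_fst[OF row] AE_snd[OF AEJ]
  proof eventually_elim
    case (elim z)
    let ?j = "q (snd z)"
    have "(\<integral>\<^sup>+y. I ?j y * \<rho> (fst z, y) \<partial>\<nu>) \<le> (\<integral>\<^sup>+y. \<rho> (fst z, y) \<partial>\<nu>)"
      by (intro nn_integral_mono) (auto simp: I_eq)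
    then have "s ?j (fst z) \<le> ennreal (1 / n ?j) * 1"
      unfolding s_def elim(1) by (intro mult_left_mono) auto
    then have le: "\<rho>' z \<le> ennreal (1 / n ?j)" using elim(2) by (simp add: \<rho>'_def sumI)
    then have "r z \<le> 1 / n ?j" unfolding r_def using npos[OF elim(2)] by (intro enn2real_leI) auto
    moreover have "\<rho>' z < \<top>" using le by (rule le_less_trans) simp
    ultimately show ?case using elim(2) by (simp add: r_def)
  qed
  then have AEr: "AE z in ?P. \<rho>' z = ennreal (r z)" and AErJ: "AE z in ?P. q (snd z) \<in> J \<and> r z \<le> 1 / n (q (snd z))"
    by (auto elim: eventually_mono)
  define \<gamma> where "\<gamma> = density ?P \<rho>'"
  have \<gamma>: "\<gamma> \<in> couplings \<mu> \<nu>" unfolding \<gamma>_def by (rule density_in_couplings[OF \<rho>'m row' col'])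
  have \<gamma>r: "\<gamma> = density ?P (\<lambda>z. ennreal (r z))" unfolding \<gamma>_def using AEr by (intro density_cong) auto
  interpret G: prob_space \<gamma> using \<gamma> by (simp add: couplings_def)
  define K where "K = (\<Sum>j\<in>J. 1 / n j)"
  have AErK: "AE z in ?P. r z \<le> K"
    using AErJ
  proof eventually_elim
    case (elim z)
    have "1 / n (q (snd z)) \<le> K" unfolding K_def
      using member_le_sum[of "q (snd z)" J "\<lambda>j. 1 / n j"] elim finJ npos by (simp add: less_imp_le)
    then show ?case using elim by simp
  qed
  have lnb: "\<bar>t * ln t\<bar> \<le> 1 + K * K" if "0 \<le> t" "t \<le> K" for t
  proof (cases "t = 0")
    case False
    then have t: "0 < t" using that by simp
    have "- 1 \<le> t * ln t" using mult_ln_ge[of t 1] that by simp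
    moreover have "t * ln t \<le> t * t" using ln_le_minus_one[OF t] that by (intro mult_left_mono) auto
    moreover have "t * t \<le> K * K" using that by (intro mult_mono) auto
    moreover have "0 \<le> K * K" by simp
    ultimately show ?thesis by linarith
  qed (simp add: add_nonneg_nonneg)
  have rint: "integrable ?P r"
    by (rule integrable_const_bound[of _ K]) (use AErK r0 in \<open>auto elim: eventually_mono\<close>)
  have rlnint: "integrable ?P (\<lambda>z. r z * ln (r z))"
    by (rule integrable_const_bound[of _ "1 + K * K"]) (use AErK r0 lnb in \<open>auto elim: eventually_mono\<close>)
  have r1: "(\<integral>z. r z \<partial>?P) = 1"
  proof -
    have "(\<integral>\<^sup>+z. ennreal (r z) \<partial>?P) = 1"
      using G.emeasure_space_1 unfolding \<gamma>r by (subst (asm) emeasure_density) auto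
    then show ?thesis using nn_integral_eq_integral[OF rint] r0 by simp
  qed
  \<comment> \<open>Jensen's inequality for the logarithm by hand: \<open>1 / n j = N * w j\<close>
    and \<open>ln (w j) \<le> w j - 1\<close>. The mean of \<open>w\<close> over the cells under
    \<nu> is \<open>card J / N \<le> 1\<close>, so what remains beside \<open>ln N\<close> is
    nonpositive.\<close>
  define w where "w j = (if j \<in> J then 1 / (N * n j) else 0)" for j
  have w0: "0 \<le> w j" for j using npos by (auto simp: w_def less_imp_le)
  have wm[measurable]: "(\<lambda>y. w (q y)) \<in> borel_measurable borel"
    by (rule measurable_compose[OF q]) simp
  have wb: "\<bar>w j\<bar> \<le> (\<Sum>j\<in>J. w j)" for j
  proof (cases "j \<in> J")
    case True
    then have "w j \<le> (\<Sum>j\<in>J. w j)" using member_le_sum[of j J w] finJ w0 by blast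
    then show ?thesis using w0[of j] by simp
  next
    case False
    then have "w j = 0" by (simp add: w_def)
    then show ?thesis using sum_nonneg[of J w] w0 by simp
  qed
  have N: "0 < N"
  proof (rule ccontr)
    assume "\<not> 0 < N"
    then have "AE y in \<nu>. False" using AEJ by (auto simp: J_def)
    then show False by (simp add: M2.AE_False)
  qed
  have wint: "integrable ?P (\<lambda>z. r z * w (q (snd z)))"
  proof (rule integrable_const_bound[of _ "K * (\<Sum>j\<in>J. w j)"])
    show "AE z in ?P. norm (r z * w (q (snd z))) \<le> K * (\<Sum>j\<in>J. w j)"
      using AErK
    proof eventually_elim
      case (elim z)
      then show ?case using r0[of z] wb[of "q (snd z)"] by (auto simp: abs_mult intro!: mult_mono)
    qed
  qed (simp add: measurable_compose[OF measurable_snd_borel wm])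
  have w1: "(\<integral>z. r z * w (q (snd z)) \<partial>?P) \<le> 1"
  proof -
    have "(\<integral>z. r z * w (q (snd z)) \<partial>?P) = (\<integral>z. w (q (snd z)) \<partial>\<gamma>)"
      unfolding \<gamma>r using r0 measurable_compose[OF measurable_snd_borel wm] by (subst integral_density) auto
    also have "\<dots> = (\<integral>y. w (q y) \<partial>\<nu>)"
      using integral_potentials(2)[OF \<gamma>, of "\<lambda>_. 0" 0 "\<lambda>y. w (q y)" "\<Sum>j\<in>J. w j"] wb by simp
    also have "\<dots> = (\<Sum>j\<in>J. w j * n j)"
      using M2.integral_finite_valued[OF _ finJ AEJ, of w] by (simp add: n_def)
    also have "\<dots> = (\<Sum>j\<in>J. 1 / N)"
      by (intro sum.cong refl) (auto simp: w_def J_def)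
    also have "\<dots> = card J / N" by simp
    also have "\<dots> \<le> 1"
    proof -
      have "card J \<le> card {..<N}" by (intro card_mono) (auto simp: J_def)
      then show ?thesis using N by simp
    qed
    finally show ?thesis .
  qed
  have "AE z in ?P. r z * ln (r z) \<le> r z * ln N + r z * w (q (snd z)) - r z"
    using AErJ
  proof eventually_elim
    case (elim z)
    let ?j = "q (snd z)"
    have j: "?j \<in> J" using elim by simp
    show ?case
    proof (cases "r z = 0")
      case False
      then have rp: "0 < r z" using r0[of z] by simp
      have wp: "0 < w ?j" using npos[OF j] N j by (simp add: w_def)
      have "ln (r z) \<le> ln (1 / n ?j)" using elim rp npos[OF j] by simp
      also have "1 / n ?j = N * w ?j" using N j by (simp add: w_def)
      also have "ln (N * w ?j) = ln N + ln (w ?j)" using N wp by (simp add: ln_mult)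
      also have "\<dots> \<le> ln N + (w ?j - 1)" using ln_le_minus_one[OF wp] by simp
      finally have "r z * ln (r z) \<le> r z * (ln N + (w ?j - 1))" using rp by simp
      then show ?thesis by (simp add: algebra_simps)
    qed simp
  qed
  then have "(\<integral>z. r z * ln (r z) \<partial>?P) \<le> (\<integral>z. r z * ln N + r z * w (q (snd z)) - r z \<partial>?P)"
    using rint wint rlnint by (intro integral_mono_AE) auto
  also have "\<dots> = ln N + (\<integral>z. r z * w (q (snd z)) \<partial>?P) - 1"
    using rint wint r1 by simp
  finally have "(\<integral>z. r z * ln (r z) \<partial>?P) \<le> ln N" using w1 by linarith
  then have ent: "Ent \<gamma> ?P \<le> ereal (ln N)"
    using Ent_density[OF rm r0 _ rlnint] G.prob_space_axioms unfolding \<gamma>r[symmetric] by simp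
  have "(\<integral>\<^sup>+z. E z \<partial>\<gamma>) \<le> (\<integral>\<^sup>+z. E0 z \<partial>density ?P \<rho>) + (\<integral>\<^sup>+y. h y \<partial>\<nu>)"
    if [measurable]: "E \<in> borel_measurable borel" "E0 \<in> borel_measurable borel" "h \<in> borel_measurable borel"
      and le: "\<And>x y y' x0. x \<in> ?X \<Longrightarrow> y \<in> ?Y \<Longrightarrow> y' \<in> ?Y \<Longrightarrow> x0 \<in> ?Y \<Longrightarrow> q y' = q y \<Longrightarrow> q x0 = q y \<Longrightarrow> E (x, y') \<le> E0 (x, y) + h x0"
    for E E0 h
  proof -
    \<comment> \<open>The hypothesis is averaged over \<open>x0\<close> in the cell, independently
      of \<open>x\<close> and \<open>y\<close>. As the plan gives cell \<open>j\<close> of the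
      target the mass \<open>n j\<close>, summing the averages restores the integral of
      \<open>h\<close> against \<nu>.\<close>
    define H where "H j = ennreal (1 / n j) * (\<integral>\<^sup>+y. I j y * h y \<partial>\<nu>)" for j
    have nH: "ennreal (n j) * H j = (\<integral>\<^sup>+y. I j y * h y \<partial>\<nu>)" if "j \<in> J" for j
      using npos[OF that] unfolding H_def by (simp add: mult.assoc[symmetric] ennreal_mult[symmetric])
    have q_Y: "y \<in> ?Y" if "q y \<in> J" for y using that qN[of y] by (simp add: J_def)
    have leH: "E (x, y') \<le> E0 (x, y) + H (q y)" if "x \<in> ?X" "q y \<in> J" "q y' = q y" for x y y'
    proof -
      let ?j = "q y"
      have j: "1 = ennreal (1 / n ?j) * ennreal (n ?j)"
        using npos[OF that(2)] by (simp add: ennreal_mult[symmetric])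
      have "E (x, y') = ennreal (1 / n ?j) * ennreal (n ?j) * E (x, y')" by (simp add: j[symmetric])
      also have "\<dots> = ennreal (1 / n ?j) * (\<integral>\<^sup>+x0. I ?j x0 * E (x, y') \<partial>\<nu>)"
        by (simp add: nn_integral_multc nI mult.assoc)
      also have "\<dots> \<le> ennreal (1 / n ?j) * (\<integral>\<^sup>+x0. I ?j x0 * E0 (x, y) + I ?j x0 * h x0 \<partial>\<nu>)"
      proof (intro mult_left_mono nn_integral_mono)
        fix x0
        show "I ?j x0 * E (x, y') \<le> I ?j x0 * E0 (x, y) + I ?j x0 * h x0"
        proof (cases "q x0 = ?j")
          case True
          then show ?thesis using le[OF that(1), of y y' x0] that(2,3) q_Y[of y] q_Y[of y'] q_Y[of x0] by (simp add: I_eq)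
        qed (simp add: I_eq)
      qed simp
      also have "\<dots> = ennreal (1 / n ?j) * (ennreal (n ?j) * E0 (x, y) + (\<integral>\<^sup>+x0. I ?j x0 * h x0 \<partial>\<nu>))"
        by (subst nn_integral_add) (auto simp: nn_integral_multc nI)
      also have "\<dots> = E0 (x, y) + H ?j"
        by (simp add: distrib_left H_def mult.assoc[symmetric] j[symmetric])
      finally show ?thesis .
    qed
    have "(\<integral>\<^sup>+z. E z \<partial>\<gamma>) = (\<integral>\<^sup>+z. \<rho>' z * E z \<partial>?P)"
      unfolding \<gamma>_def by (subst nn_integral_density) auto
    also have "\<dots> = (\<integral>\<^sup>+x. \<integral>\<^sup>+y'. \<rho>' (x, y') * E (x, y') \<partial>\<nu> \<partial>\<mu>)"
      by (subst M2.nn_integral_fst) auto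
    also have "\<dots> \<le> (\<integral>\<^sup>+x. (\<integral>\<^sup>+y. \<rho> (x, y) * E0 (x, y) \<partial>\<nu>) + (\<Sum>j\<in>J. H j * (\<integral>\<^sup>+y. I j y * \<rho> (x, y) \<partial>\<nu>)) \<partial>\<mu>)"
    proof (intro nn_integral_mono_AE)
      show "AE x in \<mu>. (\<integral>\<^sup>+y'. \<rho>' (x, y') * E (x, y') \<partial>\<nu>)
        \<le> (\<integral>\<^sup>+y. \<rho> (x, y) * E0 (x, y) \<partial>\<nu>) + (\<Sum>j\<in>J. H j * (\<integral>\<^sup>+y. I j y * \<rho> (x, y) \<partial>\<nu>))"
        using AE_spt[OF sets_left]
      proof eventually_elim
        case (elim x)
        define a where "a j = (\<integral>\<^sup>+y'. I j y' * E (x, y') \<partial>\<nu>)" for j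
        have aj: "s j x * a j \<le> (\<integral>\<^sup>+y. I j y * \<rho> (x, y) * (E0 (x, y) + H j) \<partial>\<nu>)" if j: "j \<in> J" for j
        proof -
          \<comment> \<open>The left side does not depend on \<open>y\<close>, while every
            \<open>y\<close> of the cell is allowed on the right; the bound can therefore be
            integrated against the part of \<rho> in the cell.\<close>
          have a_le: "a j \<le> ennreal (n j) * (E0 (x, y) + H j)" if "q y = j" for y
          proof -
            have "a j \<le> (\<integral>\<^sup>+y'. I j y' * (E0 (x, y) + H j) \<partial>\<nu>)"
              unfolding a_def using leH[OF elim, of y] that j by (intro nn_integral_mono) (auto simp: I_eq)
            then show ?thesis by (simp add: nn_integral_multc nI)
          qed
          have "s j x * a j = ennreal (1 / n j) * (\<integral>\<^sup>+y. I j y * \<rho> (x, y) * a j \<partial>\<nu>)"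
            unfolding s_def by (subst nn_integral_multc) (simp_all add: mult.assoc)
          also have "\<dots> \<le> ennreal (1 / n j) * (\<integral>\<^sup>+y. ennreal (n j) * (I j y * \<rho> (x, y) * (E0 (x, y) + H j)) \<partial>\<nu>)"
          proof (intro mult_left_mono nn_integral_mono)
            fix y
            show "I j y * \<rho> (x, y) * a j \<le> ennreal (n j) * (I j y * \<rho> (x, y) * (E0 (x, y) + H j))"
              using a_le[of y] by (cases "q y = j") (auto simp: I_eq mult.left_commute[of _ "\<rho> (x, y)"] intro!: mult_left_mono)
          qed simp
          also have "\<dots> = ennreal (1 / n j) * ennreal (n j) * (\<integral>\<^sup>+y. I j y * \<rho> (x, y) * (E0 (x, y) + H j) \<partial>\<nu>)"
            by (simp add: nn_integral_cmult mult.assoc)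
          also have "ennreal (1 / n j) * ennreal (n j) = 1"
            using npos[OF j] by (simp add: ennreal_mult[symmetric])
          finally show ?thesis by simp
        qed
        have "(\<integral>\<^sup>+y'. \<rho>' (x, y') * E (x, y') \<partial>\<nu>) = (\<integral>\<^sup>+y'. (\<Sum>j\<in>J. s j x * (I j y' * E (x, y'))) \<partial>\<nu>)"
          unfolding \<rho>'_def sum_distrib_right fst_conv snd_conv
          by (intro nn_integral_cong sum.cong refl) (simp add: mult_ac)
        also have "\<dots> = (\<Sum>j\<in>J. s j x * a j)"
          unfolding a_def by (simp add: nn_integral_sum nn_integral_cmult)
        also have "\<dots> \<le> (\<Sum>j\<in>J. (\<integral>\<^sup>+y. I j y * \<rho> (x, y) * (E0 (x, y) + H j) \<partial>\<nu>))"
          by (intro sum_mono aj)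
        also have "\<dots> = (\<Sum>j\<in>J. (\<integral>\<^sup>+y. I j y * (\<rho> (x, y) * E0 (x, y)) \<partial>\<nu>) + H j * (\<integral>\<^sup>+y. I j y * \<rho> (x, y) \<partial>\<nu>))"
        proof (intro sum.cong refl)
          fix j
          have "(\<integral>\<^sup>+y. I j y * \<rho> (x, y) * (E0 (x, y) + H j) \<partial>\<nu>) = (\<integral>\<^sup>+y. I j y * (\<rho> (x, y) * E0 (x, y)) + H j * (I j y * \<rho> (x, y)) \<partial>\<nu>)"
            by (simp add: distrib_left mult_ac)
          also have "\<dots> = (\<integral>\<^sup>+y. I j y * (\<rho> (x, y) * E0 (x, y)) \<partial>\<nu>) + H j * (\<integral>\<^sup>+y. I j y * \<rho> (x, y) \<partial>\<nu>)"
            by (subst nn_integral_add) (auto simp: nn_integral_cmult)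
          finally show "(\<integral>\<^sup>+y. I j y * \<rho> (x, y) * (E0 (x, y) + H j) \<partial>\<nu>) = (\<integral>\<^sup>+y. I j y * (\<rho> (x, y) * E0 (x, y)) \<partial>\<nu>) + H j * (\<integral>\<^sup>+y. I j y * \<rho> (x, y) \<partial>\<nu>)" .
        qed
        also have "\<dots> = (\<integral>\<^sup>+y. (\<Sum>j\<in>J. I j y * (\<rho> (x, y) * E0 (x, y))) \<partial>\<nu>) + (\<Sum>j\<in>J. H j * (\<integral>\<^sup>+y. I j y * \<rho> (x, y) \<partial>\<nu>))"
          by (subst nn_integral_sum) (auto simp: sum.distrib)
        also have "\<dots> \<le> (\<integral>\<^sup>+y. \<rho> (x, y) * E0 (x, y) \<partial>\<nu>) + (\<Sum>j\<in>J. H j * (\<integral>\<^sup>+y. I j y * \<rho> (x, y) \<partial>\<nu>))"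
          by (intro add_right_mono nn_integral_mono) (simp add: sumI)
        finally show ?case .
      qed
    qed
    also have "\<dots> = (\<integral>\<^sup>+x. \<integral>\<^sup>+y. \<rho> (x, y) * E0 (x, y) \<partial>\<nu> \<partial>\<mu>) + (\<Sum>j\<in>J. H j * ennreal (n j))"
      by (subst nn_integral_add) (auto simp: nn_integral_sum nn_integral_cmult I\<rho>)
    also have "(\<Sum>j\<in>J. H j * ennreal (n j)) = (\<Sum>j\<in>J. (\<integral>\<^sup>+y. I j y * h y \<partial>\<nu>))"
      by (intro sum.cong refl) (subst mult.commute, rule nH)
    also have "\<dots> = (\<integral>\<^sup>+y. (\<Sum>j\<in>J. I j y * h y) \<partial>\<nu>)" by (simp add: nn_integral_sum)
    also have "\<dots> \<le> (\<integral>\<^sup>+y. h y \<partial>\<nu>)" by (intro nn_integral_mono) (simp add: sumI)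
    also have "(\<integral>\<^sup>+x. \<integral>\<^sup>+y. \<rho> (x, y) * E0 (x, y) \<partial>\<nu> \<partial>\<mu>) = (\<integral>\<^sup>+z. E0 z \<partial>density ?P \<rho>)"
      by (subst nn_integral_density, simp, simp, subst M2.nn_integral_fst[symmetric]) auto
    finally show ?thesis by (simp add: add_left_mono)
  qed
  then show thesis using that[OF \<gamma> ent] by blast
qed

end

section \<open>Near-optimal plans of low entropy\<close>

lemma (in borel_prob_pair) measurable_gap:
  fixes \<phi> :: "'a \<Rightarrow> real" and \<psi> :: "'b \<Rightarrow> real" and c :: "'a \<times> 'b \<Rightarrow> real"
  assumes c: "continuous_on (spt \<mu> \<times> spt \<nu>) c"
    and [measurable]: "\<phi> \<in> borel_measurable borel" "\<psi> \<in> borel_measurable borel"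
  shows "(\<lambda>z. indicator (spt \<mu> \<times> spt \<nu>) z * (c z - \<phi> (fst z) - \<psi> (snd z))) \<in> borel_measurable borel"
proof -
  have eq: "indicator (spt \<mu> \<times> spt \<nu>) z * (c z - \<phi> (fst z) - \<psi> (snd z))
    = indicator (spt \<mu> \<times> spt \<nu>) z *\<^sub>R c z - indicator (spt \<mu> \<times> spt \<nu>) z * (\<phi> (fst z) + \<psi> (snd z))" for z
    by (simp add: algebra_simps)
  show ?thesis unfolding eq using measurable_cost[OF c] by measurable
qed

text \<open>The marginals fix the integral of the potentials, so the gap integrates to cost minus
  dual value. The gap is nonnegative on the supports, which gives weak duality and lets it be
  handled as an \<open>ennreal\<close> integral without further integrability checks.\<close>

lemma (in borel_prob_pair) transport_cost_gap:
  fixes \<phi> :: "'a \<Rightarrow> real" and \<psi> :: "'b \<Rightarrow> real" and c :: "'a \<times> 'b \<Rightarrow> real"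
  assumes \<gamma>: "\<gamma> \<in> couplings \<mu> \<nu>" and c: "continuous_on (spt \<mu> \<times> spt \<nu>) c"
    and \<phi>: "\<phi> \<in> borel_measurable borel" "\<And>x. \<bar>\<phi> x\<bar> \<le> B" and \<psi>: "\<psi> \<in> borel_measurable borel" "\<And>y. \<bar>\<psi> y\<bar> \<le> B'"
    and le: "\<forall>x\<in>spt \<mu>. \<forall>y\<in>spt \<nu>. \<phi> x + \<psi> y \<le> c (x, y)"
  shows "(\<integral>x. \<phi> x \<partial>\<mu>) + (\<integral>y. \<psi> y \<partial>\<nu>) \<le> transport_cost \<mu> \<nu> c \<gamma>"
    "(\<integral>\<^sup>+z. ennreal (indicator (spt \<mu> \<times> spt \<nu>) z * (c z - \<phi> (fst z) - \<psi> (snd z))) \<partial>\<gamma>)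
      = ennreal (transport_cost \<mu> \<nu> c \<gamma> - ((\<integral>x. \<phi> x \<partial>\<mu>) + (\<integral>y. \<psi> y \<partial>\<nu>)))"
proof -
  let ?XY = "spt \<mu> \<times> spt \<nu>"
  let ?E = "\<lambda>z. indicator ?XY z *\<^sub>R c z - (\<phi> (fst z) + \<psi> (snd z))"
  note ip = integral_potentials[OF \<gamma> \<phi> \<psi>]
  have int: "integrable \<gamma> ?E" using integrable_cost[OF \<gamma> c] ip(1) by simp
  have eq: "(\<integral>z. ?E z \<partial>\<gamma>) = transport_cost \<mu> \<nu> c \<gamma> - ((\<integral>x. \<phi> x \<partial>\<mu>) + (\<integral>y. \<psi> y \<partial>\<nu>))"
    unfolding transport_cost_def set_lebesgue_integral_def using integrable_cost[OF \<gamma> c] ip by simp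
  have AE0: "AE z in \<gamma>. 0 \<le> ?E z \<and> indicator ?XY z * (c z - \<phi> (fst z) - \<psi> (snd z)) = ?E z"
    using AE_couplings[OF \<gamma> compact_left compact_right]
  proof eventually_elim
    case (elim z)
    then show ?case using le[rule_format, of "fst z" "snd z"] by auto
  qed
  then have pos: "AE z in \<gamma>. 0 \<le> ?E z" by (auto elim: eventually_mono)
  have "0 \<le> (\<integral>z. ?E z \<partial>\<gamma>)" by (rule integral_nonneg_AE[OF pos])
  then show "(\<integral>x. \<phi> x \<partial>\<mu>) + (\<integral>y. \<psi> y \<partial>\<nu>) \<le> transport_cost \<mu> \<nu> c \<gamma>" unfolding eq by simp
  have "(\<integral>\<^sup>+z. ennreal (indicator ?XY z * (c z - \<phi> (fst z) - \<psi> (snd z))) \<partial>\<gamma>) = (\<integral>\<^sup>+z. ennreal (?E z) \<partial>\<gamma>)"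
    using AE0 by (intro nn_integral_cong_AE) (auto elim: eventually_mono)
  also have "\<dots> = ennreal (\<integral>z. ?E z \<partial>\<gamma>)" by (rule nn_integral_eq_integral[OF int pos])
  finally show "(\<integral>\<^sup>+z. ennreal (indicator ?XY z * (c z - \<phi> (fst z) - \<psi> (snd z))) \<partial>\<gamma>)
      = ennreal (transport_cost \<mu> \<nu> c \<gamma> - ((\<integral>x. \<phi> x \<partial>\<mu>) + (\<integral>y. \<psi> y \<partial>\<nu>)))" unfolding eq .
qed

text \<open>Everything is inherited from \<open>c\<close> through the infimum. The oscillation bound
  contains \<open>C\<close> but not the bound \<open>B\<close> of \<phi>, and this keeps later
  constants independent of the potentials.\<close>

lemma inf_convolution:
  fixes c :: "'a::metric_space \<times> 'b::metric_space \<Rightarrow> real"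
  assumes X: "compact X" "X \<noteq> {}" and K: "compact K" and c: "continuous_on (X \<times> K) c"
    and \<phi>: "\<And>x. \<bar>\<phi> x\<bar> \<le> B" and bound: "\<forall>z\<in>X \<times> K. \<bar>c z\<bar> \<le> C"
  defines "\<psi> \<equiv> \<lambda>y. INF x\<in>X. c (x, y) - \<phi> x"
  shows "\<And>x y. x \<in> X \<Longrightarrow> y \<in> K \<Longrightarrow> \<phi> x + \<psi> y \<le> c (x, y)"
    and "\<And>y \<tau>. y \<in> K \<Longrightarrow> 0 < \<tau> \<Longrightarrow> \<exists>x\<in>X. c (x, y) < \<phi> x + \<psi> y + \<tau>"
    and "\<And>y. y \<in> K \<Longrightarrow> \<bar>\<psi> y\<bar> \<le> C + B"
    and "\<And>y y'. y \<in> K \<Longrightarrow> y' \<in> K \<Longrightarrow> \<bar>\<psi> y - \<psi> y'\<bar> \<le> 2 * C"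
    and "continuous_on K \<psi>"
proof -
  note C = bspec[OF bound]
  have bdd: "bdd_below ((\<lambda>x. c (x, y) - \<phi> x) ` X)" if "y \<in> K" for y
  proof (intro bdd_belowI2[where m = "- C - B"])
    fix x assume "x \<in> X"
    then show "- C - B \<le> c (x, y) - \<phi> x" using C[of "(x, y)"] \<phi>[of x] that by auto
  qed
  show le: "\<phi> x + \<psi> y \<le> c (x, y)" if "x \<in> X" "y \<in> K" for x y
    using cINF_lower[OF bdd[OF that(2)] that(1)] by (simp add: \<psi>_def)
  show inf: "\<exists>x\<in>X. c (x, y) < \<phi> x + \<psi> y + \<tau>" if "y \<in> K" "0 < \<tau>" for y \<tau>
    using cInf_lessD[of "(\<lambda>x. c (x, y) - \<phi> x) ` X" "\<psi> y + \<tau>"] X(2) that(2) by (auto simp: \<psi>_def algebra_simps)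
  \<comment> \<open>A common bound on the increments of all \<open>c (x, _)\<close> passes to the
    infimum. It yields the oscillation bound and, by uniform continuity of \<open>c\<close>,
    continuity.\<close>
  have lip: "\<psi> y - \<psi> y' \<le> t" if yy: "y \<in> K" "y' \<in> K" "\<And>x. x \<in> X \<Longrightarrow> c (x, y) - c (x, y') \<le> t" for y y' t
  proof (rule field_le_epsilon)
    fix \<tau> :: real assume "0 < \<tau>"
    then obtain x where "x \<in> X" "c (x, y') < \<phi> x + \<psi> y' + \<tau>" using inf[OF yy(2)] by blast
    then show "\<psi> y - \<psi> y' \<le> t + \<tau>" using le[of x y] yy(1) yy(3)[of x] by force
  qed
  show "\<bar>\<psi> y\<bar> \<le> C + B" if yK: "y \<in> K" for y
  proof (rule abs_leI)
    obtain x where x: "x \<in> X" using X(2) by blast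
    show "\<psi> y \<le> C + B" using le[OF x yK] C[of "(x, y)"] \<phi>[of x] x yK by auto
    show "- \<psi> y \<le> C + B"
    proof (rule field_le_epsilon)
      fix \<tau> :: real assume "0 < \<tau>"
      then obtain x where "x \<in> X" "c (x, y) < \<phi> x + \<psi> y + \<tau>" using inf[OF yK] by blast
      then show "- \<psi> y \<le> C + B + \<tau>" using C[of "(x, y)"] \<phi>[of x] yK by auto
    qed
  qed
  show "\<bar>\<psi> y - \<psi> y'\<bar> \<le> 2 * C" if "y \<in> K" "y' \<in> K" for y y'
  proof -
    have "\<bar>c (x, y)\<bar> \<le> C" "\<bar>c (x, y')\<bar> \<le> C" if "x \<in> X" for x
      using C \<open>y \<in> K\<close> \<open>y' \<in> K\<close> that by auto
    then have "c (x, y) - c (x, y') \<le> 2 * C" "c (x, y') - c (x, y) \<le> 2 * C" if "x \<in> X" for x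
      using that by (smt (verit))+
    then have "\<psi> y - \<psi> y' \<le> 2 * C" "\<psi> y' - \<psi> y \<le> 2 * C" using lip that by auto
    then show ?thesis by linarith
  qed
  show "continuous_on K \<psi>"
    unfolding continuous_on_iff
  proof (intro ballI allI impI)
    fix y and e :: real assume y: "y \<in> K" and "0 < e"
    have "uniformly_continuous_on (X \<times> K) c"
      using compact_uniformly_continuous[OF c] X(1) K by (simp add: compact_Times)
    then obtain d where d: "0 < d" "\<And>z z'. z \<in> X \<times> K \<Longrightarrow> z' \<in> X \<times> K \<Longrightarrow> dist z' z < d \<Longrightarrow> dist (c z') (c z) < e / 2"
      unfolding uniformly_continuous_on_def using \<open>0 < e\<close> by (meson half_gt_zero)
    have "dist (\<psi> y') (\<psi> y) < e" if y': "y' \<in> K" "dist y' y < d" for y'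
    proof -
      have "dist (c (x, y')) (c (x, y)) < e / 2" if "x \<in> X" for x
        using that y y' by (intro d) (auto simp: dist_Pair_Pair)
      then have lt: "\<bar>c (x, y') - c (x, y)\<bar> < e / 2" if "x \<in> X" for x
        using that by (simp add: dist_real_def)
      have "\<psi> y' - \<psi> y \<le> e / 2" using lt by (intro lip[OF y'(1) y]) (meson abs_le_D1 less_imp_le)
      moreover have "\<psi> y - \<psi> y' \<le> e / 2" using lt by (intro lip[OF y y'(1)]) (metis abs_minus_commute abs_le_D1 less_imp_le)
      ultimately show ?thesis using \<open>0 < e\<close> by (simp add: dist_real_def)
    qed
    then show "\<exists>d>0. \<forall>y'\<in>K. dist y' y < d \<longrightarrow> dist (\<psi> y') (\<psi> y) < e" using d(1) by blast
  qed
qed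

text \<open>At a near-minimiser \<open>x\<close> for \<open>y\<close>, the function
  \<open>c (x, _) - \<phi> x\<close> nearly equals \<psi> at \<open>y\<close> and lies above it at
  the two outer points, so \<psi> inherits its upper bound.\<close>

lemma inf_convolution_second_difference:
  fixes c :: "'a::real_normed_vector \<times> 'b::euclidean_space \<Rightarrow> real"
  assumes c: "second_derivs S c c' c''" and D: "convex D" "X \<times> D \<subseteq> S"
    and L: "\<And>x y. x \<in> X \<Longrightarrow> y \<in> D \<Longrightarrow> norm (c'' (x, y)) \<le> L"
    and \<psi>: "\<And>x y. x \<in> X \<Longrightarrow> y \<in> D \<Longrightarrow> \<phi> x + \<psi> y \<le> c (x, y)"
    and \<psi>_inf: "\<And>y \<tau>. y \<in> D \<Longrightarrow> 0 < \<tau> \<Longrightarrow> \<exists>x\<in>X. c (x, y) < \<phi> x + \<psi> y + \<tau>"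
    and y: "y \<in> D" "y + z \<in> D" "y - z \<in> D"
  shows "\<psi> (y + z) + \<psi> (y - z) - 2 * \<psi> y \<le> L * (norm z)\<^sup>2"
proof (rule field_le_epsilon)
  fix \<tau> :: real assume "0 < \<tau>"
  then obtain x where x: "x \<in> X" "c (x, y) < \<phi> x + \<psi> y + \<tau> / 2" using \<psi>_inf[OF y(1), of "\<tau> / 2"] by auto
  have "convex_on D (\<lambda>w. (-1) * c (x, w) + L / 2 * (norm (w - y))\<^sup>2)"
    using D x(1) by (intro convex_on_along_slice[OF c D(1)] L) auto
  from convex_on_midpoint[OF this y(2,3)]
  have "c (x, y + z) + c (x, y - z) - 2 * c (x, y) \<le> L * (norm z)\<^sup>2" by (simp add: algebra_simps)
  then show "\<psi> (y + z) + \<psi> (y - z) - 2 * \<psi> y \<le> L * (norm z)\<^sup>2 + \<tau>"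
    using \<psi>[OF x(1) y(2)] \<psi>[OF x(1) y(3)] x(2) by linarith
qed

lemma integrable_real_bounded:
  assumes "finite_measure M" "f \<in> borel_measurable M" "\<And>x. \<bar>f x :: real\<bar> \<le> B"
  shows "integrable M f"
  using assms by (intro finite_measure.integrable_const_bound[of M _ B]) auto

text \<open>\<open>ennreal\<close> sends negative numbers to zero, so the \<open>p i\<close> are
  first replaced by their positive parts, which can only increase the sum.\<close>

lemma ennreal_le_add_sum:
  fixes p :: "'i \<Rightarrow> real"
  assumes "t \<le> a + b + 2 * (\<Sum>i\<in>I. p i)" "0 \<le> a" "0 \<le> b"
  shows "ennreal t \<le> ennreal a + ennreal b + 2 * (\<Sum>i\<in>I. ennreal (p i))"
proof -
  have "(\<Sum>i\<in>I. p i) \<le> (\<Sum>i\<in>I. max 0 (p i))" by (intro sum_mono) simp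
  then have "t \<le> a + b + 2 * (\<Sum>i\<in>I. max 0 (p i))" using assms(1) by linarith
  then have "ennreal t \<le> ennreal (a + b + 2 * (\<Sum>i\<in>I. max 0 (p i)))" by (rule ennreal_leI)
  also have "\<dots> = ennreal a + ennreal b + ennreal (2 * (\<Sum>i\<in>I. max 0 (p i)))"
    using assms(2,3) by (simp add: sum_nonneg)
  also have "ennreal (2 * (\<Sum>i\<in>I. max 0 (p i))) = 2 * (\<Sum>i\<in>I. ennreal (p i))"
    by (simp add: ennreal_mult sum_nonneg flip: sum_ennreal)
  finally show ?thesis .
qed

text \<open>An \<epsilon>-optimal plan is blocked, and \<open>gap_doubling\<close> compares the
  gaps. Semiconcavity of \<psi> gives no pointwise lower bound of order \<epsilon> on its second
  differences; this is why the base point \<open>x0\<close> is independent of the plan and averaged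
  over the cell, so that only their integral against \<nu> matters.\<close>

lemma near_optimal_plan:
  fixes c :: "'a::euclidean_space \<times> 'b::euclidean_space \<Rightarrow> real"
  assumes "borel_prob_pair \<mu> \<nu>"
    and c: "second_derivs (\<Omega>m \<times> \<Omega>p) c c' c''" "continuous_on (\<Omega>m \<times> \<Omega>p) c''"
    and \<Omega>: "open \<Omega>p" "spt \<mu> \<subseteq> \<Omega>m" "spt \<nu> \<subseteq> \<Omega>p"
    and M: "0 < M" "\<And>f. f \<in> borel_measurable borel \<Longrightarrow> (\<integral>\<^sup>+x. f x \<partial>\<nu>) \<le> ennreal M * (\<integral>\<^sup>+x. f x \<partial>lborel)"
  obtains C \<delta> where "0 < C" "0 < \<delta>"
    "\<And>\<epsilon>. 0 < \<epsilon> \<Longrightarrow> \<epsilon> < \<delta> \<Longrightarrow> \<exists>\<gamma>\<in>couplings \<mu> \<nu>. Ent \<gamma> (\<mu> \<Otimes>\<^sub>M \<nu>) \<le> ereal (DIM('b) / 2 * ln (1 / \<epsilon>) + C) \<and>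
      (\<forall>\<gamma>'\<in>couplings \<mu> \<nu>. transport_cost \<mu> \<nu> c \<gamma> \<le> transport_cost \<mu> \<nu> c \<gamma>' + C * \<epsilon>)"
proof -
  interpret borel_prob_pair \<mu> \<nu> by fact
  let ?X = "spt \<mu>" and ?Y = "spt \<nu>"
  let ?Q = "cbox (- One) One :: 'b set"
  have X0: "?X \<noteq> {}"
  proof
    assume "?X = {}"
    then have "AE x in \<mu>. False" using AE_spt[OF sets_left] by simp
    then show False by (simp add: M1.AE_False)
  qed
  have Y0: "?Y \<noteq> {}"
  proof
    assume "?Y = {}"
    then have "AE x in \<nu>. False" using AE_spt[OF sets_right] by simp
    then show False by (simp add: M2.AE_False)
  qed
  have contc: "continuous_on (\<Omega>m \<times> \<Omega>p) c"
    using c(1) unfolding second_derivs_def by (intro continuous_at_imp_continuous_on) (auto dest: has_derivative_continuous)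
  obtain r where r: "0 < r" "(\<Union>y\<in>?Y. cball y r) \<subseteq> \<Omega>p"
    using compact_subset_open_imp_cball_epsilon_subset[OF compact_right \<Omega>(1,3)] by blast
  \<comment> \<open>The closed \<open>r\<close>-neighbourhood of the support: the reflected points
    and the vertices around \<open>x0\<close> may leave the support, so \<psi> has to obey its
    estimates on whole balls.\<close>
  define K where "K = (\<lambda>(y, v). y + v) ` (?Y \<times> cball 0 r)"
  have K: "compact K" unfolding K_def case_prod_unfold
    by (intro compact_continuous_image compact_Times compact_right continuous_intros) simp
  have ballK: "ball y r \<subseteq> K" if "y \<in> ?Y" for y
  proof
    fix w assume "w \<in> ball y r"
    then have "(y, w - y) \<in> ?Y \<times> cball 0 r" using that by (auto simp: dist_norm norm_minus_commute)
    then show "w \<in> K" unfolding K_def by force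
  qed
  have YK: "?Y \<subseteq> K" using ballK r(1) by (meson centre_in_ball subset_iff)
  have K\<Omega>: "K \<subseteq> \<Omega>p"
  proof
    fix w assume "w \<in> K"
    then obtain y v where "y \<in> ?Y" "norm v \<le> r" "w = y + v" by (auto simp: K_def)
    then have "w \<in> cball y r" by (simp add: dist_norm)
    then show "w \<in> \<Omega>p" using r(2) \<open>y \<in> ?Y\<close> by blast
  qed
  have XK\<Omega>: "?X \<times> K \<subseteq> \<Omega>m \<times> \<Omega>p" using \<Omega>(2) K\<Omega> by auto
  have cXK: "compact (?X \<times> K)" using compact_left K by (rule compact_Times)
  have contXK: "continuous_on (?X \<times> K) c" using contc XK\<Omega> continuous_on_subset by blast
  have contXY: "continuous_on (?X \<times> ?Y) c" using contXK YK continuous_on_subset[of "?X \<times> K" c "?X \<times> ?Y"] by blast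
  have "bounded (c ` (?X \<times> K))" using contXK cXK compact_continuous_image compact_imp_bounded by blast
  then obtain B where B: "0 < B" "\<And>z. z \<in> ?X \<times> K \<Longrightarrow> \<bar>c z\<bar> \<le> B"
    unfolding bounded_pos by (metis image_eqI real_norm_def)
  have bound: "\<forall>z\<in>?X \<times> K. \<bar>c z\<bar> \<le> B" using B(2) by blast
  have "bounded (c'' ` (?X \<times> K))"
    by (rule compact_imp_bounded[OF compact_continuous_image[OF continuous_on_subset[OF c(2) XK\<Omega>] cXK]])
  then obtain L where L: "0 < L" "\<And>z. z \<in> ?X \<times> K \<Longrightarrow> norm (c'' z) \<le> L"
    unfolding bounded_pos by (metis image_eqI)
  obtain BK where BK: "0 < BK" "\<And>y. y \<in> K \<Longrightarrow> norm y \<le> BK"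
    using compact_imp_bounded[OF K] unfolding bounded_pos by blast
  obtain V :: "'b set" where V: "finite V" "?Q = convex hull V"
    by (rule cube_convex_hull[of 1 "0 :: 'b"]) auto
  obtain R where R: "0 < R" "\<And>v. v \<in> ?Q \<Longrightarrow> norm v \<le> R"
    using bounded_cbox[of "- One" "One :: 'b"] unfolding bounded_pos by blast
  obtain Cg where Cg: "0 < Cg"
    "\<And>\<delta>. 0 < \<delta> \<Longrightarrow> \<delta> \<le> 1 \<Longrightarrow> \<exists>N (q :: 'b \<Rightarrow> nat). q \<in> borel \<rightarrow>\<^sub>M count_space UNIV \<and> (\<forall>x. q x < N \<longleftrightarrow> x \<in> ?Y) \<and>
       (\<forall>x\<in>?Y. \<forall>x'\<in>?Y. q x = q x' \<longrightarrow> (\<forall>b\<in>Basis. \<bar>(x - x') \<bullet> b\<bar> \<le> \<delta>)) \<and> real N \<le> Cg / \<delta> ^ DIM('b)"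
    using grid_partition[OF compact_imp_bounded[OF compact_right] measurable_supports(2)] by blast
  \<comment> \<open>\<open>integral_second_difference\<close> with radius \<open>r / 2\<close>
    controls the integral over the concentric ball of half that radius, so balls of radius
    \<open>r / 4\<close> have to cover.\<close>
  obtain F where F: "F \<subseteq> ?Y" "finite F" "?Y \<subseteq> (\<Union>b\<in>F. ball b (r / 4))"
  proof (rule compactE_image[OF compact_right, of ?Y "\<lambda>b. ball b (r / 4)"])
    show "?Y \<subseteq> (\<Union>b\<in>?Y. ball b (r / 4))" using r(1) by force
  qed auto
  define Lf where "Lf = L / 2 * BK\<^sup>2 + 4 * B"
  have Lf0: "0 \<le> Lf" unfolding Lf_def using L(1) B(1) by (intro add_nonneg_nonneg) auto
  define C2 where "C2 = (\<Sum>b\<in>F. 4 * Lf * measure lborel (ball b (r / 2)) / (r / 2)\<^sup>2)"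
  have C20: "0 \<le> C2" unfolding C2_def using Lf0 by (intro sum_nonneg) auto
  \<comment> \<open>\<open>C1 * \<epsilon>\<close> is the quadratic error of
    \<open>gap_doubling\<close> for \<open>l = 3 * sqrt \<epsilon>\<close>. In \<open>C3\<close>,
    the 2 comes from the doubled gap of the \<epsilon>-optimal plan and the last term from the
    second differences of \<psi> in the directions of \<open>V\<close>.\<close>
  define C1 where "C1 = (2 + 2 * card V) * (L * (3 * R)\<^sup>2)"
  have C10: "0 \<le> C1" using L(1) by (simp add: C1_def)
  define C3 where "C3 = 2 + C1 + 2 * card V * (M * (C2 * (3 * R)\<^sup>2))"
  have C3: "0 < C3" unfolding C3_def using C10 C20 M(1) by (intro add_pos_nonneg) auto
  define C where "C = C3 + \<bar>ln Cg\<bar>"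
  \<comment> \<open>Below \<open>(r / (6 * R))\<^sup>2\<close> the displacements, of norm at most
    \<open>3 * sqrt \<epsilon> * R\<close>, stay under \<open>r / 2\<close>; the bound 1 makes
    \<open>sqrt \<epsilon>\<close> an admissible mesh.\<close>
  define \<delta>0 where "\<delta>0 = min 1 ((r / (6 * R))\<^sup>2)"
  show thesis
  proof (rule that[of C \<delta>0])
    show "0 < C" using C3 by (simp add: C_def)
    show "0 < \<delta>0" using r(1) R(1) by (simp add: \<delta>0_def)
    fix \<epsilon> :: real assume \<epsilon>: "0 < \<epsilon>" "\<epsilon> < \<delta>0"
    define \<delta> where "\<delta> = sqrt \<epsilon>"
    have \<delta>: "0 < \<delta>" "\<delta> \<le> 1" "\<delta>\<^sup>2 = \<epsilon>" using \<epsilon> by (auto simp: \<delta>_def \<delta>0_def)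
    \<comment> \<open>Coordinates within a cell differ by at most \<delta>, so those of the
      reflected point \<open>2 *\<^sub>R y - y'\<close> differ from those of \<open>x0\<close> by at
      most \<open>2 * \<delta> + \<delta>\<close>.\<close>
    define l where "l = 3 * \<delta>"
    have l: "0 < l" using \<delta> by (simp add: l_def)
    have lR: "l * R < r / 2"
    proof -
      have "\<delta> < r / (6 * R)"
        unfolding \<delta>_def using \<epsilon> r(1) R(1) by (intro real_less_lsqrt) (auto simp: \<delta>0_def)
      then show ?thesis using R(1) by (simp add: l_def field_simps)
    qed
    have lR2: "(l * R)\<^sup>2 = (3 * R)\<^sup>2 * \<epsilon>" by (simp add: l_def power_mult_distrib \<delta>(3))
    obtain \<phi> \<psi>0 \<rho> where \<phi>m: "\<phi> \<in> borel_measurable borel" and \<phi>b: "bounded (range \<phi>)"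
      and \<psi>0m[measurable]: "\<psi>0 \<in> borel_measurable borel" and \<psi>0b: "bounded (range \<psi>0)"
      and \<psi>0: "\<And>x y. x \<in> ?X \<Longrightarrow> y \<in> ?Y \<Longrightarrow> \<phi> x + \<psi>0 y \<le> c (x, y)"
      and \<rho>: "\<rho> \<in> borel_measurable borel" "AE x in \<mu>. (\<integral>\<^sup>+y. \<rho> (x, y) \<partial>\<nu>) = 1" "AE y in \<nu>. (\<integral>\<^sup>+x. \<rho> (x, y) \<partial>\<mu>) = 1"
      and cost0: "transport_cost \<mu> \<nu> c (density (\<mu> \<Otimes>\<^sub>M \<nu>) \<rho>) \<le> (\<integral>x. \<phi> x \<partial>\<mu>) + (\<integral>y. \<psi>0 y \<partial>\<nu>) + \<epsilon>"
      using approx_kantorovich_duality[OF assms(1) contXY \<epsilon>(1)] by blast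
    obtain B\<phi> where B\<phi>: "\<And>x. \<bar>\<phi> x\<bar> \<le> B\<phi>" using \<phi>b unfolding bounded_iff by auto
    obtain B\<psi> where B\<psi>: "\<And>x. \<bar>\<psi>0 x\<bar> \<le> B\<psi>" using \<psi>0b unfolding bounded_iff by auto
    \<comment> \<open>\<open>\<psi>0\<close> comes with no regularity. Its replacement is the
      largest function compatible with \<phi>, so the dual value can only increase, and it makes
      sense on all of \<open>K\<close>.\<close>
    define \<psi>1 where "\<psi>1 y = (INF x\<in>?X. c (x, y) - \<phi> x)" for y
    note ic = inf_convolution[of ?X K c \<phi> B\<phi> B, OF compact_left X0 K contXK B\<phi> bound, folded \<psi>1_def]
    define \<psi> where "\<psi> y = indicator K y *\<^sub>R \<psi>1 y" for y
    have \<psi>K: "\<psi> y = \<psi>1 y" if "y \<in> K" for y using that by (simp add: \<psi>_def)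
    have Kb[measurable]: "K \<in> sets borel" using K by (simp add: borel_compact)
    have \<psi>m[measurable]: "\<psi> \<in> borel_measurable borel"
      unfolding \<psi>_def using Kb ic(5) by (rule borel_measurable_continuous_on_indicator)
    have \<psi>_le: "\<phi> x + \<psi> y \<le> c (x, y)" if "x \<in> ?X" "y \<in> K" for x y using ic(1)[OF that] \<psi>K[OF that(2)] by simp
    have \<psi>_inf: "\<exists>x\<in>?X. c (x, y) < \<phi> x + \<psi> y + \<tau>" if "y \<in> K" "0 < \<tau>" for y \<tau>
      using ic(2)[OF that] \<psi>K[OF that(1)] by simp
    have \<psi>b: "\<bar>\<psi> y\<bar> \<le> B + B\<phi>" for y
      using ic(3)[of y] B(1) B\<phi>[of undefined] by (cases "y \<in> K") (auto simp: \<psi>_def)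
    have \<psi>_osc: "\<bar>\<psi> y - \<psi> y'\<bar> \<le> 2 * B" if "y \<in> K" "y' \<in> K" for y y'
      using ic(4)[OF that] \<psi>K that by simp
    have \<psi>_le': "\<phi> x + \<psi> y \<le> c (x, y)" if "x \<in> ?X" "y \<in> ?Y" for x y using \<psi>_le that YK by blast
    have \<psi>0_le: "(\<integral>y. \<psi>0 y \<partial>\<nu>) \<le> (\<integral>y. \<psi> y \<partial>\<nu>)"
    proof (rule integral_mono_AE)
      show "integrable \<nu> \<psi>0" by (rule integrable_real_bounded[OF M2.finite_measure_axioms _ B\<psi>]) measurable
      show "integrable \<nu> \<psi>" by (rule integrable_real_bounded[OF M2.finite_measure_axioms _ \<psi>b]) measurable
      show "AE y in \<nu>. \<psi>0 y \<le> \<psi> y"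
        using AE_spt[OF sets_right]
      proof eventually_elim
        case (elim y)
        have "\<psi>0 y \<le> \<psi>1 y" unfolding \<psi>1_def
          using \<psi>0[OF _ elim] X0 by (intro cINF_greatest) (auto simp: algebra_simps)
        then show ?case using \<psi>K elim YK by auto
      qed
    qed
    let ?\<gamma>0 = "density (\<mu> \<Otimes>\<^sub>M \<nu>) \<rho>"
    have \<gamma>0: "?\<gamma>0 \<in> couplings \<mu> \<nu>" by (rule density_in_couplings[OF \<rho>])
    define S where "S = (\<integral>x. \<phi> x \<partial>\<mu>) + (\<integral>y. \<psi> y \<partial>\<nu>)"
    define E where "E z = indicator (?X \<times> ?Y) z * (c z - \<phi> (fst z) - \<psi> (snd z))" for z
    have Em[measurable]: "E \<in> borel_measurable borel" unfolding E_def by (rule measurable_gap[OF contXY \<phi>m \<psi>m])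
    have \<psi>_le'': "\<forall>x\<in>?X. \<forall>y\<in>?Y. \<phi> x + \<psi> y \<le> c (x, y)" using \<psi>_le' by blast
    note gap = transport_cost_gap[OF _ contXY \<phi>m B\<phi> \<psi>m \<psi>b \<psi>_le'', folded E_def S_def]
    have E0: "(\<integral>\<^sup>+z. ennreal (E z) \<partial>?\<gamma>0) \<le> ennreal \<epsilon>"
      unfolding gap(2)[OF \<gamma>0] using cost0 \<psi>0_le by (intro ennreal_leI) (simp add: S_def)
    obtain N and q :: "'b \<Rightarrow> nat" where q: "q \<in> borel \<rightarrow>\<^sub>M count_space UNIV" "\<And>x. q x < N \<longleftrightarrow> x \<in> ?Y"
      "\<And>x x' b. x \<in> ?Y \<Longrightarrow> x' \<in> ?Y \<Longrightarrow> q x = q x' \<Longrightarrow> b \<in> Basis \<Longrightarrow> \<bar>(x - x') \<bullet> b\<bar> \<le> \<delta>" "real N \<le> Cg / \<delta> ^ DIM('b)"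
      using Cg(2)[OF \<delta>(1,2)] by blast
    define P where "P y \<sigma> = L * (norm (l *\<^sub>R \<sigma>))\<^sup>2 - (\<psi> (y + l *\<^sub>R \<sigma>) + \<psi> (y - l *\<^sub>R \<sigma>) - 2 * \<psi> y)" for y \<sigma>
    have Pm[measurable]: "(\<lambda>y. P y \<sigma>) \<in> borel_measurable borel" for \<sigma> unfolding P_def by measurable
    have VQ: "v \<in> ?Q" if "v \<in> V" for v using that V(2) by (simp add: hull_inc)
    have normV: "norm (l *\<^sub>R v) \<le> l * R" if "v \<in> ?Q" for v
      using R(2)[OF that] l by (simp add: mult_left_mono)
    have point: "ennreal (E (x, y')) \<le> (2 * ennreal (E (x, y)) + ennreal (C1 * \<epsilon>)) + 2 * (\<Sum>\<sigma>\<in>V. ennreal (P x0 \<sigma>))"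
      if xy: "x \<in> ?X" "y \<in> ?Y" "y' \<in> ?Y" "x0 \<in> ?Y" "q y' = q y" "q x0 = q y" for x y y' x0
    proof -
      have in_ball: "x0 + l *\<^sub>R v \<in> ball x0 r" if "v \<in> ?Q" for v
        using normV[OF that] lR r(1) by (simp add: dist_norm)
      have BD: "ball x0 r \<subseteq> K" by (rule ballK[OF xy(4)])
      have coord: "(1 / l) *\<^sub>R (w - x0) \<in> ?Q" if co: "\<And>b. b \<in> Basis \<Longrightarrow> \<bar>(w - x0) \<bullet> b\<bar> \<le> l" for w
      proof -
        have "- 1 \<le> (w - x0) \<bullet> b / l \<and> (w - x0) \<bullet> b / l \<le> 1" if "b \<in> Basis" for b
          using co[OF that] l by (simp add: abs_le_iff divide_le_eq le_divide_eq)
        then show ?thesis by (simp add: mem_box)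
      qed
      have recon: "w = x0 + l *\<^sub>R ((1 / l) *\<^sub>R (w - x0))" for w using l by simp
      have b1: "\<bar>(y - x0) \<bullet> b\<bar> \<le> \<delta>" "\<bar>(y' - x0) \<bullet> b\<bar> \<le> \<delta>" if "b \<in> Basis" for b
        using q(3) xy that by auto
      have u0: "(1 / l) *\<^sub>R (y - x0) \<in> ?Q" using b1(1) \<delta> by (intro coord) (force simp: l_def)
      have u1: "(1 / l) *\<^sub>R (y' - x0) \<in> ?Q" using b1(2) \<delta> by (intro coord) (force simp: l_def)
      have u2: "(1 / l) *\<^sub>R ((2 *\<^sub>R y - y') - x0) \<in> ?Q"
      proof (rule coord)
        fix b :: 'b assume b: "b \<in> Basis"
        have "((2 *\<^sub>R y - y') - x0) \<bullet> b = 2 * ((y - x0) \<bullet> b) - (y' - x0) \<bullet> b"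
          by (simp add: inner_diff_left)
        then show "\<bar>((2 *\<^sub>R y - y') - x0) \<bullet> b\<bar> \<le> l" using b1[OF b] unfolding l_def by linarith
      qed
      have yD: "y \<in> ball x0 r" using in_ball[OF u0] recon[of y] by simp
      have "c (x, y') - \<phi> x - \<psi> y' \<le> 2 * (c (x, y) - \<phi> x - \<psi> y) + (2 + 2 * card V) * (L * (l * R)\<^sup>2) + 2 * (\<Sum>\<sigma>\<in>V. P x0 \<sigma>)"
        unfolding P_def
      proof (rule gap_doubling[OF c(1) convex_ball _ _ _ _ V R(2) in_ball xy(1) yD recon[of y'] recon[of "2 *\<^sub>R y - y'"] u1 u2])
        show "?X \<times> ball x0 r \<subseteq> \<Omega>m \<times> \<Omega>p" using XK\<Omega> BD by blast
        show "norm (c'' (x, y)) \<le> L" if "x \<in> ?X" "y \<in> ball x0 r" for x y using L(2) that BD by blast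
        show "\<phi> x + \<psi> y \<le> c (x, y)" if "x \<in> ?X" "y \<in> ball x0 r" for x y using \<psi>_le that BD by blast
        show "\<exists>x\<in>?X. c (x, y) < \<phi> x + \<psi> y + \<tau>" if "y \<in> ball x0 r" "0 < \<tau>" for y \<tau> using \<psi>_inf that BD by blast
      qed
      moreover have "(2 + 2 * card V) * (L * (l * R)\<^sup>2) = C1 * \<epsilon>" unfolding lR2 C1_def by simp
      ultimately have "E (x, y') \<le> 2 * E (x, y) + C1 * \<epsilon> + 2 * (\<Sum>\<sigma>\<in>V. P x0 \<sigma>)"
        using xy by (simp add: E_def)
      then have "ennreal (E (x, y')) \<le> ennreal (2 * E (x, y)) + ennreal (C1 * \<epsilon>) + 2 * (\<Sum>\<sigma>\<in>V. ennreal (P x0 \<sigma>))"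
        using xy \<psi>_le'[OF xy(1,2)] C10 \<epsilon> by (intro ennreal_le_add_sum) (auto simp: E_def)
      also have "ennreal (2 * E (x, y)) = 2 * ennreal (E (x, y))"
        using xy \<psi>_le'[OF xy(1,2)] by (subst ennreal_mult) (auto simp: E_def)
      finally show ?thesis .
    qed
    have P_int: "(\<integral>\<^sup>+y. ennreal (P y \<sigma>) \<partial>\<nu>) \<le> ennreal (M * (C2 * (3 * R)\<^sup>2) * \<epsilon>)" if \<sigma>: "\<sigma> \<in> V" for \<sigma>
    proof -
      let ?z = "l *\<^sub>R \<sigma>"
      have zn: "norm ?z \<le> l * R" using normV[OF VQ[OF \<sigma>]] .
      obtain y0 where y0: "y0 \<in> ?Y" using Y0 by blast
      \<comment> \<open>On \<open>K\<close> this is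
        \<open>L / 2 * (norm y)\<^sup>2 - \<psi> y\<close>, shifted by a constant into the range
        from \<open>- Lf\<close> to 0 that \<open>integral_second_difference\<close> asks for.
        Normalising \<psi> at \<open>y0\<close> leaves only its oscillation, at most
        \<open>2 * B\<close>, so \<open>Lf\<close> depends neither on \<phi> nor on \<epsilon>. The
        constant drops out of second differences, which are \<open>P y \<sigma>\<close> near the
        support.\<close>
      define f where "f y = indicator K y * (L / 2 * (norm y)\<^sup>2 - \<psi> y + \<psi> y0 - (L / 2 * BK\<^sup>2 + 2 * B))" for y
      have fm: "f \<in> borel_measurable borel" unfolding f_def by measurable
      have f_bounds: "- Lf \<le> f y \<and> f y \<le> 0" for y
      proof (cases "y \<in> K")
        case True
        have "\<bar>\<psi> y0 - \<psi> y\<bar> \<le> 2 * B" using True y0 YK by (intro \<psi>_osc) auto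
        moreover have "L / 2 * (norm y)\<^sup>2 \<le> L / 2 * BK\<^sup>2" using BK True L(1) by (intro mult_left_mono power_mono) auto
        moreover have "0 \<le> L / 2 * (norm y)\<^sup>2" using L(1) by simp
        ultimately show ?thesis using True unfolding f_def Lf_def by auto
      qed (use Lf0 in \<open>simp add: f_def\<close>)
      have ball_eq: "P y \<sigma> = f (y + ?z) + f (y - ?z) - 2 * f y \<and> 0 \<le> P y \<sigma>" if y: "y \<in> ball b (r / 2)" and b: "b \<in> F" for y b
      proof -
        have bK: "ball b r \<subseteq> K" using ballK F(1) b by blast
        have "dist b (y + ?z) \<le> dist b y + norm ?z" "dist b (y - ?z) \<le> dist b y + norm ?z"
          using dist_triangle[of b "y + ?z" y] dist_triangle[of b "y - ?z" y] by (simp_all add: dist_norm)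
        then have inb: "y \<in> ball b r" "y + ?z \<in> ball b r" "y - ?z \<in> ball b r"
          using y zn lR r(1) by auto
        then have inK: "y \<in> K" "y + ?z \<in> K" "y - ?z \<in> K" using bK by auto
        have sq: "(norm (y + ?z))\<^sup>2 + (norm (y - ?z))\<^sup>2 = 2 * (norm y)\<^sup>2 + 2 * (norm ?z)\<^sup>2"
          by (simp only: power2_norm_eq_inner) (simp add: inner_diff inner_add inner_commute)
        have "L / 2 * ((norm (y + ?z))\<^sup>2 + (norm (y - ?z))\<^sup>2 - 2 * (norm y)\<^sup>2) = L * (norm ?z)\<^sup>2"
          unfolding sq by simp
        then have "P y \<sigma> = f (y + ?z) + f (y - ?z) - 2 * f y"
          unfolding P_def f_def using inK by (simp add: algebra_simps)
        moreover have "\<psi> (y + ?z) + \<psi> (y - ?z) - 2 * \<psi> y \<le> L * (norm ?z)\<^sup>2"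
        proof (rule inf_convolution_second_difference[OF c(1) convex_ball _ _ _ _ inb])
          show "?X \<times> ball b r \<subseteq> \<Omega>m \<times> \<Omega>p" using XK\<Omega> bK by blast
          show "norm (c'' (x, y)) \<le> L" if "x \<in> ?X" "y \<in> ball b r" for x y using L(2) that bK by blast
          show "\<phi> x + \<psi> y \<le> c (x, y)" if "x \<in> ?X" "y \<in> ball b r" for x y using \<psi>_le that bK by blast
          show "\<exists>x\<in>?X. c (x, y) < \<phi> x + \<psi> y + \<tau>" if "y \<in> ball b r" "0 < \<tau>" for y \<tau> using \<psi>_inf that bK by blast
        qed
        ultimately show ?thesis unfolding P_def by simp
      qed
      have [measurable]: "ball b (r / 4) \<in> sets borel" for b :: 'b by simp
      have "(\<integral>\<^sup>+y. ennreal (P y \<sigma>) \<partial>\<nu>) = (\<integral>\<^sup>+y. ennreal (P y \<sigma>) * indicator ?Y y \<partial>\<nu>)"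
        using AE_spt[OF sets_right] by (intro nn_integral_cong_AE) (auto elim: eventually_mono)
      also have "\<dots> \<le> ennreal M * (\<integral>\<^sup>+y. ennreal (P y \<sigma>) * indicator ?Y y \<partial>lborel)"
        by (intro M(2)) measurable
      also have "\<dots> \<le> ennreal M * (\<integral>\<^sup>+y. (\<Sum>b\<in>F. ennreal (P y \<sigma>) * indicator (ball b (r / 4)) y) \<partial>lborel)"
      proof (intro mult_left_mono nn_integral_mono)
        fix y
        show "ennreal (P y \<sigma>) * indicator ?Y y \<le> (\<Sum>b\<in>F. ennreal (P y \<sigma>) * indicator (ball b (r / 4)) y)"
        proof (cases "y \<in> ?Y")
          case True
          then obtain b where b: "b \<in> F" "y \<in> ball b (r / 4)" using F(3) by blast
          then show ?thesis
            using member_le_sum[of b F "\<lambda>b. ennreal (P y \<sigma>) * indicator (ball b (r / 4)) y"] F(2) True by simp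
        qed simp
      qed simp
      also have "\<dots> = ennreal M * (\<Sum>b\<in>F. \<integral>\<^sup>+y. ennreal (P y \<sigma>) * indicator (ball b (r / 4)) y \<partial>lborel)"
        by (intro arg_cong[of _ _ "times (ennreal M)"] nn_integral_sum) measurable
      also have "\<dots> \<le> ennreal M * (\<Sum>b\<in>F. ennreal (4 * Lf * measure lborel (ball b (r / 2)) / (r / 2)\<^sup>2 * (l * R)\<^sup>2))"
      proof (intro mult_left_mono sum_mono)
        fix b assume b: "b \<in> F"
        have "(\<integral>\<^sup>+y. ennreal (P y \<sigma>) * indicator (ball b (r / 4)) y \<partial>lborel)
          = (\<integral>\<^sup>+y. ennreal (f (y + ?z) + f (y - ?z) - 2 * f y) * indicator (ball b (r / 2 / 2)) y \<partial>lborel)"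
        proof (intro nn_integral_cong)
          fix y
          show "ennreal (P y \<sigma>) * indicator (ball b (r / 4)) y = ennreal (f (y + ?z) + f (y - ?z) - 2 * f y) * indicator (ball b (r / 2 / 2)) y"
            using ball_eq[OF _ b, of y] r(1) by (auto split: split_indicator)
        qed
        also have "\<dots> \<le> ennreal (4 * Lf * measure lborel (ball b (r / 2)) / (r / 2)\<^sup>2 * (norm ?z)\<^sup>2)"
        proof (rule integral_second_difference[OF fm])
          show "- Lf \<le> f x" "f x \<le> 0" for x using f_bounds[of x] by auto
          show "0 < r / 2" "norm ?z \<le> r / 2" using r(1) zn lR by auto
          show "0 \<le> f (x + ?z) + f (x - ?z) - 2 * f x" if "x \<in> ball b (r / 2)" for x using ball_eq[OF that b] by simp
        qed
        also have "\<dots> \<le> ennreal (4 * Lf * measure lborel (ball b (r / 2)) / (r / 2)\<^sup>2 * (l * R)\<^sup>2)"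
          using zn Lf0 by (intro ennreal_leI mult_left_mono power_mono) auto
        finally show "(\<integral>\<^sup>+y. ennreal (P y \<sigma>) * indicator (ball b (r / 4)) y \<partial>lborel)
          \<le> ennreal (4 * Lf * measure lborel (ball b (r / 2)) / (r / 2)\<^sup>2 * (l * R)\<^sup>2)" .
      qed simp
      also have "(\<Sum>b\<in>F. ennreal (4 * Lf * measure lborel (ball b (r / 2)) / (r / 2)\<^sup>2 * (l * R)\<^sup>2)) = ennreal (C2 * (l * R)\<^sup>2)"
        unfolding C2_def sum_distrib_right using Lf0 by (intro sum_ennreal) auto
      also have "ennreal M * ennreal (C2 * (l * R)\<^sup>2) = ennreal (M * (C2 * (l * R)\<^sup>2))"
        using M(1) C20 by (intro ennreal_mult[symmetric]) auto
      finally show ?thesis unfolding lR2 by (simp add: mult.assoc)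
    qed
    obtain \<gamma> where \<gamma>: "\<gamma> \<in> couplings \<mu> \<nu>" and ent: "Ent \<gamma> (\<mu> \<Otimes>\<^sub>M \<nu>) \<le> ereal (ln N)"
      and blk: "\<And>E E0 h. E \<in> borel_measurable borel \<Longrightarrow> E0 \<in> borel_measurable borel \<Longrightarrow> h \<in> borel_measurable borel \<Longrightarrow>
        (\<And>x y y' x0. x \<in> spt \<mu> \<Longrightarrow> y \<in> spt \<nu> \<Longrightarrow> y' \<in> spt \<nu> \<Longrightarrow> x0 \<in> spt \<nu> \<Longrightarrow> q y' = q y \<Longrightarrow> q x0 = q y \<Longrightarrow>
          E (x, y') \<le> E0 (x, y) + h x0) \<Longrightarrow>
        (\<integral>\<^sup>+z. E z \<partial>\<gamma>) \<le> (\<integral>\<^sup>+z. E0 z \<partial>?\<gamma>0) + (\<integral>\<^sup>+y. h y \<partial>\<nu>)"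
      by (rule block_approximation[OF \<rho> q(1,2)]) blast
    interpret G0: prob_space ?\<gamma>0 using \<gamma>0 by (simp add: couplings_def)
    have "(\<integral>\<^sup>+z. ennreal (E z) \<partial>\<gamma>) \<le> (\<integral>\<^sup>+z. 2 * ennreal (E z) + ennreal (C1 * \<epsilon>) \<partial>?\<gamma>0) + (\<integral>\<^sup>+y. 2 * (\<Sum>\<sigma>\<in>V. ennreal (P y \<sigma>)) \<partial>\<nu>)"
      by (rule blk) (measurable, rule point)
    also have "(\<integral>\<^sup>+z. 2 * ennreal (E z) + ennreal (C1 * \<epsilon>) \<partial>?\<gamma>0) = 2 * (\<integral>\<^sup>+z. ennreal (E z) \<partial>?\<gamma>0) + ennreal (C1 * \<epsilon>)"
      using G0.emeasure_space_1 by (subst nn_integral_add) (auto simp: nn_integral_cmult)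
    also have "(\<integral>\<^sup>+y. 2 * (\<Sum>\<sigma>\<in>V. ennreal (P y \<sigma>)) \<partial>\<nu>) = 2 * (\<Sum>\<sigma>\<in>V. \<integral>\<^sup>+y. ennreal (P y \<sigma>) \<partial>\<nu>)"
      by (simp add: nn_integral_cmult nn_integral_sum)
    also have "2 * (\<integral>\<^sup>+z. ennreal (E z) \<partial>?\<gamma>0) + ennreal (C1 * \<epsilon>) + 2 * (\<Sum>\<sigma>\<in>V. \<integral>\<^sup>+y. ennreal (P y \<sigma>) \<partial>\<nu>)
      \<le> 2 * ennreal \<epsilon> + ennreal (C1 * \<epsilon>) + 2 * (\<Sum>\<sigma>\<in>V. ennreal (M * (C2 * (3 * R)\<^sup>2) * \<epsilon>))"
      using E0 P_int by (intro add_mono mult_left_mono sum_mono) auto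
    also have "\<dots> = ennreal (2 * \<epsilon> + C1 * \<epsilon> + 2 * (\<Sum>\<sigma>\<in>V. M * (C2 * (3 * R)\<^sup>2) * \<epsilon>))"
    proof -
      have a0: "0 \<le> M * (C2 * (3 * R)\<^sup>2) * \<epsilon>" using \<epsilon> C20 M(1) by simp
      have "2 * ennreal \<epsilon> = ennreal (2 * \<epsilon>)" using \<epsilon> ennreal_mult[of 2 \<epsilon>] by simp
      moreover have "2 * (\<Sum>\<sigma>\<in>V. ennreal (M * (C2 * (3 * R)\<^sup>2) * \<epsilon>)) = ennreal (2 * (\<Sum>\<sigma>\<in>V. M * (C2 * (3 * R)\<^sup>2) * \<epsilon>))"
        using ennreal_mult[of 2 "\<Sum>\<sigma>\<in>V. M * (C2 * (3 * R)\<^sup>2) * \<epsilon>"] a0 by (subst sum_ennreal) (simp_all only: sum_nonneg ennreal_numeral zero_le_numeral)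
      moreover have "ennreal (s + t + u) = ennreal s + ennreal t + ennreal u" if "0 \<le> s" "0 \<le> t" "0 \<le> u" for s t u
        using that by simp
      moreover have "0 \<le> 2 * (\<Sum>\<sigma>\<in>V. M * (C2 * (3 * R)\<^sup>2) * \<epsilon>)"
      proof -
        have "0 \<le> (\<Sum>\<sigma>\<in>V. M * (C2 * (3 * R)\<^sup>2) * \<epsilon>)" by (rule sum_nonneg) (rule a0)
        then show ?thesis by linarith
      qed
      ultimately show ?thesis using \<epsilon> C10 by simp
    qed
    also have "2 * \<epsilon> + C1 * \<epsilon> + 2 * (\<Sum>\<sigma>\<in>V. M * (C2 * (3 * R)\<^sup>2) * \<epsilon>) = C3 * \<epsilon>"
      by (simp add: C3_def algebra_simps)
    finally have "transport_cost \<mu> \<nu> c \<gamma> - S \<le> C3 * \<epsilon>"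
      unfolding gap(2)[OF \<gamma>] using C3 \<epsilon> by simp
    moreover have "C3 * \<epsilon> \<le> C * \<epsilon>" unfolding C_def using \<epsilon> by (intro mult_right_mono) auto
    \<comment> \<open>The dual value \<open>S\<close> bounds the cost of every competitor from
      below, so no optimal plan has to be named.\<close>
    ultimately have cost: "transport_cost \<mu> \<nu> c \<gamma> \<le> transport_cost \<mu> \<nu> c \<gamma>' + C * \<epsilon>" if "\<gamma>' \<in> couplings \<mu> \<nu>" for \<gamma>'
      using gap(1)[OF that] by linarith
    have N: "0 < N" using q(2) Y0 by (metis all_not_in_conv gr_zeroI not_less0)
    \<comment> \<open>The mesh \<open>sqrt \<epsilon>\<close> halves the exponent of the number of
      cells: this is the \<open>DIM('b) / 2\<close> of the expansion.\<close>
    have "ln N \<le> ln (Cg / \<delta> ^ DIM('b))" using q(4) N by (intro ln_mono) auto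
    also have "\<dots> = ln Cg - DIM('b) * ln \<delta>" using Cg(1) \<delta>(1) by (simp add: ln_div ln_realpow)
    also have "ln \<delta> = ln \<epsilon> / 2" unfolding \<delta>_def using \<epsilon> by (simp add: ln_sqrt)
    also have "ln Cg - DIM('b) * (ln \<epsilon> / 2) \<le> DIM('b) / 2 * ln (1 / \<epsilon>) + C"
      using \<epsilon> C3 by (simp add: ln_div C_def)
    finally have "ereal (ln N) \<le> ereal (DIM('b) / 2 * ln (1 / \<epsilon>) + C)" by simp
    with ent have "Ent \<gamma> (\<mu> \<Otimes>\<^sub>M \<nu>) \<le> ereal (DIM('b) / 2 * ln (1 / \<epsilon>) + C)" by (rule order_trans)
    then show "\<exists>\<gamma>\<in>couplings \<mu> \<nu>. Ent \<gamma> (\<mu> \<Otimes>\<^sub>M \<nu>) \<le> ereal (DIM('b) / 2 * ln (1 / \<epsilon>) + C) \<and>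
      (\<forall>\<gamma>'\<in>couplings \<mu> \<nu>. transport_cost \<mu> \<nu> c \<gamma> \<le> transport_cost \<mu> \<nu> c \<gamma>' + C * \<epsilon>)"
      using \<gamma> cost by blast
  qed
qed

section \<open>The expansion\<close>

lemma nn_integral_bounded_density:
  assumes f[measurable]: "f \<in> borel_measurable borel" and M: "0 \<le> M" "AE x in lborel. f x \<le> M"
    and [measurable]: "g \<in> borel_measurable borel"
  shows "(\<integral>\<^sup>+x. g x \<partial>density lborel (\<lambda>x. ennreal (f x))) \<le> ennreal M * (\<integral>\<^sup>+x. g x \<partial>lborel)"
proof -
  have "(\<integral>\<^sup>+x. g x \<partial>density lborel (\<lambda>x. ennreal (f x))) = (\<integral>\<^sup>+x. ennreal (f x) * g x \<partial>lborel)"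
    by (subst nn_integral_density) auto
  also have "\<dots> \<le> (\<integral>\<^sup>+x. ennreal M * g x \<partial>lborel)"
    using M(2) by (intro nn_integral_mono_AE) (auto elim!: eventually_mono intro!: mult_right_mono ennreal_leI)
  also have "\<dots> = ennreal M * (\<integral>\<^sup>+x. g x \<partial>lborel)" by (rule nn_integral_cmult) simp
  finally show ?thesis .
qed

theorem theorem1p1:
  fixes \<Omega>m \<Omega>p :: "(real^'n) set"
    and \<mu>m \<mu>p :: "(real^'n) measure"
    and fm fp :: "real^'n \<Rightarrow> real"
    and c :: "(real^'n) \<times> (real^'n) \<Rightarrow> real"
  assumes "open \<Omega>m" "convex \<Omega>m" "open \<Omega>p" "convex \<Omega>p"
    and "fm \<in> borel_measurable borel" "\<forall>x. 0 \<le> fm x" "\<exists>M. AE x in lborel. fm x \<le> M"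
    and "fp \<in> borel_measurable borel" "\<forall>x. 0 \<le> fp x" "\<exists>M. AE x in lborel. fp x \<le> M"
    and "\<mu>m = density lborel (\<lambda>x. ennreal (fm x))"
    and "\<mu>p = density lborel (\<lambda>x. ennreal (fp x))"
    and "prob_space \<mu>m" "prob_space \<mu>p"
    and "compact (spt \<mu>m)" "spt \<mu>m \<subseteq> \<Omega>m"
    and "compact (spt \<mu>p)" "spt \<mu>p \<subseteq> \<Omega>p"
    and "C2_on (\<Omega>m \<times> \<Omega>p) c"
    and "infinitesimally_twisted \<Omega>m \<Omega>p c"
  shows "\<bar>v_zero \<mu>m \<mu>p c\<bar> \<noteq> \<infinity> \<and>
    (\<exists>C \<delta>. \<delta> > 0 \<and> (\<forall>\<epsilon>. 0 < \<epsilon> \<and> \<epsilon> < \<delta> \<longrightarrow>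
       v_eps \<mu>m \<mu>p c \<epsilon> \<le> v_zero \<mu>m \<mu>p c + ereal (real CARD('n) / 2 * \<epsilon> * ln (1 / \<epsilon>) + C * \<epsilon>) \<and>
       v_zero \<mu>m \<mu>p c + ereal (real CARD('n) / 2 * \<epsilon> * ln (1 / \<epsilon>) - C * \<epsilon>) \<le> v_eps \<mu>m \<mu>p c \<epsilon>))"
proof -
  have sets: "sets \<mu>m = sets borel" "sets \<mu>p = sets borel"
    using assms(11,12) by simp_all
  have pair: "borel_prob_pair \<mu>m \<mu>p"
    using assms(13-15,17) sets by (simp add: borel_prob_pair_def borel_prob_pair_axioms_def)
  interpret borel_prob_pair \<mu>m \<mu>p by (rule pair)
  let ?X = "spt \<mu>m" and ?Y = "spt \<mu>p" and ?P = "\<mu>m \<Otimes>\<^sub>M \<mu>p"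
  obtain c' c'' where c: "second_derivs (\<Omega>m \<times> \<Omega>p) c c' c''" "continuous_on (\<Omega>m \<times> \<Omega>p) c''"
    using assms(19) unfolding C2_on_def by blast
  \<comment> \<open>\<open>infinitesimally_twisted\<close> speaks of every choice of derivatives of
    \<open>c\<close>, hence also of the one with continuous \<open>c''\<close> fixed here.\<close>
  have inv: "invertible (mixed_hessian c'' x y)" if "x \<in> \<Omega>m" "y \<in> \<Omega>p" for x y
    using assms(20) c(1) that unfolding infinitesimally_twisted_def by blast
  have "continuous_on (\<Omega>m \<times> \<Omega>p) c"
    using c(1) unfolding second_derivs_def by (intro continuous_at_imp_continuous_on) (auto dest: has_derivative_continuous)
  then have cont: "continuous_on (?X \<times> ?Y) c"
    by (rule continuous_on_subset) (use assms(16,18) in auto)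
  obtain Mm Mp where M0: "AE x in lborel. fm x \<le> Mm" "AE x in lborel. fp x \<le> Mp" using assms(7,10) by blast
  define M where "M = max 1 (max Mm Mp)"
  have M: "0 < M" by (simp add: M_def)
  have Mm: "AE x in lborel. fm x \<le> M" using M0(1) by eventually_elim (simp add: M_def)
  have Mp: "AE x in lborel. fp x \<le> M" using M0(2) by eventually_elim (simp add: M_def)
  have bm: "(\<integral>\<^sup>+x. f x \<partial>\<mu>m) \<le> ennreal M * (\<integral>\<^sup>+x. f x \<partial>lborel)" if "f \<in> borel_measurable borel" for f
    unfolding assms(11) using M Mm that assms(5) by (intro nn_integral_bounded_density) auto
  have bp: "(\<integral>\<^sup>+x. f x \<partial>\<mu>p) \<le> ennreal M * (\<integral>\<^sup>+x. f x \<partial>lborel)" if "f \<in> borel_measurable borel" for f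
    unfolding assms(12) using M Mp that assms(8) by (intro nn_integral_bounded_density) auto
  let ?T = "transport_cost \<mu>m \<mu>p c"
  \<comment> \<open>One bounded pair of potentials bounds all costs from below; with the product
    plan as competitor this makes \<open>v_zero\<close> finite.\<close>
  obtain \<phi>0 \<psi>0 \<rho>0 where pot0: "\<phi>0 \<in> borel_measurable borel" "bounded (range \<phi>0)" "\<psi>0 \<in> borel_measurable borel" "bounded (range \<psi>0)"
    "\<And>x y. x \<in> ?X \<Longrightarrow> y \<in> ?Y \<Longrightarrow> \<phi>0 x + \<psi>0 y \<le> c (x, y)"
    using approx_kantorovich_duality[OF pair cont, of 1] by (metis zero_less_one)
  obtain B\<phi> B\<psi> where B: "\<And>x. \<bar>\<phi>0 x\<bar> \<le> B\<phi>" "\<And>x. \<bar>\<psi>0 x\<bar> \<le> B\<psi>"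
    using pot0(2,4) unfolding bounded_iff by auto
  have lower0: "(\<integral>x. \<phi>0 x \<partial>\<mu>m) + (\<integral>y. \<psi>0 y \<partial>\<mu>p) \<le> ?T \<gamma>" if "\<gamma> \<in> couplings \<mu>m \<mu>p" for \<gamma>
    using transport_cost_gap(1)[OF that cont pot0(1) B(1) pot0(3) B(2)] pot0(5) by blast
  have v0_le: "v_zero \<mu>m \<mu>p c \<le> ereal (?T \<gamma>)" if "\<gamma> \<in> couplings \<mu>m \<mu>p" for \<gamma>
    unfolding v_zero_def by (rule INF_lower[OF that])
  have "ereal ((\<integral>x. \<phi>0 x \<partial>\<mu>m) + (\<integral>y. \<psi>0 y \<partial>\<mu>p)) \<le> v_zero \<mu>m \<mu>p c"
    unfolding v_zero_def by (intro INF_greatest) (simp add: lower0)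
  then have fin: "\<bar>v_zero \<mu>m \<mu>p c\<bar> \<noteq> \<infinity>"
    using v0_le[OF pair_in_couplings] by (cases "v_zero \<mu>m \<mu>p c") auto
  then obtain v where v: "v_zero \<mu>m \<mu>p c = ereal v" by (cases "v_zero \<mu>m \<mu>p c") auto
  obtain CL where CL: "0 < CL"
    "\<And>\<epsilon> \<phi> \<psi>. 0 < \<epsilon> \<Longrightarrow> \<phi> \<in> borel_measurable borel \<Longrightarrow> \<psi> \<in> borel_measurable borel \<Longrightarrow>
      (\<And>x y. x \<in> ?X \<Longrightarrow> y \<in> ?Y \<Longrightarrow> \<phi> x + \<psi> y \<le> c (x, y)) \<Longrightarrow>
      (\<integral>\<^sup>+z. ennreal (indicator (?X \<times> ?Y) z * exp (- (c z - \<phi> (fst z) - \<psi> (snd z)) / \<epsilon>)) \<partial>?P)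
        \<le> ennreal (CL * sqrt \<epsilon> ^ CARD('n))"
    by (rule laplace_bound[OF pair c assms(1,3,16,18) inv M bm bp]; (assumption | (rule that; (assumption | blast))))
  obtain CU \<delta> where CU: "0 < CU" "0 < \<delta>"
    "\<And>\<epsilon>. 0 < \<epsilon> \<Longrightarrow> \<epsilon> < \<delta> \<Longrightarrow> \<exists>\<gamma>\<in>couplings \<mu>m \<mu>p. Ent \<gamma> ?P \<le> ereal (DIM(real^'n) / 2 * ln (1 / \<epsilon>) + CU) \<and>
      (\<forall>\<gamma>'\<in>couplings \<mu>m \<mu>p. ?T \<gamma> \<le> ?T \<gamma>' + CU * \<epsilon>)"
    by (rule near_optimal_plan[OF pair c assms(3,16,18) M bp]; (assumption | (rule that; (assumption | blast))))
  \<comment> \<open>The upper bound loses \<open>CU * \<epsilon>\<close> in the cost and again in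
    \<epsilon> times the entropy. The lower bound loses \<epsilon> in the duality and
    \<open>\<epsilon> * ln CL\<close> through the logarithm of the Gaussian bound.\<close>
  define C where "C = max (2 * CU) (1 + ln CL)"
  show ?thesis
  proof (intro conjI fin exI[of _ C] exI[of _ \<delta>] allI impI CU(2); elim conjE)
    fix \<epsilon> :: real assume \<epsilon>: "0 < \<epsilon>" "\<epsilon> < \<delta>"
    obtain \<gamma> where \<gamma>: "\<gamma> \<in> couplings \<mu>m \<mu>p" "Ent \<gamma> ?P \<le> ereal (CARD('n) / 2 * ln (1 / \<epsilon>) + CU)"
      "\<And>\<gamma>'. \<gamma>' \<in> couplings \<mu>m \<mu>p \<Longrightarrow> ?T \<gamma> \<le> ?T \<gamma>' + CU * \<epsilon>"
      using CU(3)[OF \<epsilon>] by auto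
    have "ereal (?T \<gamma> - CU * \<epsilon>) \<le> v_zero \<mu>m \<mu>p c"
      unfolding v_zero_def using \<gamma>(3) by (intro INF_greatest) (simp add: diff_le_eq)
    then have T: "?T \<gamma> \<le> v + CU * \<epsilon>" using v by simp
    have "v_eps \<mu>m \<mu>p c \<epsilon> \<le> ereal (?T \<gamma>) + ereal \<epsilon> * Ent \<gamma> ?P"
      unfolding v_eps_def by (rule INF_lower[OF \<gamma>(1)])
    also have "\<dots> \<le> ereal (v + CU * \<epsilon>) + ereal \<epsilon> * ereal (CARD('n) / 2 * ln (1 / \<epsilon>) + CU)"
      using T \<gamma>(2) \<epsilon> by (intro add_mono ereal_mult_left_mono) auto
    also have "\<dots> \<le> v_zero \<mu>m \<mu>p c + ereal (real CARD('n) / 2 * \<epsilon> * ln (1 / \<epsilon>) + C * \<epsilon>)"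
    proof -
      have "2 * CU * \<epsilon> \<le> C * \<epsilon>" using \<epsilon> by (intro mult_right_mono) (auto simp: C_def)
      then show ?thesis unfolding v by (simp add: algebra_simps)
    qed
    finally show "v_eps \<mu>m \<mu>p c \<epsilon> \<le> v_zero \<mu>m \<mu>p c + ereal (real CARD('n) / 2 * \<epsilon> * ln (1 / \<epsilon>) + C * \<epsilon>)" .
  next
    fix \<epsilon> :: real assume \<epsilon>: "0 < \<epsilon>" "\<epsilon> < \<delta>"
    obtain \<phi> \<psi> \<rho> where \<phi>: "\<phi> \<in> borel_measurable borel" "bounded (range \<phi>)"
      and \<psi>: "\<psi> \<in> borel_measurable borel" "bounded (range \<psi>)"
      and le: "\<And>x y. x \<in> ?X \<Longrightarrow> y \<in> ?Y \<Longrightarrow> \<phi> x + \<psi> y \<le> c (x, y)"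
      and \<rho>: "\<rho> \<in> borel_measurable borel" "AE x in \<mu>m. (\<integral>\<^sup>+y. \<rho> (x, y) \<partial>\<mu>p) = 1" "AE y in \<mu>p. (\<integral>\<^sup>+x. \<rho> (x, y) \<partial>\<mu>m) = 1"
      and cost: "?T (density ?P \<rho>) \<le> (\<integral>x. \<phi> x \<partial>\<mu>m) + (\<integral>y. \<psi> y \<partial>\<mu>p) + \<epsilon>"
      using approx_kantorovich_duality[OF pair cont \<epsilon>(1)] by blast
    obtain B B' where B: "\<And>x. \<bar>\<phi> x\<bar> \<le> B" "\<And>x. \<bar>\<psi> x\<bar> \<le> B'"
      using \<phi>(2) \<psi>(2) unfolding bounded_iff by auto
    let ?S = "(\<integral>x. \<phi> x \<partial>\<mu>m) + (\<integral>y. \<psi> y \<partial>\<mu>p)" and ?Z = "CL * sqrt \<epsilon> ^ CARD('n)"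
    have S: "v \<le> ?S + \<epsilon>"
      using v0_le[OF density_in_couplings[OF \<rho>]] cost unfolding v by simp
    have Z: "0 < ?Z" using CL(1) \<epsilon> by simp
    have "ln ?Z = ln CL + CARD('n) * (ln \<epsilon> / 2)"
      using CL(1) \<epsilon> by (simp add: ln_mult ln_realpow ln_sqrt)
    then have "- (\<epsilon> * ln ?Z) = real CARD('n) / 2 * \<epsilon> * ln (1 / \<epsilon>) - ln CL * \<epsilon>"
      using \<epsilon> by (simp add: ln_div algebra_simps)
    moreover have "(1 + ln CL) * \<epsilon> \<le> C * \<epsilon>" using \<epsilon> by (intro mult_right_mono) (auto simp: C_def)
    ultimately have "v + (real CARD('n) / 2 * \<epsilon> * ln (1 / \<epsilon>) - C * \<epsilon>) \<le> ?S - \<epsilon> * ln ?Z"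
      using S by (simp add: algebra_simps)
    then have "v_zero \<mu>m \<mu>p c + ereal (real CARD('n) / 2 * \<epsilon> * ln (1 / \<epsilon>) - C * \<epsilon>) \<le> ereal (?S - \<epsilon> * ln ?Z)"
      unfolding v by simp
    also have "\<dots> \<le> v_eps \<mu>m \<mu>p c \<epsilon>"
      unfolding v_eps_def
    proof (rule INF_greatest)
      fix \<gamma> assume "\<gamma> \<in> couplings \<mu>m \<mu>p"
      then show "ereal (?S - \<epsilon> * ln ?Z) \<le> ereal (?T \<gamma>) + ereal \<epsilon> * Ent \<gamma> ?P"
        by (rule entropic_cost_ge[OF _ cont \<phi>(1) B(1) \<psi>(1) B(2) \<epsilon>(1) Z CL(2)[OF \<epsilon>(1) \<phi>(1) \<psi>(1) le]])
    qed
    finally show "v_zero \<mu>m \<mu>p c + ereal (real CARD('n) / 2 * \<epsilon> * ln (1 / \<epsilon>) - C * \<epsilon>) \<le> v_eps \<mu>m \<mu>p c \<epsilon>" .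
  qed
qed

end
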